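(* For each $d=1,2,\dots$ consider a finite-horizon Markov decision process with horizon $H$, compact state space $\mathsf S_d=B^d_{R_d}\subset\mathbb R^d$ and compact action space $\mathsf A_d=B^d_{A_d}\subset\mathbb R^d$ for some $R_d>0$, $A_d>0$, where $B_R^d$ is the Euclidean ball in $\mathbb R^d$ of radius $R$, with one-step transition densities $p^a_{d,h}(y|x)$ ($h=1,\dots,H$), rewards $R_{d,h}$ ($0\le h\le H-1$) and terminal reward $F_d$. Assume: (i) for each $d$ there are constants $\delta_d,\Lambda_d,L_d>0$ and a function $\mathcal L_d:\mathsf S_d\to\mathbb R_+$ with $\max\{\|\mathcal L_d\|_{L^1(\mathsf S_d)},\|\mathcal L_d\|_{L^\infty(\mathsf S_d)}\}\le L_d$ and $$0<\delta_d\le p^a_{d,h}(y|x)\le\Lambda_d,\qquad |p^{a_1}_{d,h}(y|x_1)-p^{a_2}_{d,h}(y|x_2)|\le\mathcal L_d(y)\bigl(|x_1-x_2|+\rho_{\mathsf A}(a_1,a_2)\bigr)$$ for all $x,x_1,x_2,y\in\mathsf S_d$, $a,a_1,a_2\in\mathsf A_d$, $h=1,\dots,H$; (ii) $\max\{|R_{d,h}(s,a)|,|F_d(s)|\}\le G$ for all $(s,a)\in\mathsf S_d\times\mathsf A_d$ and $0\le h\le H-1$, with $G$ uniform in $d$. If $R_d$, $A_d$ and $p^a_{d,h}(y|x)$ are such that $L_d$, $\Lambda_d$ and $\delta_d^{-1}$ can be taken to be polynomially bounded in $d$, then the complexity $\mathcal C(\epsilon,d)$ of the weighted mesh algorithm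 satisfies $$\mathcal C(\epsilon,d)\lesssim\frac{H^9G^4}{\epsilon^4}\,\mathrm{polynomial}(d).$$ In this case the mesh algorithm is tractable in the sense of Novak and Woźniakowski, that is, $$\lim_{d+\epsilon^{-1}\to\infty}\frac{\log\mathcal C(\epsilon,d)}{d+\epsilon^{-1}}=0.$$
   Context: **MDP.** Fix $d$ and drop it from the notation. $|\cdot|$ is the Euclidean norm and $\rho_{\mathsf A}$ the metric on $\mathsf A$. For $h=1,\dots,H$, $P_h(\cdot|x,a)$ is a probability kernel from $\mathsf S\times\mathsf A$ to $\mathsf S$ with Lebesgue density $y\mapsto p_h^a(y|x)$. A policy is $\boldsymbol\pi=(\pi_0,\dots,\pi_{H-1})$ with measurable $\pi_t:\mathsf S\to\mathcal P(\mathsf A)$ (probability measures on $\mathsf A$); $\Pi$ is the set of policies. Under $\boldsymbol\pi$, $A_t\sim\pi_t(S_t)$, $S_{t+1}\sim P_{t+1}(\cdot|S_t,A_t)$. The optimal value is $V_0^\star(x_0)=\sup_{\boldsymbol\pi\in\Pi}\mathbb E_{\boldsymbol\pi}\bigl[\sum_{t=0}^{H-1}R_t(S_t,A_t)+F(S_H)\,|\,S_0=x_0\bigr]$. **Weighted mesh algorithm.** Fix $x_0\in\mathsf S$ and controls $b_0,\dots,b_{H-1}\in\mathsf A$. Simulate independently for $n=1,\dots,N$ chains with $S_0^{(n)}=x_0$, $S_{h+1}^{(n)}\sim P_{h+1}(\cdot|S_h^{(n)},b_h)$. With $0/0=0$ let $$w_{h,n,N}(x,a)=\frac{p_{h+1}^a(S_{h+1}^{(n)}|x)}{\sum_{k\ne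 n}p_{h+1}^{b_h}(S_{h+1}^{(n)}|S_h^{(k)})}\Big/\sum_{n'=1}^N\frac{p_{h+1}^a(S_{h+1}^{(n')}|x)}{\sum_{k'\ne n'}p_{h+1}^{b_h}(S_{h+1}^{(n')}|S_h^{(k')})}.$$ Put $\overline V_H(S_H^{(n)})=F(S_H^{(n)})$ and, for $h=H-1,\dots,0$, $r=1,\dots,N$, $\overline V_h(S_h^{(r)})=\sup_{a\in\mathsf A}\bigl(R_h(S_h^{(r)},a)+\sum_{n=1}^N\overline V_{h+1}(S_{h+1}^{(n)})w_{h,n,N}(S_h^{(r)},a)\bigr)$. The output is $\overline V_0(x_0)$. **Complexity.** $\mathcal C(\epsilon,d)$ is the computational budget needed for computing $V_0^\star(x_0)$ in dimension $d$ by this algorithm with accuracy $\epsilon>0$ in $L^1$, i.e. $\mathbb E[|\overline V_0(x_0)-V_0^\star(x_0)|]\le\epsilon$. The overall cost with $N$ trajectories is identified with $HN^2$ (the cost of computing all weights); the cost of the optimization over $a$ is disregarded. **Notation.** $\lesssim$ denotes $\le$ up to an absolute proportionality constant; $\mathrm{polynomial}(d)$ denotes an expression polynomial in $d$.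
   Formalization: The action radius A_d is also assumed to be at most exp(polynomial(d)), without which the claim fails, and the complexity bound is stated for 0 < ε ≤ 2(H+1)G, since the cost of a run is positive while the bound vanishes as ε grows. *)

theory Defs
  imports "HOL-Probability.Probability" "HOL-Computational_Algebra.Polynomial"
begin

text \<open>Since the dimension \<open>d\<close> varies within a single statement, a point of \<open>d\<close>-dimensional
  Euclidean space is an extensional function on the index set \<open>{..<d}\<close>.\<close>

type_synonym point = "nat \<Rightarrow> real"

definition edist :: "nat \<Rightarrow> point \<Rightarrow> point \<Rightarrow> real" where
  "edist d x y = L2_set (\<lambda>i. x i - y i) {..<d}"

definition eball :: "nat \<Rightarrow> real \<Rightarrow> point set" where
  "eball d r = {x \<in> {..<d} \<rightarrow>\<^sub>E UNIV. L2_set x {..<d} \<le> r}"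

definition lebesgue_ball :: "nat \<Rightarrow> real \<Rightarrow> point measure" where
  "lebesgue_ball d r = restrict_space (PiM {..<d} (\<lambda>_. lborel)) (eball d r)"

text \<open>\<open>trans_dens M h a x y\<close> is the density at \<open>y\<close> of the transition into time \<open>h\<close>, given
  the state \<open>x\<close> and the action \<open>a\<close> at time \<open>h - 1\<close>.\<close>

record mdp =
  state_radius :: real
  action_radius :: real
  trans_dens :: "nat \<Rightarrow> point \<Rightarrow> point \<Rightarrow> point \<Rightarrow> real"
  reward :: "nat \<Rightarrow> point \<Rightarrow> point \<Rightarrow> real"
  terminal :: "point \<Rightarrow> real"

definition states :: "nat \<Rightarrow> mdp \<Rightarrow> point set" where
  "states d M = eball d (state_radius M)"

definition actions :: "nat \<Rightarrow> mdp \<Rightarrow> point set" where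
  "actions d M = eball d (action_radius M)"

definition state_space :: "nat \<Rightarrow> mdp \<Rightarrow> point measure" where
  "state_space d M = lebesgue_ball d (state_radius M)"

definition action_space :: "nat \<Rightarrow> mdp \<Rightarrow> point measure" where
  "action_space d M = lebesgue_ball d (action_radius M)"

definition trans_kernel :: "nat \<Rightarrow> mdp \<Rightarrow> nat \<Rightarrow> point \<Rightarrow> point \<Rightarrow> point measure" where
  "trans_kernel d M h x a = density (state_space d M) (\<lambda>y. ennreal (trans_dens M h a x y))"

text \<open>Joint Borel measurability of the rewards is what makes the expected total reward of
  every policy meaningful; no continuity is required of them.\<close>

definition is_mdp :: "nat \<Rightarrow> nat \<Rightarrow> mdp \<Rightarrow> bool" where
  "is_mdp d H M \<longleftrightarrow>
     0 < state_radius M \<and> 0 < action_radius M \<and>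
     (\<forall>h\<in>{1..H}.
        (\<forall>x\<in>states d M. \<forall>a\<in>actions d M.
           trans_dens M h a x \<in> borel_measurable (state_space d M) \<and>
           (\<forall>y\<in>states d M. 0 \<le> trans_dens M h a x y)) \<and>
        (\<lambda>(x, a). trans_kernel d M h x a)
          \<in> state_space d M \<Otimes>\<^sub>M action_space d M \<rightarrow>\<^sub>M prob_algebra (state_space d M)) \<and>
     (\<forall>h<H. (\<lambda>(x, a). reward M h x a)
        \<in> borel_measurable (state_space d M \<Otimes>\<^sub>M action_space d M)) \<and>
     terminal M \<in> borel_measurable (state_space d M)"

definition policies :: "nat \<Rightarrow> nat \<Rightarrow> mdp \<Rightarrow> (nat \<Rightarrow> point \<Rightarrow> point measure) set" where
  "policies d H M = {\<pi>. \<forall>t<H. \<pi> t \<in> state_space d M \<rightarrow>\<^sub>M prob_algebra (action_space d M)}"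

text \<open>The joint law of \<open>(S_0, ..., S_t)\<close> and \<open>(A_0, ..., A_{t-1})\<close> under a policy.\<close>

definition history_space ::
  "nat \<Rightarrow> mdp \<Rightarrow> nat \<Rightarrow> ((nat \<Rightarrow> point) \<times> (nat \<Rightarrow> point)) measure" where
  "history_space d M t = PiM {..t} (\<lambda>_. state_space d M) \<Otimes>\<^sub>M PiM {..<t} (\<lambda>_. action_space d M)"

primrec policy_law ::
  "nat \<Rightarrow> mdp \<Rightarrow> (nat \<Rightarrow> point \<Rightarrow> point measure) \<Rightarrow> point \<Rightarrow> nat
    \<Rightarrow> ((nat \<Rightarrow> point) \<times> (nat \<Rightarrow> point)) measure" where
  "policy_law d M \<pi> x0 0 = return (history_space d M 0) (\<lambda>i\<in>{..0}. x0, \<lambda>i\<in>{}. undefined)"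
| "policy_law d M \<pi> x0 (Suc t) =
     policy_law d M \<pi> x0 t \<bind> (\<lambda>(s, u).
       \<pi> t (s t) \<bind> (\<lambda>a.
         distr (trans_kernel d M (Suc t) (s t) a) (history_space d M (Suc t))
           (\<lambda>y. (s(Suc t := y), u(t := a)))))"

definition policy_value ::
  "nat \<Rightarrow> nat \<Rightarrow> mdp \<Rightarrow> (nat \<Rightarrow> point \<Rightarrow> point measure) \<Rightarrow> point \<Rightarrow> real" where
  "policy_value d H M \<pi> x0 =
     (\<integral>(s, u). (\<Sum>t<H. reward M t (s t) (u t)) + terminal M (s H) \<partial>policy_law d M \<pi> x0 H)"

definition optimal_value :: "nat \<Rightarrow> nat \<Rightarrow> mdp \<Rightarrow> point \<Rightarrow> real" where
  "optimal_value d H M x0 = (SUP \<pi>\<in>policies d H M. policy_value d H M \<pi> x0)"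

text \<open>The law of one chain \<open>(S_0, ..., S_t)\<close> driven by the fixed controls \<open>b\<close>.\<close>

primrec chain_law ::
  "nat \<Rightarrow> mdp \<Rightarrow> (nat \<Rightarrow> point) \<Rightarrow> point \<Rightarrow> nat \<Rightarrow> (nat \<Rightarrow> point) measure" where
  "chain_law d M b x0 0 = return (PiM {..0} (\<lambda>_. state_space d M)) (\<lambda>i\<in>{..0}. x0)"
| "chain_law d M b x0 (Suc t) =
     chain_law d M b x0 t \<bind> (\<lambda>s.
       distr (trans_kernel d M (Suc t) (s t) (b t)) (PiM {..Suc t} (\<lambda>_. state_space d M))
         (\<lambda>y. s(Suc t := y)))"

definition sample_law ::
  "nat \<Rightarrow> nat \<Rightarrow> mdp \<Rightarrow> (nat \<Rightarrow> point) \<Rightarrow> point \<Rightarrow> nat \<Rightarrow> (nat \<Rightarrow> nat \<Rightarrow> point) measure" where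
  "sample_law d H M b x0 N = PiM {..<N} (\<lambda>_. chain_law d M b x0 H)"

text \<open>In the following, \<open>\<omega> n h\<close> is the state at time \<open>h\<close> of the \<open>n\<close>-th of the \<open>N\<close> chains.\<close>

definition mesh_ratio ::
  "mdp \<Rightarrow> (nat \<Rightarrow> point) \<Rightarrow> nat \<Rightarrow> (nat \<Rightarrow> nat \<Rightarrow> point) \<Rightarrow> nat \<Rightarrow> nat \<Rightarrow> point \<Rightarrow> point \<Rightarrow> real" where
  "mesh_ratio M b N \<omega> h n x a =
     trans_dens M (Suc h) a x (\<omega> n (Suc h)) /
     (\<Sum>k\<in>{..<N} - {n}. trans_dens M (Suc h) (b h) (\<omega> k h) (\<omega> n (Suc h)))"

definition mesh_weight ::
  "mdp \<Rightarrow> (nat \<Rightarrow> point) \<Rightarrow> nat \<Rightarrow> (nat \<Rightarrow> nat \<Rightarrow> point) \<Rightarrow> nat \<Rightarrow> nat \<Rightarrow> point \<Rightarrow> point \<Rightarrow> real" where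
  "mesh_weight M b N \<omega> h n x a =
     mesh_ratio M b N \<omega> h n x a / (\<Sum>n'<N. mesh_ratio M b N \<omega> h n' x a)"

text \<open>\<open>mesh_value d H M b N \<omega> k x\<close> is the mesh estimate at time \<open>H - k\<close>; the recursion
  uses it only at the mesh points of that time, and at \<open>x0\<close> for \<open>k = H\<close>.\<close>

primrec mesh_value ::
  "nat \<Rightarrow> nat \<Rightarrow> mdp \<Rightarrow> (nat \<Rightarrow> point) \<Rightarrow> nat \<Rightarrow> (nat \<Rightarrow> nat \<Rightarrow> point) \<Rightarrow> nat \<Rightarrow> point \<Rightarrow> real" where
  "mesh_value d H M b N \<omega> 0 x = terminal M x"
| "mesh_value d H M b N \<omega> (Suc k) x =
     (SUP a\<in>actions d M.
        reward M (H - Suc k) x a +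
        (\<Sum>n<N. mesh_value d H M b N \<omega> k (\<omega> n (H - k)) * mesh_weight M b N \<omega> (H - Suc k) n x a))"

definition mesh_output ::
  "nat \<Rightarrow> nat \<Rightarrow> mdp \<Rightarrow> (nat \<Rightarrow> point) \<Rightarrow> point \<Rightarrow> nat \<Rightarrow> (nat \<Rightarrow> nat \<Rightarrow> point) \<Rightarrow> real" where
  "mesh_output d H M b x0 N \<omega> = mesh_value d H M b N \<omega> H x0"

text \<open>The output involves suprema over uncountable action sets of functions that are only
  Borel in the action, so as a random variable it is universally measurable (upper
  semianalytic), not necessarily Borel. Hence the expectation is taken with respect to the
  completed law.\<close>

definition mesh_error :: "nat \<Rightarrow> nat \<Rightarrow> mdp \<Rightarrow> (nat \<Rightarrow> point) \<Rightarrow> point \<Rightarrow> nat \<Rightarrow> ennreal" where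
  "mesh_error d H M b x0 N =
     (\<integral>\<^sup>+\<omega>. ennreal \<bar>mesh_output d H M b x0 N \<omega> - optimal_value d H M x0\<bar>
        \<partial>completion (sample_law d H M b x0 N))"

text \<open>The weights need \<open>N \<ge> 2\<close>: for \<open>N = 1\<close> the leave-one-out sums are empty. The value
  is \<open>\<infinity>\<close> if no \<open>N\<close> attains the accuracy. As a run has a positive minimal cost, a bound that vanishes as
  \<open>\<epsilon> \<rightarrow> \<infinity>\<close> can only hold for nontrivial accuracies; with all rewards bounded by \<open>G\<close>, any output
  is within \<open>2 * (H + 1) * G\<close> of the optimal value.\<close>

definition mesh_complexity ::
  "nat \<Rightarrow> mdp \<Rightarrow> (nat \<Rightarrow> point) \<Rightarrow> point \<Rightarrow> real \<Rightarrow> nat \<Rightarrow> ereal" where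
  "mesh_complexity H M b x0 \<epsilon> d =
     Inf {ereal (real H * real N ^ 2) | N. 2 \<le> N \<and> mesh_error d H M b x0 N \<le> ennreal \<epsilon>}"

definition regular_densities :: "nat \<Rightarrow> nat \<Rightarrow> mdp \<Rightarrow> real \<Rightarrow> real \<Rightarrow> real \<Rightarrow> bool" where
  "regular_densities d H M \<delta> \<Lambda> L \<longleftrightarrow>
     0 < \<delta> \<and> 0 < \<Lambda> \<and> 0 < L \<and>
     (\<forall>h\<in>{1..H}. \<forall>a\<in>actions d M. \<forall>x\<in>states d M. \<forall>y\<in>states d M.
        \<delta> \<le> trans_dens M h a x y \<and> trans_dens M h a x y \<le> \<Lambda>) \<and>
     (\<exists>lip. lip \<in> borel_measurable (state_space d M) \<and> (\<forall>y\<in>states d M. 0 \<le> lip y) \<and>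
        (\<integral>\<^sup>+y. ennreal (lip y) \<partial>state_space d M) \<le> ennreal L \<and>
        (AE y in state_space d M. lip y \<le> L) \<and>
        (\<forall>h\<in>{1..H}. \<forall>a1\<in>actions d M. \<forall>a2\<in>actions d M.
          \<forall>x1\<in>states d M. \<forall>x2\<in>states d M. \<forall>y\<in>states d M.
            \<bar>trans_dens M h a1 x1 y - trans_dens M h a2 x2 y\<bar>
              \<le> lip y * (edist d x1 x2 + edist d a1 a2)))"

definition bounded_rewards :: "nat \<Rightarrow> nat \<Rightarrow> mdp \<Rightarrow> real \<Rightarrow> bool" where
  "bounded_rewards d H M G \<longleftrightarrow>
     (\<forall>h<H. \<forall>s\<in>states d M. \<forall>a\<in>actions d M. \<bar>reward M h s a\<bar> \<le> G) \<and>
     (\<forall>s\<in>states d M. \<bar>terminal M s\<bar> \<le> G)"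

text \<open>The radius of the action sets has to be controlled as well (at most exponential in a
  polynomial, so that the metric entropy of the action set is polynomial in \<open>d\<close>): the other
  bounds are compatible with arbitrarily rich families of densities on huge action sets. A bound
  on the radius of the state space follows from the lower bound \<open>\<delta> d\<close> on the densities.\<close>

definition mesh_problem ::
  "real poly \<Rightarrow> real poly \<Rightarrow> real poly \<Rightarrow> real poly \<Rightarrow> nat \<Rightarrow> real \<Rightarrow> (nat \<Rightarrow> mdp) \<Rightarrow> (nat \<Rightarrow> point)
    \<Rightarrow> (nat \<Rightarrow> nat \<Rightarrow> point) \<Rightarrow> (nat \<Rightarrow> real) \<Rightarrow> (nat \<Rightarrow> real) \<Rightarrow> (nat \<Rightarrow> real) \<Rightarrow> bool" where
  "mesh_problem pL p\<Lambda> p\<delta> pA H G M x0 b \<delta> \<Lambda> L \<longleftrightarrow>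
     1 \<le> H \<and>
     (\<forall>d\<ge>1. is_mdp d H (M d) \<and>
        regular_densities d H (M d) (\<delta> d) (\<Lambda> d) (L d) \<and> bounded_rewards d H (M d) G \<and>
        x0 d \<in> states d (M d) \<and> (\<forall>h<H. b d h \<in> actions d (M d)) \<and>
        L d \<le> poly pL (real d) \<and> \<Lambda> d \<le> poly p\<Lambda> (real d) \<and> 1 / \<delta> d \<le> poly p\<delta> (real d) \<and>
        action_radius (M d) \<le> exp (poly pA (real d)))"

text \<open>The limit \<open>d + 1/\<epsilon> \<rightarrow> \<infinity>\<close> over all dimensions \<open>d \<ge> 1\<close> and accuracies \<open>\<epsilon> > 0\<close>.\<close>

definition tractability_filter :: "(nat \<times> real) filter" where
  "tractability_filter =
     inf (filtercomap (\<lambda>(d, \<epsilon>). real d + 1 / \<epsilon>) at_top) (principal {(d, \<epsilon>). 1 \<le> d \<and> 0 < \<epsilon>})"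

definition tractable :: "(real \<Rightarrow> nat \<Rightarrow> ereal) \<Rightarrow> bool" where
  "tractable C \<longleftrightarrow>
     (\<forall>d\<ge>1. \<forall>\<epsilon>>0. C \<epsilon> d < \<infinity>) \<and>
     ((\<lambda>(d, \<epsilon>). ln (real_of_ereal (C \<epsilon> d)) / (real d + 1 / \<epsilon>)) \<longlongrightarrow> 0) tractability_filter"

end

theory Submission
  imports Defs
begin

text \<open>The mesh weights sum to one, so the backward recursion is nonexpansive in the maximum norm over
  the mesh, and the error of the output is at most the sum over the \<open>H\<close> steps of the noise
  of a weighted average of the true value function, uniformly over all states and actions. The true
  value function is deterministic, which makes the steps independent of each other: no conditioning on
  earlier mesh points is needed. Up to an error of order \<open>1 / sqrt N\<close> without any supremum, each
  leave-one-out denominator may be replaced by \<open>N\<close> times the marginal density of the chain; what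
  remains is an empirical process of independent chains indexed by states and actions, bounded by chaining
  because the densities are Lipschitz. Chaining avoids logarithms of \<open>N\<close>, and the covering numbers
  enter only through their logarithms, which are polynomial in the dimension.

  As the rewards are merely Borel, comparing the pointwise suprema over actions in the algorithm with the
  supremum over measurable policies needs a measurable selection theorem. It is obtained from Choquet's
  capacitability argument applied to Borel sets, written as projections of closed sets.\<close>

section \<open>Measurable selection of near-optimal actions\<close>

text \<open>Suprema over actions need not be Borel in the state, while laws of controlled processes
  are only known on Borel sets. The way out is a Borel version of the value function that agrees
  with the supremum almost everywhere: all transitions have densities, so after time 0 neither a
  controlled process nor a mesh chain meets the exceptional null set, almost surely. The start
  \<open>x0\<close> is a single point which such an argument cannot reach; there the supremum over
  actions is kept as it stands. The mesh weights are quotients of random sums. The normalising sum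
  is the numerator for the constant function 1, so one uniform bound handles both. Suprema of random
  sums over states and actions are controlled through measurable majorants with small mean, so that
  their own measurability never matters. Value functions are bounded by \<open>(H + 1) * G\<close>,
  so one step has noise of order \<open>H * G / sqrt N\<close> times a polynomial in the dimension,
  and \<open>H\<close> steps give \<open>H^2 * G / sqrt N\<close>. Accuracy \<epsilon> takes
  \<open>N\<close> of order \<open>H^4 * G^2 / \<epsilon>^2\<close>; the cost \<open>H * N^2\<close>
  then has the exponents 9, 4 and 4.\<close>

definition suslin :: "'a::topological_space set \<Rightarrow> bool" where
  "suslin E \<longleftrightarrow> (\<exists>C :: ('a \<times> (nat \<Rightarrow> nat)) set. closed C \<and> E = fst ` C)"

lemma suslin_closed: "closed E \<Longrightarrow> suslin E"
  unfolding suslin_def by (intro exI[of _ "E \<times> UNIV"]) (auto intro: closed_Times)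

text \<open>One code \<sigma> carries countably many codes at once through the pairing
  \<open>prod_encode\<close>. Decoding the \<open>n\<close>-th of them is continuous, so demanding
  that all of them be valid keeps the set of pairs closed.\<close>

lemma suslin_INT:
  fixes E :: "nat \<Rightarrow> 'a::topological_space set"
  assumes "\<And>n. suslin (E n)"
  shows "suslin (\<Inter>n. E n)"
proof -
  obtain C :: "nat \<Rightarrow> ('a \<times> (nat \<Rightarrow> nat)) set" where C: "\<And>n. closed (C n)" "\<And>n. E n = fst ` C n"
    using assms unfolding suslin_def by metis
  define D where "D = (\<Inter>n. (\<lambda>(z, \<sigma>). (z, \<lambda>k. \<sigma> (prod_encode (n, k)))) -` C n)"
  have "closed D"
    unfolding D_def split_def
    by (intro closed_INT ballI closed_vimage C continuous_intros continuous_on_fst continuous_on_id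
        continuous_on_product_then_coordinatewise[OF continuous_on_snd])
  moreover have "(\<Inter>n. E n) = fst ` D"
  proof (intro equalityI subsetI)
    fix z assume "z \<in> (\<Inter>n. E n)"
    then have "\<forall>n. \<exists>\<tau>. (z, \<tau>) \<in> C n" using C(2) by force
    then obtain \<tau> where \<tau>: "\<And>n. (z, \<tau> n) \<in> C n" by metis
    then have "(z, \<lambda>m. case prod_decode m of (n, k) \<Rightarrow> \<tau> n k) \<in> D"
      by (simp add: D_def)
    then show "z \<in> fst ` D" by force
  qed (force simp: D_def C(2))
  ultimately show ?thesis unfolding suslin_def by blast
qed

text \<open>The entry \<open>\<sigma> 0\<close> names a member of the union, and the rest of
  \<sigma> is a code for that member. The implication from \<open>\<sigma> 0 = n\<close> to validity
  is a closed condition because the naturals are discrete, which makes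
  \<open>\<sigma> 0 \<noteq> n\<close> closed.\<close>

lemma suslin_UN:
  fixes E :: "nat \<Rightarrow> 'a::topological_space set"
  assumes "\<And>n. suslin (E n)"
  shows "suslin (\<Union>n. E n)"
proof -
  obtain C :: "nat \<Rightarrow> ('a \<times> (nat \<Rightarrow> nat)) set" where C: "\<And>n. closed (C n)" "\<And>n. E n = fst ` C n"
    using assms unfolding suslin_def by metis
  define D where "D = (\<Inter>n. ((\<lambda>(z, \<sigma>). \<sigma> 0) -` (- {n})) \<union> (\<lambda>(z, \<sigma>). (z, \<lambda>k. \<sigma> (Suc k))) -` C n)"
  have "open {n}" for n :: nat
    by (rule discrete_topology_class.open_discrete)
  then have c: "closed (- {n})" for n :: nat
    by (simp add: closed_def)
  have "closed D"
    unfolding D_def split_def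
    by (intro closed_INT ballI closed_Un closed_vimage C c continuous_intros continuous_on_fst continuous_on_id
        continuous_on_product_then_coordinatewise[OF continuous_on_snd])
  moreover have "(\<Union>n. E n) = fst ` D"
  proof (intro equalityI subsetI)
    fix z assume "z \<in> (\<Union>n. E n)"
    then obtain n \<tau> where "(z, \<tau>) \<in> C n" using C(2) by force
    then have "(z, case_nat n \<tau>) \<in> D"
      by (auto simp: D_def)
    then show "z \<in> fst ` D" by force
  qed (force simp: D_def C(2))
  ultimately show ?thesis unfolding suslin_def by blast
qed

text \<open>In a metric space an open set is the union of the closed sets of points at distance at
  least \<open>1 / Suc n\<close> from its complement. The whole space is treated apart: its
  complement is empty, where \<open>infdist\<close> is 0 by convention.\<close>

lemma suslin_open:
  fixes E :: "'a::metric_space set"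
  assumes "open E"
  shows "suslin E"
proof (cases "E = UNIV")
  case False
  define F where "F n = {x. 1 / real (Suc n) \<le> infdist x (- E)}" for n
  have ne: "- E \<noteq> {}" using False by auto
  have "closed (F n)" for n
    unfolding F_def by (intro closed_Collect_le continuous_intros continuous_on_infdist)
  moreover have "E = (\<Union>n. F n)"
  proof (intro equalityI subsetI)
    fix x assume "x \<in> E"
    then have "infdist x (- E) > 0"
      using assms ne by (metis closed_Compl in_closed_iff_infdist_zero ComplD infdist_nonneg less_eq_real_def)
    then obtain n where "1 / real (Suc n) < infdist x (- E)"
      using nat_approx_posE by blast
    then show "x \<in> (\<Union>n. F n)" unfolding F_def by (auto intro: less_imp_le simp del: of_nat_Suc)
  next
    fix x assume "x \<in> (\<Union>n. F n)"
    then obtain n where "1 / real (Suc n) \<le> infdist x (- E)" by (auto simp: F_def)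
    moreover have "1 / real (Suc n) > 0" by simp
    ultimately have "infdist x (-E) > 0" by linarith
    then show "x \<in> E"
      by (metis ComplI infdist_zero less_irrefl)
  qed
  ultimately show ?thesis using suslin_UN suslin_closed by metis
qed (simp add: suslin_closed)

text \<open>Complements of Suslin sets need not be Suslin, so the induction carries the property for
  a set and its complement together. Complementation then only swaps the two, and countable unions
  and intersections exchange roles.\<close>

lemma suslin_borel:
  fixes E :: "'a::metric_space set"
  assumes "E \<in> sets borel"
  shows "suslin E"
proof -
  have "E \<in> sigma_sets UNIV {S. open S}" using assms by (simp add: borel_def)
  then have "suslin E \<and> suslin (- E)"
  proof induction
    case (Basic a)
    then show ?case by (auto intro: suslin_open suslin_closed)
  next
    case (Union a)
    then show ?case by (auto intro: suslin_UN suslin_INT)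
  qed (auto intro: suslin_closed simp: Compl_eq_Diff_UNIV[symmetric])
  then show ?thesis ..
qed

section \<open>Compact sets of codes and Choquet capacitability\<close>

lemma compact_bounded_sequences: "compact {\<sigma> :: nat \<Rightarrow> nat. \<forall>i. \<sigma> i \<le> n i}"
proof -
  have "{\<sigma> :: nat \<Rightarrow> nat. \<forall>i. \<sigma> i \<le> n i} = (\<Pi>\<^sub>E i\<in>UNIV. {..n i})" by (auto simp: PiE_def)
  moreover have "compactin (product_topology (\<lambda>_. euclidean) UNIV) (\<Pi>\<^sub>E i\<in>UNIV. {..n i})"
    by (subst compactin_PiE) (auto simp: finite_imp_compact)
  ultimately show ?thesis
    by (simp add: euclidean_product_topology compactin_euclidean_iff)
qed

lemma tendsto_fun_iff:
  fixes f :: "'c \<Rightarrow> 'i \<Rightarrow> 'a::topological_space"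
  shows "(f \<longlongrightarrow> l) F \<longleftrightarrow> (\<forall>i. ((\<lambda>c. f c i) \<longlongrightarrow> l i) F)"
  using limitin_componentwise[of "\<lambda>_. euclidean" UNIV f l F]
  by (simp add: euclidean_product_topology)

text \<open>Choquet's capacitability argument: since the outer measure is continuous along increasing
  unions, the entries of the codes can be bounded one after the other with a small loss.\<close>

lemma closed_projection_inner_approx:
  fixes C :: "(('a::metric_space \<times> 'b::metric_space) \<times> (nat \<Rightarrow> nat)) set"
  assumes "finite_measure \<mu>" and sets: "sets \<mu> = sets borel"
    and C: "closed C" "fst ` C \<subseteq> X \<times> Y" "compact X" "compact Y"
    and c: "c < outer_measure_of \<mu> (fst ` fst ` C)"
  shows "\<exists>K. compact K \<and> K \<subseteq> fst ` C \<and> c \<le> emeasure \<mu> (fst ` K)"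
proof -
  interpret finite_measure \<mu> by fact
  have sp: "space \<mu> = UNIV" using sets_eq_imp_space_eq[OF sets] by simp
  define D where "D ns = fst ` fst ` {p \<in> C. \<forall>i<length ns. snd p i \<le> ns ! i}" for ns :: "nat list"
  have step: "\<exists>m. c < outer_measure_of \<mu> (D (ns @ [m]))" if "c < outer_measure_of \<mu> (D ns)" for ns
  proof -
    have "D ns = (\<Union>m. D (ns @ [m]))"
    proof (intro equalityI subsetI)
      fix x assume "x \<in> D ns"
      then obtain a \<sigma> where *: "((x, a), \<sigma>) \<in> C" "\<forall>i<length ns. \<sigma> i \<le> ns ! i"
        unfolding D_def by force
      then have "x \<in> D (ns @ [\<sigma> (length ns)])"
        unfolding D_def by (force simp: nth_append less_Suc_eq)
      then show "x \<in> (\<Union>m. D (ns @ [m]))" by blast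
    next
      fix x assume "x \<in> (\<Union>m. D (ns @ [m]))"
      then show "x \<in> D ns" unfolding D_def by (force simp: nth_append less_Suc_eq)
    qed
    \<comment> \<open>The projections \<open>D ns\<close> may fail to be measurable; the outer
      measure is nevertheless continuous along increasing unions.\<close>
    moreover have "(SUP m. outer_measure_of \<mu> (D (ns @ [m]))) = outer_measure_of \<mu> (\<Union>m. D (ns @ [m]))"
    proof (rule SUP_outer_measure_of_incseq)
      show "incseq (\<lambda>m. D (ns @ [m]))"
        unfolding D_def incseq_def
        by (intro allI impI image_mono) (auto simp: nth_append less_Suc_eq intro: order_trans)
    qed (simp add: sp)
    ultimately show ?thesis using that by (metis (no_types, lifting) less_SUP_iff)
  qed
  have "\<exists>f. \<forall>k. (c < outer_measure_of \<mu> (D (f k)) \<and> length (f k) = k) \<and> (\<exists>m. f (Suc k) = f k @ [m])"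
  proof (rule dependent_nat_choice)
    show "\<exists>ns. c < outer_measure_of \<mu> (D ns) \<and> length ns = 0"
      using c by (intro exI[of _ "[]"]) (simp add: D_def)
  next
    fix ns k assume "c < outer_measure_of \<mu> (D ns) \<and> length ns = k"
    then obtain m where "c < outer_measure_of \<mu> (D (ns @ [m]))" using step by blast
    then show "\<exists>y. (c < outer_measure_of \<mu> (D y) \<and> length y = Suc k) \<and> (\<exists>m. y = ns @ [m])"
      using \<open>c < _ \<and> length ns = k\<close> by (intro exI[of _ "ns @ [m]"]) auto
  qed
  then obtain f where f: "\<And>k. c < outer_measure_of \<mu> (D (f k))" "\<And>k. length (f k) = k"
    "\<And>k. \<exists>m. f (Suc k) = f k @ [m]" by blast
  define n where "n i = f (Suc i) ! i" for i
  have fn: "f k ! i = n i" if "i < k" for i k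
    using that
  proof (induction k)
    case (Suc k)
    obtain m where m: "f (Suc k) = f k @ [m]" using f(3) by blast
    show ?case
    proof (cases "i = k")
      case False
      then show ?thesis using Suc by (simp add: m nth_append f(2))
    qed (simp add: n_def)
  qed simp
  have Df: "D (f k) = fst ` fst ` {p \<in> C. \<forall>i<k. snd p i \<le> n i}" for k
    unfolding D_def f(2) using fn by (metis (no_types, lifting))
  define K where "K = fst ` (C \<inter> ((X \<times> Y) \<times> {\<sigma>. \<forall>i. \<sigma> i \<le> n i}))"
  have "compact K"
    unfolding K_def
    by (intro compact_continuous_image continuous_on_fst continuous_on_id closed_Int_compact C compact_Times
        compact_bounded_sequences)
  \<comment> \<open>A point of all the closures is approximated by points with codes whose first
    \<open>k\<close> entries obey the bounds. Compactness in the second coordinate and in the code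
    yields a limit in \<open>C\<close>, because \<open>C\<close> is closed.\<close>
  have sub: "(\<Inter>k. closure (D (f k))) \<subseteq> fst ` K"
  proof
    fix x assume x: "x \<in> (\<Inter>k. closure (D (f k)))"
    have "\<exists>y a \<sigma>. dist y x < 1 / Suc k \<and> ((y, a), \<sigma>) \<in> C \<and> (\<forall>i<k. \<sigma> i \<le> n i)" for k
    proof -
      have "x \<in> closure (D (f k))" using x by blast
      then obtain y where "y \<in> D (f k)" "dist y x < 1 / Suc k"
        by (metis closure_approachable of_nat_0_less_iff zero_less_Suc zero_less_divide_1_iff)
      then show ?thesis unfolding Df by force
    qed
    then obtain y a \<sigma> where yas: "\<And>k. dist (y k) x < 1 / Suc k" "\<And>k. ((y k, a k), \<sigma> k) \<in> C"
      "\<And>k i. i < k \<Longrightarrow> \<sigma> k i \<le> n i" by metis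
    \<comment> \<open>\<open>\<sigma> k\<close> obeys the bounds only in its first \<open>k\<close>
      entries. Truncation moves it into a compact set, and entry \<open>i\<close> is unaffected as
      soon as \<open>i < k\<close>, so the truncated and the original codes have the same pointwise
      limit along a subsequence.\<close>
    define \<tau> where "\<tau> k i = min (\<sigma> k i) (n i)" for k i
    have "compact (Y \<times> {\<sigma>. \<forall>i. \<sigma> i \<le> n i})"
      using C compact_Times compact_bounded_sequences by blast
    moreover have "a k \<in> Y" for k using yas(2)[of k] C(2) by force
    ultimately obtain l r where lr: "l \<in> Y \<times> {\<sigma>. \<forall>i. \<sigma> i \<le> n i}" "strict_mono r"
      "((\<lambda>k. (a k, \<tau> k)) \<circ> r) \<longlonglongrightarrow> l"
      using seq_compactE[OF compact_imp_seq_compact, of "Y \<times> {\<sigma>. \<forall>i. \<sigma> i \<le> n i}" "\<lambda>k. (a k, \<tau> k)"]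
      by (auto simp: \<tau>_def) blast
    obtain b \<rho> where l: "l = (b, \<rho>)" by force
    have a_lim: "(\<lambda>k. a (r k)) \<longlonglongrightarrow> b"
      using tendsto_fst[OF lr(3)] by (simp add: l o_def)
    have \<tau>_lim: "(\<lambda>k. \<tau> (r k)) \<longlonglongrightarrow> \<rho>"
      using tendsto_snd[OF lr(3)] by (simp add: l o_def)
    have \<sigma>_lim: "(\<lambda>k. \<sigma> (r k)) \<longlonglongrightarrow> \<rho>"
    unfolding tendsto_fun_iff
    proof
      fix i
      have "(\<lambda>k. \<tau> (r k) i) \<longlonglongrightarrow> \<rho> i"
        using \<tau>_lim by (simp add: tendsto_fun_iff)
      moreover have "\<forall>\<^sub>F k in sequentially. \<tau> (r k) i = \<sigma> (r k) i"
        using eventually_gt_at_top[of i]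
      proof eventually_elim
        case (elim k)
        then have "i < r k" using seq_suble[OF lr(2), of k] by linarith
        then show ?case using yas(3) by (simp add: \<tau>_def)
      qed
      ultimately show "(\<lambda>k. \<sigma> (r k) i) \<longlonglongrightarrow> \<rho> i" by (rule Lim_transform_eventually)
    qed
    have "(\<lambda>k. dist (y k) x) \<longlonglongrightarrow> 0"
      by (rule tendsto_sandwich[OF _ _ tendsto_const LIMSEQ_inverse_real_of_nat])
         (use yas(1) in \<open>auto intro!: always_eventually less_imp_le simp: inverse_eq_divide simp del: of_nat_Suc\<close>)
    then have "y \<longlonglongrightarrow> x" by (rule tendsto_dist_iff[THEN iffD2])
    then have "(\<lambda>k. y (r k)) \<longlonglongrightarrow> x" using LIMSEQ_subseq_LIMSEQ[OF _ lr(2)] by (auto simp: o_def)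
    then have "(\<lambda>k. ((y (r k), a (r k)), \<sigma> (r k))) \<longlonglongrightarrow> ((x, b), \<rho>)"
      by (intro tendsto_Pair a_lim \<sigma>_lim)
    then have "((x, b), \<rho>) \<in> C"
      by (rule closed_sequentially[OF C(1) yas(2)])
    moreover have "\<forall>i. \<rho> i \<le> n i" using lr(1) l by auto
    ultimately have "(x, b) \<in> K" unfolding K_def using C(2) by (force intro!: image_eqI[of "(x, b)" fst])
    then show "x \<in> fst ` K" by force
  qed
  \<comment> \<open>Closures are Borel, so from here on the outer measure is the measure itself and
    continuity from above applies.\<close>
  have "c \<le> emeasure \<mu> (closure (D (f k)))" for k
    using f(1)[of k] outer_measure_of_mono[OF closure_subset, of \<mu> "D (f k)"]
    by (simp add: sets)
  moreover have "decseq (\<lambda>k. closure (D (f k)))"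
    unfolding Df decseq_def by (intro allI impI closure_mono image_mono) auto
  ultimately have "c \<le> emeasure \<mu> (\<Inter>k. closure (D (f k)))"
    by (subst INF_emeasure_decseq[symmetric]) (auto simp: sets intro!: INF_greatest)
  also have "\<dots> \<le> emeasure \<mu> (fst ` K)"
    by (intro emeasure_mono sub)
       (use \<open>compact K\<close> in \<open>auto simp: sets intro!: borel_compact compact_continuous_image continuous_on_fst continuous_on_id\<close>)
  finally show ?thesis
    using \<open>compact K\<close> K_def by (intro exI[of _ K]) auto
qed

text \<open>The coordinates are minimised one after the other over the section of \<open>K\<close>,
  the earlier ones being held at their minima. Compactness of \<open>K\<close> makes every minimum
  attained and its sublevel sets Borel. Finitely many coordinates are enough for the application,
  since a point of a ball is determined by its first \<open>d\<close> ones.\<close>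

lemma lexicographic_selector:
  fixes K :: "('x::{metric_space,second_countable_topology} \<times> (nat \<Rightarrow> real)) set"
  assumes K: "compact K"
  shows "\<exists>m\<in>borel_measurable borel. \<forall>x\<in>fst ` K. \<exists>a. (x, a) \<in> K \<and> (\<forall>j<i. a j = m x j)"
proof (induction i)
  case 0
  show ?case by (intro bexI[of _ "\<lambda>_ _. 0"]) auto
next
  case (Suc i)
  then obtain m :: "'x \<Rightarrow> nat \<Rightarrow> real" where m[measurable]: "m \<in> borel_measurable borel"
    and mK: "\<And>x. x \<in> fst ` K \<Longrightarrow> \<exists>a. (x, a) \<in> K \<and> (\<forall>j<i. a j = m x j)" by auto
  define P where "P x v \<longleftrightarrow> (\<exists>a. (x, a) \<in> K \<and> (\<forall>j<i. a j = m x j) \<and> a i = v) \<and>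
      (\<forall>a. (x, a) \<in> K \<and> (\<forall>j<i. a j = m x j) \<longrightarrow> v \<le> a i)" for x v
  have "\<exists>v. P x v" if "x \<in> fst ` K" for x
  proof -
    let ?S = "K \<inter> {p. fst p = x \<and> (\<forall>j\<in>{..<i}. snd p j = m x j)}"
    have *: "{p. fst p = x \<and> (\<forall>j\<in>{..<i}. snd p j = m x j)} =
        {p. fst p = x} \<inter> (\<Inter>j\<in>{..<i}. {p. snd p j = m x j})"
      by auto
    have "closed {p :: 'x \<times> (nat \<Rightarrow> real). fst p = x \<and> (\<forall>j\<in>{..<i}. snd p j = m x j)}"
      unfolding *
      by (intro closed_Int closed_INT ballI closed_Collect_eq continuous_on_const continuous_on_fst continuous_on_id
          continuous_on_product_then_coordinatewise[OF continuous_on_snd])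
    then have 1: "compact ?S" using K by (rule compact_Int_closed[rotated])
    have 2: "?S \<noteq> {}" using mK[OF that] by force
    have 3: "continuous_on ?S (\<lambda>p. snd p i)"
      by (intro continuous_on_product_then_coordinatewise[OF continuous_on_snd] continuous_on_id)
    obtain p where p: "p \<in> ?S" "\<forall>q\<in>?S. snd p i \<le> snd q i"
      using continuous_attains_inf[OF 1 2 3] by (elim bexE)
    have "snd p i \<le> a i" if "(x, a) \<in> K \<and> (\<forall>j<i. a j = m x j)" for a
      using bspec[OF p(2), of "(x, a)"] that by auto
    then show ?thesis using p(1) unfolding P_def by (intro exI[of _ "snd p i"] conjI exI[of _ "snd p"]) auto
  qed
  then obtain v0 where v0: "\<And>x. x \<in> fst ` K \<Longrightarrow> P x (v0 x)" by metis
  define v where "v x = (if x \<in> fst ` K then v0 x else 0)" for x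
  \<comment> \<open>The sublevel condition has free earlier coordinates \<open>b\<close> in place of
    \<open>m x\<close>. In this form it is closed by compactness of \<open>K\<close>, and for
    \<open>x\<close> in the projection \<open>v x \<le> c\<close> amounts to
    \<open>(x, m x) \<in> T c\<close>, which is Borel because \<open>m\<close> is.\<close>
  define T where "T c = {(x, b). \<exists>a. (x, a) \<in> K \<and> (\<forall>j<i. a j = b j) \<and> a i \<le> c}" for c
  have "closed (T c)" for c
    unfolding closed_sequential_limits
  proof (intro allI impI, elim conjE)
    fix s l assume s: "\<forall>n. s n \<in> T c" and lim: "s \<longlonglongrightarrow> l"
    obtain x b where l: "l = (x, b)" by force
    have "\<forall>n. \<exists>a. (fst (s n), a) \<in> K \<and> (\<forall>j<i. a j = snd (s n) j) \<and> a i \<le> c"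
      using s unfolding T_def by (auto simp: split_def)
    then obtain a where a: "\<And>n. (fst (s n), a n) \<in> K" "\<And>n j. j < i \<Longrightarrow> a n j = snd (s n) j"
      "\<And>n. a n i \<le> c" by metis
    obtain p r where r: "p \<in> K" "strict_mono r" "((\<lambda>n. (fst (s n), a n)) \<circ> r) \<longlonglongrightarrow> p"
      using seq_compactE[OF compact_imp_seq_compact[OF K], of "\<lambda>n. (fst (s n), a n)"] a(1) by blast
    have lim': "(\<lambda>n. s (r n)) \<longlonglongrightarrow> (x, b)"
      using LIMSEQ_subseq_LIMSEQ[OF lim r(2)] by (simp add: l o_def)
    have 1: "(\<lambda>n. fst (s (r n))) \<longlonglongrightarrow> fst p" and 2: "(\<lambda>n. a (r n)) \<longlonglongrightarrow> snd p"
      using tendsto_fst[OF r(3)] tendsto_snd[OF r(3)] by (simp_all add: o_def)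
    have "fst p = x"
      using LIMSEQ_unique[OF 1] tendsto_fst[OF lim'] by simp
    moreover have "snd p j = b j" if "j < i" for j
    proof -
      have "(\<lambda>n. a (r n) j) \<longlonglongrightarrow> snd p j" using 2 by (simp add: tendsto_fun_iff)
      moreover have "(\<lambda>n. snd (s (r n)) j) \<longlonglongrightarrow> b j"
        using tendsto_snd[OF lim'] by (simp add: tendsto_fun_iff)
      ultimately show ?thesis using a(2)[OF that] by (simp add: LIMSEQ_unique)
    qed
    moreover have "snd p i \<le> c"
      using 2 a(3) by (auto simp: tendsto_fun_iff intro: LIMSEQ_le_const2)
    ultimately show "l \<in> T c"
      unfolding T_def l using r(1) by (auto intro!: exI[of _ "snd p"])
  qed
  then have Tc[measurable]: "T c \<in> sets borel" for c by simp
  have K1[measurable]: "fst ` K \<in> sets borel"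
    using K by (auto intro!: borel_compact compact_continuous_image continuous_on_fst continuous_on_id)
  have "v \<in> borel_measurable borel"
  proof (rule borel_measurable_iff_le[THEN iffD2], rule allI)
    fix c
    have "{x \<in> space borel. v x \<le> c} =
        (fst ` K \<inter> (\<lambda>x. (x, m x)) -` T c) \<union> (if 0 \<le> c then - (fst ` K) else {})"
    proof (intro equalityI subsetI)
      fix x assume "x \<in> {x \<in> space borel. v x \<le> c}"
      then show "x \<in> (fst ` K \<inter> (\<lambda>x. (x, m x)) -` T c) \<union> (if 0 \<le> c then - (fst ` K) else {})"
        using v0[of x] by (cases "x \<in> fst ` K") (auto simp: v_def T_def P_def)
    next
      fix x assume x: "x \<in> (fst ` K \<inter> (\<lambda>x. (x, m x)) -` T c) \<union> (if 0 \<le> c then - (fst ` K) else {})"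
      show "x \<in> {x \<in> space borel. v x \<le> c}"
      proof (cases "x \<in> fst ` K")
        case True
        then obtain a where "(x, a) \<in> K" "\<forall>j<i. a j = m x j" "a i \<le> c"
          using x by (auto simp: T_def split: if_splits)
        then have "v0 x \<le> c" using v0[OF True] unfolding P_def by (meson order_trans)
        then show ?thesis using True by (simp add: v_def)
      qed (use x in \<open>auto simp: v_def split: if_splits\<close>)
    qed
    moreover have "(\<lambda>x. (x, m x)) -` T c \<in> sets borel"
      using measurable_sets[OF borel_measurable_Pair[OF measurable_ident m] Tc, of c] by simp
    ultimately show "{x \<in> space borel. v x \<le> c} \<in> sets borel" by auto
  qed
  then have "(\<lambda>x. (m x)(i := v x)) \<in> borel_measurable borel"
    by (intro measurable_coordinatewise_then_product)
       (auto simp: fun_upd_def intro!: measurable_If measurable_product_then_coordinatewise[OF m])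
  moreover have "\<exists>a. (x, a) \<in> K \<and> (\<forall>j<Suc i. a j = ((m x)(i := v x)) j)" if "x \<in> fst ` K" for x
    using v0[OF that] that by (auto simp: v_def P_def less_Suc_eq)
  ultimately show ?case by (intro bexI[of _ "\<lambda>x. (m x)(i := v x)"] ballI)
qed

section \<open>Euclidean balls as compact sets and selection over them\<close>

lemma eball_abs_le:
  assumes "x \<in> eball d r" "i < d"
  shows "\<bar>x i\<bar> \<le> r"
proof -
  have "\<bar>x i\<bar> \<le> L2_set (\<lambda>i. \<bar>x i\<bar>) {..<d}" using assms by (intro member_le_L2_set) auto
  also have "\<dots> = L2_set x {..<d}" by (simp add: L2_set_def)
  finally show ?thesis using assms by (simp add: eball_def)
qed

lemma eball_le_PiE: "eball d r \<subseteq> (\<Pi>\<^sub>E i\<in>{..<d}. {-r..r})"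
proof
  fix x assume x: "x \<in> eball d r"
  from eball_abs_le[OF this] have "- r \<le> x i \<and> x i \<le> r" if "i < d" for i
    using that by (simp add: abs_le_iff minus_le_iff)
  then show "x \<in> (\<Pi>\<^sub>E i\<in>{..<d}. {-r..r})" using x by (auto simp: eball_def PiE_iff)
qed

text \<open>Extensionality freezes all coordinates from \<open>d\<close> on at
  \<open>undefined\<close>, so the ball is a closed part of a Tychonoff product of intervals and
  singletons in the full space \<open>nat \<Rightarrow> real\<close>. The selection argument can
  thus work in one fixed metric space for all dimensions.\<close>

lemma compact_eball: "compact (eball d r)"
proof -
  let ?S = "\<lambda>i. if i < d then {-r..r} else {undefined}"
  have "eball d r = (\<Pi>\<^sub>E i\<in>UNIV. ?S i) \<inter> {x. L2_set x {..<d} \<le> r}"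
  proof (intro equalityI subsetI)
    fix x assume x: "x \<in> eball d r"
    from eball_abs_le[OF this] have "- r \<le> x i \<and> x i \<le> r" if "i < d" for i
      using that by (simp add: abs_le_iff minus_le_iff)
    then show "x \<in> (\<Pi>\<^sub>E i\<in>UNIV. ?S i) \<inter> {x. L2_set x {..<d} \<le> r}"
      using x by (auto simp: eball_def PiE_def extensional_def)
  next
    fix x assume x: "x \<in> (\<Pi>\<^sub>E i\<in>UNIV. ?S i) \<inter> {x. L2_set x {..<d} \<le> r}"
    then have "x i = undefined" if "\<not> i < d" for i
      using that by (auto simp: PiE_def Pi_def dest!: spec[of _ i] split: if_splits)
    then show "x \<in> eball d r" using x by (auto simp: eball_def PiE_def extensional_def)
  qed
  moreover have "compactin (product_topology (\<lambda>_. euclidean) UNIV) (\<Pi>\<^sub>E i\<in>UNIV. ?S i)"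
    by (subst compactin_PiE) auto
  then have "compact (\<Pi>\<^sub>E i\<in>UNIV. ?S i)"
    by (simp add: euclidean_product_topology compactin_euclidean_iff)
  moreover have "closed {x :: nat \<Rightarrow> real. L2_set x {..<d} \<le> r}"
    unfolding L2_set_def
    by (intro closed_Collect_le continuous_intros) auto
  ultimately show ?thesis by (simp add: compact_Int_closed)
qed

lemma zero_in_eball: "0 \<le> r \<Longrightarrow> (\<lambda>i\<in>{..<d}. 0) \<in> eball d r"
  by (auto simp: eball_def L2_set_def)

text \<open>Inner approximating compact sets exhaust the projection up to a null set, and each of them has
  a lexicographically least selector.\<close>

lemma borel_ae_selection:
  fixes E :: "(point \<times> point) set"
  assumes "finite_measure \<mu>" and sets: "sets \<mu> = sets borel"
    and E: "E \<in> sets borel" "E \<subseteq> X \<times> eball d r" "compact X" "0 \<le> r"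
  shows "\<exists>\<alpha>\<in>borel_measurable borel. (\<forall>x. \<alpha> x \<in> eball d r) \<and> (AE x in \<mu>. x \<in> fst ` E \<longrightarrow> (x, \<alpha> x) \<in> E)"
proof -
  interpret finite_measure \<mu> by fact
  have sp: "space \<mu> = UNIV" using sets_eq_imp_space_eq[OF sets] by simp
  obtain C :: "((point \<times> point) \<times> (nat \<Rightarrow> nat)) set" where C: "closed C" "E = fst ` C"
    using suslin_borel[OF E(1)] unfolding suslin_def by blast
  define u where "u = outer_measure_of \<mu> (fst ` E)"
  \<comment> \<open>A measurable hull of the projection, which need not be Borel itself.\<close>
  obtain Z where Z: "Z \<in> sets \<mu>" "fst ` E \<subseteq> Z" "emeasure \<mu> Z = u"
    using outer_measure_of_attain[of "fst ` E" \<mu>] unfolding u_def sp by auto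
  have ufin: "u \<noteq> \<top>" using Z(3) by auto
  have "\<exists>K. compact K \<and> K \<subseteq> E \<and> u \<le> emeasure \<mu> (fst ` K) + ennreal (1 / Suc n)" for n
  proof (cases "u = 0")
    \<comment> \<open>Nothing lies strictly below \<open>u = 0\<close>, so the inner approximation
      cannot be invoked; the empty set serves.\<close>
    case True
    then show ?thesis by (intro exI[of _ "{}"]) auto
  next
    case False
    then have "u - ennreal (1 / Suc n) < u"
      using ufin by (intro ennreal_between) (auto simp: zero_less_iff_neq_zero less_top)
    then obtain K where "compact K" "K \<subseteq> fst ` C" "u - ennreal (1 / Suc n) \<le> emeasure \<mu> (fst ` K)"
      using closed_projection_inner_approx[OF \<open>finite_measure \<mu>\<close> sets C(1) _ E(3) compact_eball, of d r "u - ennreal (1 / Suc n)"]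
        E(2) unfolding u_def C(2) by auto
    then show ?thesis
      by (intro exI[of _ K]) (simp add: C(2) ennreal_minus_le_iff add.commute)
  qed
  then obtain K where K: "\<And>n. compact (K n)" "\<And>n. K n \<subseteq> E"
    "\<And>n. u \<le> emeasure \<mu> (fst ` K n) + ennreal (1 / Suc n)" by metis
  have K1[measurable]: "fst ` K n \<in> sets borel" for n
    using K by (auto intro!: borel_compact compact_continuous_image continuous_on_fst continuous_on_id)
  define B where "B = (\<Union>n. fst ` K n)"
  have B[measurable]: "B \<in> sets borel" unfolding B_def by measurable
  have "u \<le> emeasure \<mu> B"
  proof (rule ennreal_le_epsilon)
    fix e :: real assume "0 < e"
    then obtain n where n: "1 / real (Suc n) < e" using nat_approx_posE by blast
    have "u \<le> emeasure \<mu> (fst ` K n) + ennreal (1 / Suc n)" by (rule K)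
    also have "\<dots> \<le> emeasure \<mu> B + ennreal e"
      using n by (intro add_mono emeasure_mono ennreal_leI) (auto simp: B_def sets)
    finally show "u \<le> emeasure \<mu> B + ennreal e" .
  qed
  moreover have "B \<subseteq> Z" using K(2) Z(2) unfolding B_def by blast
  ultimately have "emeasure \<mu> (Z - B) = 0"
    using Z B ufin by (subst emeasure_Diff) (auto simp: sets diff_eq_0_iff_ennreal less_top)
  then have "AE x in \<mu>. x \<notin> Z - B"
    using Z B by (intro AE_not_in) (auto simp: null_sets_def sets)
  then have AE: "AE x in \<mu>. x \<in> fst ` E \<longrightarrow> x \<in> B"
    using Z(2) by (auto elim!: eventually_mono)
  have "\<forall>n. \<exists>m\<in>borel_measurable borel. \<forall>x\<in>fst ` K n. \<exists>a. (x, a) \<in> K n \<and> (\<forall>j<d. a j = m x j)"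
    using lexicographic_selector[OF K(1)] by blast
  then obtain m where m[measurable]: "\<And>n. m n \<in> borel_measurable borel"
    and mK: "\<And>n x. x \<in> fst ` K n \<Longrightarrow> \<exists>a. (x, a) \<in> K n \<and> (\<forall>j<d. a j = m n x j)" by metis
  \<comment> \<open>Restores extensionality: the selector agrees with a point of the ball only below
    \<open>d\<close>, and such a point is determined by these coordinates.\<close>
  define m' where "m' n x = (\<lambda>j\<in>{..<d}. m n x j)" for n x
  have m'[measurable]: "m' n \<in> borel_measurable borel" for n
    unfolding m'_def restrict_def
    by (intro measurable_coordinatewise_then_product)
       (auto intro!: measurable_If measurable_product_then_coordinatewise[OF m])
  have m'E: "(x, m' n x) \<in> E" if x: "x \<in> fst ` K n" for n x
  proof -
    obtain a where a: "(x, a) \<in> K n" "\<forall>j<d. a j = m n x j" using mK[OF x] by blast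
    then have "a \<in> eball d r" using K(2) E(2) by blast
    then have "a \<in> extensional {..<d}" by (auto simp: eball_def PiE_def)
    then have "a = m' n x" using a(2) by (auto simp: m'_def extensional_def)
    then show ?thesis using a K(2) by blast
  qed
  \<comment> \<open>On the exhausting union the first compact set containing \<open>x\<close>
    decides. Elsewhere a fixed point of the ball is used, since the rest of the projection lies in a
    null set.\<close>
  define \<alpha> where "\<alpha> x = (if x \<in> B then m' (LEAST n. x \<in> fst ` K n) x else (\<lambda>i\<in>{..<d}. 0))" for x
  have L: "x \<in> fst ` K (LEAST n. x \<in> fst ` K n)" if "x \<in> B" for x
    using that unfolding B_def by (intro LeastI_ex[of "\<lambda>n. x \<in> fst ` K n"]) auto
  have "(\<lambda>x. LEAST n. x \<in> fst ` K n) \<in> borel \<rightarrow>\<^sub>M count_space UNIV"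
    by (intro measurable_Least) (simp add: pred_def K1)
  from measurable_compose_countable[OF m' this] have "\<alpha> \<in> borel_measurable borel"
    unfolding \<alpha>_def using B by (intro measurable_If) auto
  moreover have "\<alpha> x \<in> eball d r" for x
    using m'E[OF L] E(2,4) zero_in_eball unfolding \<alpha>_def by auto
  moreover have "AE x in \<mu>. x \<in> fst ` E \<longrightarrow> (x, \<alpha> x) \<in> E"
    using AE by eventually_elim (use m'E[OF L] in \<open>auto simp: \<alpha>_def\<close>)
  ultimately show ?thesis by blast
qed

section \<open>Lebesgue measure on balls and its Borel structure\<close>

lemma sets_eball[measurable]: "eball d r \<in> sets (PiM {..<d} (\<lambda>_. lborel))"
proof -
  have "eball d r = {x \<in> space (PiM {..<d} (\<lambda>_. lborel)). L2_set x {..<d} \<le> r}"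
    by (auto simp: eball_def space_PiM)
  also have "\<dots> \<in> sets (PiM {..<d} (\<lambda>_. lborel))"
    unfolding L2_set_def by measurable
  finally show ?thesis .
qed

lemma space_lebesgue_ball[simp]: "space (lebesgue_ball d r) = eball d r"
  unfolding lebesgue_ball_def by (auto simp: space_restrict_space eball_def space_PiM)

lemma finite_lebesgue_ball: "finite_measure (lebesgue_ball d r)"
proof
  have "emeasure (lebesgue_ball d r) (eball d r) = emeasure (PiM {..<d} (\<lambda>_. lborel)) (eball d r)"
    unfolding lebesgue_ball_def by (rule emeasure_restrict_space) auto
  also have "\<dots> \<le> emeasure (PiM {..<d} (\<lambda>_. lborel)) (\<Pi>\<^sub>E i\<in>{..<d}. {-r..r})"
    by (intro emeasure_mono eball_le_PiE sets_PiM_I_finite) auto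
  also have "\<dots> = (\<Prod>i<d. emeasure lborel {-r..r})"
    by (intro product_sigma_finite.emeasure_PiM) (auto simp: product_sigma_finite_def sigma_finite_lborel)
  also have "\<dots> < \<top>"
    by (subst less_top[symmetric]) (auto simp: emeasure_lborel_Icc_eq power_eq_top_ennreal)
  finally show "emeasure (lebesgue_ball d r) (space (lebesgue_ball d r)) \<noteq> \<infinity>" by simp
qed

text \<open>On the ball the coordinates from \<open>d\<close> on are constant, so the product
  structure over \<open>{..<d}\<close> and the Borel structure of
  \<open>nat \<Rightarrow> real\<close> yield the same measurable subsets. The processes live on the
  former, the selection theorem on the latter.\<close>

lemma sets_lebesgue_ball: "sets (lebesgue_ball d r) = sets (restrict_space borel (eball d r))"
proof -
  have "(\<lambda>x. x) \<in> lebesgue_ball d r \<rightarrow>\<^sub>M restrict_space borel (eball d r)"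
  proof (rule measurable_restrict_space2)
    show "(\<lambda>x. x) \<in> borel_measurable (lebesgue_ball d r)"
    proof (rule measurable_coordinatewise_then_product)
      fix i
      show "(\<lambda>x. x i) \<in> borel_measurable (lebesgue_ball d r)"
      proof (cases "i < d")
        case True
        then show ?thesis unfolding lebesgue_ball_def by (intro measurable_restrict_space1) measurable
      next
        case False
        have "(\<lambda>x. x i) \<in> borel_measurable (lebesgue_ball d r) \<longleftrightarrow>
            (\<lambda>x. undefined) \<in> borel_measurable (lebesgue_ball d r)"
          by (subst measurable_cong[where g = "\<lambda>x. undefined"]) (use False in \<open>auto simp: eball_def PiE_def extensional_def\<close>)
        then show ?thesis by simp
      qed
    qed
  qed simp
  moreover have "(\<lambda>x. x) \<in> restrict_space borel (eball d r) \<rightarrow>\<^sub>M lebesgue_ball d r"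
    unfolding lebesgue_ball_def
  proof (rule measurable_restrict_space2)
    show "(\<lambda>x. x) \<in> restrict_space borel (eball d r) \<rightarrow>\<^sub>M PiM {..<d} (\<lambda>_. lborel)"
    proof (rule measurable_PiM_single')
      fix i
      show "(\<lambda>x. x i) \<in> restrict_space borel (eball d r) \<rightarrow>\<^sub>M lborel"
        by (simp add: measurable_restrict_space1 measurable_product_then_coordinatewise)
    qed (auto simp: eball_def space_restrict_space)
  qed (simp add: space_restrict_space)
  moreover have "sets M \<subseteq> sets N" if "(\<lambda>x. x) \<in> N \<rightarrow>\<^sub>M M" "space M = space N" for M N :: "point measure"
  proof
    fix X assume X: "X \<in> sets M"
    then have "(\<lambda>x. x) -` X \<inter> space N = X"
      using sets.sets_into_space that(2) by auto
    then show "X \<in> sets N" using measurable_sets[OF that(1) X] by simp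
  qed
  ultimately show ?thesis by (intro antisym) (auto simp: space_restrict_space)
qed

text \<open>Links product measurability of functions of state and action to Borel sets in a product
  of metric spaces, to which the projection argument applies.\<close>

lemma sets_lebesgue_ball_pair:
  assumes "E \<in> sets (lebesgue_ball d r \<Otimes>\<^sub>M lebesgue_ball d r')"
  shows "E \<in> sets borel"
proof -
  let ?X = "eball d r" and ?Y = "eball d r'"
  let ?R = "restrict_space borel (?X \<times> ?Y) :: (point \<times> point) measure"
  have E: "E \<in> sets (restrict_space borel ?X \<Otimes>\<^sub>M restrict_space borel ?Y)"
    using assms by (simp add: sets_pair_measure_cong[OF sets_lebesgue_ball sets_lebesgue_ball])
  have "fst \<in> ?R \<rightarrow>\<^sub>M restrict_space borel ?X" "snd \<in> ?R \<rightarrow>\<^sub>M restrict_space borel ?Y"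
    by (rule measurable_restrict_space2, force simp: space_restrict_space,
        intro measurable_restrict_space1 borel_measurable_continuous_onI continuous_on_fst
          continuous_on_snd continuous_on_id)+
  then have "(\<lambda>p. (fst p, snd p)) \<in> ?R \<rightarrow>\<^sub>M restrict_space borel ?X \<Otimes>\<^sub>M restrict_space borel ?Y"
    by (rule measurable_Pair)
  from measurable_sets[OF this E] have "E \<inter> (?X \<times> ?Y) \<in> sets ?R"
    by (simp add: space_restrict_space)
  moreover have "E \<subseteq> ?X \<times> ?Y"
    using sets.sets_into_space[OF E] by (simp add: space_pair_measure space_restrict_space)
  moreover have "?X \<times> ?Y \<in> sets borel"
    by (intro borel_closed closed_Times compact_imp_closed compact_eball)
  ultimately show ?thesis
    by (auto simp: sets_restrict_space_iff Int_absorb2)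
qed

lemma lebesgue_ball_to_borel: "(\<lambda>x. x) \<in> lebesgue_ball d r \<rightarrow>\<^sub>M borel"
proof -
  have "(\<lambda>x. x) \<in> restrict_space borel (eball d r) \<rightarrow>\<^sub>M borel"
    by (intro measurable_restrict_space1) simp
  then show ?thesis by (simp add: measurable_cong_sets[OF sets_lebesgue_ball refl])
qed

lemma measurable_lebesgue_ballI:
  assumes "f \<in> M \<rightarrow>\<^sub>M borel" "\<And>x. x \<in> space M \<Longrightarrow> f x \<in> eball d r"
  shows "f \<in> M \<rightarrow>\<^sub>M lebesgue_ball d r"
proof -
  have "f \<in> M \<rightarrow>\<^sub>M restrict_space borel (eball d r)"
    using assms by (intro measurable_restrict_space2) auto
  then show ?thesis by (simp add: measurable_cong_sets[OF refl sets_lebesgue_ball])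
qed

text \<open>For each rational \<open>q\<close> one measurable action function makes \<open>f\<close>
  exceed \<open>q\<close> wherever this is possible, up to a null set. Rationals are dense below the
  supremum, so this countable family recovers it almost everywhere.\<close>

lemma ae_sup_selection:
  fixes f :: "point \<times> point \<Rightarrow> real"
  assumes f: "f \<in> borel_measurable (lebesgue_ball d r \<Otimes>\<^sub>M lebesgue_ball d r')"
    and B: "\<And>x a. x \<in> eball d r \<Longrightarrow> a \<in> eball d r' \<Longrightarrow> \<bar>f (x, a)\<bar> \<le> B" and r': "0 \<le> r'"
  shows "\<exists>\<alpha>. (\<forall>n::nat. \<alpha> n \<in> lebesgue_ball d r \<rightarrow>\<^sub>M lebesgue_ball d r') \<and>
    (AE x in lebesgue_ball d r. (SUP a\<in>eball d r'. f (x, a)) = (SUP n. f (x, \<alpha> n x)))"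
proof -
  let ?M = "lebesgue_ball d r" and ?X = "eball d r" and ?Y = "eball d r'"
  interpret finite_measure ?M by (rule finite_lebesgue_ball)
  define q where "q = from_nat_into (\<rat> :: real set)"
  have q: "range q = \<rat>" unfolding q_def by (intro range_from_nat_into countable_rat) auto
  define E where "E n = {p \<in> ?X \<times> ?Y. q n < f p}" for n
  \<comment> \<open>Borel selection is formulated for a measure on the whole space, hence the
    push-forward of the measure on the ball.\<close>
  define \<mu> where "\<mu> = distr ?M borel (\<lambda>x. x)"
  have \<mu>: "finite_measure \<mu>" "sets \<mu> = sets borel"
    unfolding \<mu>_def by (auto intro: finite_measure_distr lebesgue_ball_to_borel)
  have "E n \<in> sets borel" for n
  proof (rule sets_lebesgue_ball_pair)
    have "E n = {p \<in> space (?M \<Otimes>\<^sub>M lebesgue_ball d r'). q n < f p}"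
      by (simp add: E_def space_pair_measure)
    then show "E n \<in> sets (?M \<Otimes>\<^sub>M lebesgue_ball d r')"
      using f by (simp add: borel_measurable_iff_greater)
  qed
  then have *: "\<exists>\<alpha>\<in>borel_measurable borel. (\<forall>x. \<alpha> x \<in> ?Y) \<and> (AE x in \<mu>. x \<in> fst ` E n \<longrightarrow> (x, \<alpha> x) \<in> E n)" for n
    by (intro borel_ae_selection[OF \<mu>, of _ ?X] compact_eball r') (auto simp: E_def)
  define P where "P n \<alpha> \<longleftrightarrow> \<alpha> \<in> borel_measurable borel \<and> (\<forall>x. \<alpha> x \<in> ?Y) \<and>
    (AE x in \<mu>. x \<in> fst ` E n \<longrightarrow> (x, \<alpha> x) \<in> E n)" for n and \<alpha> :: "point \<Rightarrow> point"
  have "\<exists>\<alpha>. P n \<alpha>" for n using *[of n] unfolding P_def by (elim bexE) (intro exI conjI; elim conjE; assumption)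
  then obtain \<alpha> where "\<And>n. P n (\<alpha> n)" by metis
  then have \<alpha>: "\<And>n. \<alpha> n \<in> borel_measurable borel" "\<And>n x. \<alpha> n x \<in> ?Y"
    "\<And>n. AE x in \<mu>. x \<in> fst ` E n \<longrightarrow> (x, \<alpha> n x) \<in> E n" by (simp_all add: P_def)
  have "\<alpha> n \<in> ?M \<rightarrow>\<^sub>M lebesgue_ball d r'" for n
    using measurable_compose[OF lebesgue_ball_to_borel \<alpha>(1)]
    by (intro measurable_lebesgue_ballI \<alpha>(2))
  moreover have "AE x in ?M. (SUP a\<in>?Y. f (x, a)) = (SUP n. f (x, \<alpha> n x))"
  proof -
    have "AE x in ?M. \<forall>n. x \<in> fst ` E n \<longrightarrow> (x, \<alpha> n x) \<in> E n"
      unfolding AE_all_countable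
      by (intro allI AE_distrD[OF lebesgue_ball_to_borel \<alpha>(3)[unfolded \<mu>_def]])
    then show ?thesis
    proof (rule AE_mp, intro AE_I2 impI)
      fix x assume x: "x \<in> space ?M" and *: "\<forall>n. x \<in> fst ` E n \<longrightarrow> (x, \<alpha> n x) \<in> E n"
      have bd: "bdd_above ((\<lambda>a. f (x, a)) ` ?Y)"
        using B x by (intro bdd_aboveI2[of _ _ B]) (auto simp: abs_le_iff)
      have bd': "bdd_above (range (\<lambda>n. f (x, \<alpha> n x)))"
        using B x \<alpha>(2) by (intro bdd_aboveI2[of _ _ B]) (auto simp: abs_le_iff)
      have "\<not> (SUP n. f (x, \<alpha> n x)) < (SUP a\<in>?Y. f (x, a))"
      proof
        assume "(SUP n. f (x, \<alpha> n x)) < (SUP a\<in>?Y. f (x, a))"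
        then obtain a where a: "a \<in> ?Y" "(SUP n. f (x, \<alpha> n x)) < f (x, a)"
          using bd zero_in_eball[OF r'] by (subst (asm) less_cSUP_iff) auto
        then obtain y where "y \<in> \<rat>" "(SUP n. f (x, \<alpha> n x)) < y" "y < f (x, a)"
          using Rats_dense_in_real by blast
        then obtain n where n: "(SUP n. f (x, \<alpha> n x)) < q n" "q n < f (x, a)"
          using q by (metis rangeE)
        have "(x, a) \<in> E n" using n a x by (simp add: E_def)
        then have "(x, \<alpha> n x) \<in> E n" using * by force
        then have "q n < f (x, \<alpha> n x)" by (simp add: E_def)
        also have "\<dots> \<le> (SUP n. f (x, \<alpha> n x))" by (rule cSUP_upper[OF UNIV_I bd'])
        finally show False using n(1) by simp
      qed
      moreover have "(SUP n. f (x, \<alpha> n x)) \<le> (SUP a\<in>?Y. f (x, a))"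
        by (intro cSUP_least cSUP_upper[OF \<alpha>(2) bd]) auto
      ultimately show "(SUP a\<in>?Y. f (x, a)) = (SUP n. f (x, \<alpha> n x))" by simp
    qed
  qed
  ultimately show ?thesis by blast
qed

section \<open>Uniform bounds for sums over independent samples\<close>

text \<open>Bounds the mean of a maximum by a sum of moment generating functions, without Jensen's inequality.\<close>

lemma exp_majorant:
  fixes u m :: real
  assumes "0 < m"
  shows "u \<le> ln m - 1 + exp u / m"
proof -
  have "1 + (u - ln m) \<le> exp (u - ln m)" by (rule exp_ge_add_one_self)
  also have "\<dots> = exp u / m" using assms by (simp add: exp_diff)
  finally show ?thesis by simp
qed

text \<open>Independence factorises the moment generating function, and Hoeffding's lemma bounds
  each factor. The scale \<open>l = 1 / (c * sqrt (card I))\<close> is chosen so that the result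
  does not depend on the sample size: \<open>card I * l^2 * (2 * c)^2 / 8 = 1 / 2\<close>.\<close>

lemma nn_integral_exp_iid_sum:
  assumes "prob_space \<mu>" "finite I" "I \<noteq> {}" and f[measurable]: "f \<in> borel_measurable \<mu>"
    and c: "AE x in \<mu>. \<bar>f x\<bar> \<le> c" "0 < c" and E: "(\<integral>x. f x \<partial>\<mu>) = 0"
  shows "(\<integral>\<^sup>+\<omega>. ennreal (exp ((1 / (c * sqrt (card I))) * (\<Sum>k\<in>I. f (\<omega> k)))) \<partial>PiM I (\<lambda>_. \<mu>)) \<le> ennreal (exp (1 / 2))"
proof -
  interpret prob_space \<mu> by fact
  interpret PS: product_sigma_finite "\<lambda>_. \<mu>" by unfold_locales
  have "AE x in \<mu>. f x \<in> {- c..c}"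
    using c(1) by eventually_elim (simp add: abs_le_iff minus_le_iff)
  then interpret interval_bounded_random_variable \<mu> f "- c" c
    by unfold_locales auto
  define l where "l = 1 / (c * sqrt (card I))"
  have n: "0 < card I" using assms by (simp add: card_gt_0_iff)
  then have l: "0 < l" using c by (simp add: l_def)
  have "(\<integral>\<^sup>+\<omega>. ennreal (exp (l * (\<Sum>k\<in>I. f (\<omega> k)))) \<partial>PiM I (\<lambda>_. \<mu>)) =
      (\<integral>\<^sup>+\<omega>. (\<Prod>k\<in>I. ennreal (exp (l * f (\<omega> k)))) \<partial>PiM I (\<lambda>_. \<mu>))"
    using assms(2) by (simp add: sum_distrib_left exp_sum prod_ennreal)
  also have "\<dots> = (\<Prod>k\<in>I. \<integral>\<^sup>+x. ennreal (exp (l * f x)) \<partial>\<mu>)"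
    using assms(2) by (intro PS.product_nn_integral_prod) auto
  also have "\<dots> \<le> (\<Prod>k\<in>I. ennreal (exp (l\<^sup>2 * (c - - c)\<^sup>2 / 8)))"
    using Hoeffdings_lemma_nn_integral_0[OF l E] by (intro prod_mono_ennreal) auto
  also have "\<dots> = ennreal (exp (card I * (l\<^sup>2 * (c - - c)\<^sup>2 / 8)))"
    by (simp add: ennreal_power exp_of_nat_mult[symmetric])
  also have "card I * (l\<^sup>2 * (c - - c)\<^sup>2 / 8) = 1 / 2"
    using n c by (simp add: l_def field_simps power_mult_distrib power_divide)
  finally show ?thesis by (simp add: l_def)
qed

text \<open>Exponentials of both signs are summed over the whole class, so that one measurable
  function dominates all the sums at every sample point. Passing through \<open>exp_majorant\<close>
  leaves only the logarithm of the size of the class.\<close>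

lemma iid_finite_class_majorant:
  fixes f :: "'t \<Rightarrow> 'a \<Rightarrow> real"
  assumes "prob_space \<mu>" "finite I" "finite T" and T: "T \<noteq> {}"
    and f[measurable]: "\<And>t. t \<in> T \<Longrightarrow> f t \<in> borel_measurable \<mu>"
    and c: "\<And>t. t \<in> T \<Longrightarrow> AE x in \<mu>. \<bar>f t x\<bar> \<le> c" "0 < c"
    and E: "\<And>t. t \<in> T \<Longrightarrow> (\<integral>x. f t x \<partial>\<mu>) = 0"
  shows "\<exists>\<Psi>\<in>borel_measurable (PiM I (\<lambda>_. \<mu>)). (\<forall>\<omega>. 0 \<le> \<Psi> \<omega>) \<and>
    (\<forall>\<omega>. \<forall>t\<in>T. \<bar>\<Sum>k\<in>I. f t (\<omega> k)\<bar> \<le> \<Psi> \<omega>) \<and>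
    (\<integral>\<^sup>+\<omega>. ennreal (\<Psi> \<omega>) \<partial>PiM I (\<lambda>_. \<mu>)) \<le> ennreal (c * sqrt (card I) * (ln (2 * card T) + 1 / 2))"
proof (cases "I = {}")
  case True
  have "1 \<le> card T" using assms by (simp add: Suc_le_eq card_gt_0_iff)
  then show ?thesis using True by (intro bexI[of _ "\<lambda>_. 0"]) auto
next
  case False
  let ?P = "PiM I (\<lambda>_. \<mu>)"
  interpret prob_space \<mu> by fact
  interpret P: prob_space ?P by (intro prob_space_PiM prob_space_axioms)
  have n: "0 < card I" using assms False by (simp add: card_gt_0_iff)
  have T1: "1 \<le> card T" using assms by (simp add: Suc_le_eq card_gt_0_iff)
  define l where "l = 1 / (c * sqrt (card I))"
  \<comment> \<open>An upper bound for the mean of \<open>S\<close>: two signs,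
    \<open>card T\<close> functions, and \<open>exp (1 / 2)\<close> for each. With this choice the
    mean of \<open>S / m\<close> is at most 1 and cancels the \<open>- 1\<close> of the majorant,
    leaving \<open>ln m / l\<close>.\<close>
  define m where "m = 2 * card T * exp (1 / 2 :: real)"
  have l: "0 < l" using n c by (simp add: l_def)
  have m: "0 < m" using T1 by (simp add: m_def)
  have lnm: "ln m = ln (2 * card T) + 1 / 2" using T1 by (simp add: m_def ln_mult)
  have "2 / 3 \<le> ln (2::real)" by (rule ln2_ge_two_thirds)
  moreover have "ln 2 \<le> ln (2 * real (card T))" using T1 by (subst ln_le_cancel_iff) auto
  ultimately have lnm1: "1 \<le> ln m" unfolding lnm by simp
  define Z where "Z t \<omega> = (\<Sum>k\<in>I. f t (\<omega> k))" for t \<omega>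
  have Z[measurable]: "Z t \<in> borel_measurable ?P" if "t \<in> T" for t
    unfolding Z_def using f[OF that] by measurable
  define S where "S \<omega> = (\<Sum>t\<in>T. exp (l * Z t \<omega>) + exp (l * - Z t \<omega>))" for \<omega>
  have S[measurable]: "S \<in> borel_measurable ?P" unfolding S_def by measurable
  have S0: "0 \<le> S \<omega>" for \<omega> unfolding S_def by (intro sum_nonneg add_nonneg_nonneg) auto
  define \<Psi> where "\<Psi> \<omega> = (ln m - 1 + S \<omega> / m) / l" for \<omega>
  have "\<Psi> \<in> borel_measurable ?P" unfolding \<Psi>_def by measurable
  moreover have Z\<Psi>: "\<bar>Z t \<omega>\<bar> \<le> \<Psi> \<omega>" if "t \<in> T" for t \<omega>
  proof -
    have "l * \<bar>Z t \<omega>\<bar> \<le> ln m - 1 + exp (l * \<bar>Z t \<omega>\<bar>) / m" by (rule exp_majorant[OF m])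
    also have "exp (l * \<bar>Z t \<omega>\<bar>) \<le> exp (l * Z t \<omega>) + exp (l * - Z t \<omega>)"
      by (cases "0 \<le> Z t \<omega>") auto
    also have "\<dots> \<le> S \<omega>"
      unfolding S_def using that assms(3) by (intro member_le_sum) auto
    finally show ?thesis using l m by (simp add: \<Psi>_def field_simps divide_right_mono)
  qed
  moreover have "0 \<le> \<Psi> \<omega>" for \<omega> using T Z\<Psi> abs_ge_zero order_trans by (metis ex_in_conv)
  moreover have "(\<integral>\<^sup>+\<omega>. ennreal (\<Psi> \<omega>) \<partial>?P) \<le> ennreal (c * sqrt (card I) * (ln (2 * card T) + 1 / 2))"
  proof -
    have e: "(\<integral>\<^sup>+\<omega>. ennreal (exp (l * Z t \<omega>)) \<partial>?P) \<le> ennreal (exp (1 / 2))"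
      "(\<integral>\<^sup>+\<omega>. ennreal (exp (l * - Z t \<omega>)) \<partial>?P) \<le> ennreal (exp (1 / 2))" if "t \<in> T" for t
    proof -
      show "(\<integral>\<^sup>+\<omega>. ennreal (exp (l * Z t \<omega>)) \<partial>?P) \<le> ennreal (exp (1 / 2))"
        unfolding l_def Z_def using assms that False by (intro nn_integral_exp_iid_sum) auto
      have "(\<integral>\<^sup>+\<omega>. ennreal (exp (1 / (c * sqrt (card I)) * (\<Sum>k\<in>I. - f t (\<omega> k)))) \<partial>?P) \<le> ennreal (exp (1 / 2))"
        using assms that False by (intro nn_integral_exp_iid_sum) auto
      then show "(\<integral>\<^sup>+\<omega>. ennreal (exp (l * - Z t \<omega>)) \<partial>?P) \<le> ennreal (exp (1 / 2))"
        by (simp add: l_def Z_def sum_negf)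
    qed
    have "(\<integral>\<^sup>+\<omega>. ennreal (S \<omega>) \<partial>?P) =
        (\<Sum>t\<in>T. (\<integral>\<^sup>+\<omega>. ennreal (exp (l * Z t \<omega>)) \<partial>?P) + (\<integral>\<^sup>+\<omega>. ennreal (exp (l * - Z t \<omega>)) \<partial>?P))"
      unfolding S_def by (simp add: sum_ennreal[symmetric] nn_integral_sum nn_integral_add ennreal_plus del: sum_ennreal)
    also have "\<dots> \<le> (\<Sum>t\<in>T. ennreal (exp (1 / 2)) + ennreal (exp (1 / 2)))"
      by (intro sum_mono add_mono e)
    also have "\<dots> = ennreal m"
      by (simp add: m_def ennreal_plus[symmetric] ennreal_of_nat_eq_real_of_nat ennreal_mult'[symmetric] del: ennreal_plus)
    finally have Sm: "(\<integral>\<^sup>+\<omega>. ennreal (S \<omega>) \<partial>?P) \<le> ennreal m" .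
    have "(\<integral>\<^sup>+\<omega>. ennreal (\<Psi> \<omega>) \<partial>?P) =
        (\<integral>\<^sup>+\<omega>. ennreal ((ln m - 1) / l) + ennreal (1 / (m * l)) * ennreal (S \<omega>) \<partial>?P)"
      unfolding \<Psi>_def using lnm1 l m S0
      by (intro nn_integral_cong) (simp add: ennreal_mult'[symmetric] ennreal_plus[symmetric] field_simps del: ennreal_plus)
    also have "\<dots> = ennreal ((ln m - 1) / l) + ennreal (1 / (m * l)) * (\<integral>\<^sup>+\<omega>. ennreal (S \<omega>) \<partial>?P)"
      by (simp add: nn_integral_add nn_integral_cmult P.emeasure_space_1)
    also have "\<dots> \<le> ennreal ((ln m - 1) / l) + ennreal (1 / (m * l)) * ennreal m"
      by (intro add_left_mono mult_left_mono Sm) auto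
    also have "\<dots> = ennreal (ln m / l)"
      using lnm1 l m by (simp add: ennreal_mult'[symmetric] ennreal_plus[symmetric] field_simps del: ennreal_plus)
    also have "ln m / l = c * sqrt (card I) * (ln (2 * card T) + 1 / 2)"
      unfolding lnm by (simp add: l_def)
    finally show ?thesis .
  qed
  ultimately show ?thesis unfolding Z_def by (intro bexI[of _ \<Psi>]) auto
qed

text \<open>The two series of the chaining bound. The weight \<open>2 * j + 1\<close> is
  \<open>j + Suc j\<close>, from the linearly growing entropies of two consecutive scales.\<close>

lemma sum_half_powers_le:
  "(\<Sum>j<n. (1/2::real) ^ j) \<le> 2" "(\<Sum>j<n. (1/2::real) ^ j * (2 * real j + 1)) \<le> 6"
proof -
  have "(\<Sum>j<n. (1/2::real) ^ j) = 2 - 2 * (1/2) ^ n" by (induction n) auto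
  then show "(\<Sum>j<n. (1/2::real) ^ j) \<le> 2" by simp
  have "(\<Sum>j<n. (1/2::real) ^ j * (2 * real j + 1)) = 6 - (1/2) ^ n * (4 * real n + 6)"
    by (induction n) (simp_all add: algebra_simps)
  then show "(\<Sum>j<n. (1/2::real) ^ j * (2 * real j + 1)) \<le> 6" by simp
qed

text \<open>Dudley's chaining; a single scale would cost a factor \<open>ln (card I)\<close>.\<close>

lemma chaining_majorant:
  fixes \<xi> :: "'t \<Rightarrow> 'a \<Rightarrow> real" and \<rho> :: "'t \<Rightarrow> 't \<Rightarrow> real" and T :: "nat \<Rightarrow> 't set"
  assumes "prob_space \<mu>" "finite I" "I \<noteq> {}"
    and T: "\<And>j. finite (T j)" "\<And>j. T j \<noteq> {}" "\<And>j. T j \<subseteq> \<Theta>" "\<And>j. ln (card (T j)) \<le> \<alpha> + \<beta> * j" "0 \<le> \<beta>"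
    and cover: "\<And>j \<theta>. \<theta> \<in> \<Theta> \<Longrightarrow> \<exists>t\<in>T j. \<rho> \<theta> t \<le> (1/2) ^ j"
    and \<rho>: "\<And>s t. \<rho> s t = \<rho> t s" "\<And>s t u. \<rho> s u \<le> \<rho> s t + \<rho> t u"
    and \<xi>[measurable]: "\<And>\<theta>. \<theta> \<in> \<Theta> \<Longrightarrow> \<xi> \<theta> \<in> borel_measurable \<mu>"
    and C: "0 < C0" "AE x in \<mu>. \<forall>\<theta>\<in>\<Theta>. \<bar>\<xi> \<theta> x\<bar> \<le> C0"
      "0 < C1" "AE x in \<mu>. \<forall>\<theta>\<in>\<Theta>. \<forall>\<theta>'\<in>\<Theta>. \<bar>\<xi> \<theta> x - \<xi> \<theta>' x\<bar> \<le> C1 * \<rho> \<theta> \<theta>'"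
  shows "\<exists>\<Psi>\<in>borel_measurable (PiM I (\<lambda>_. \<mu>)). (\<forall>\<omega>. 0 \<le> \<Psi> \<omega>) \<and>
    (AE \<omega> in PiM I (\<lambda>_. \<mu>). \<forall>\<theta>\<in>\<Theta>. \<bar>\<Sum>k\<in>I. (\<xi> \<theta> (\<omega> k) - (\<integral>x. \<xi> \<theta> x \<partial>\<mu>))\<bar> \<le> \<Psi> \<omega>) \<and>
    (\<integral>\<^sup>+\<omega>. ennreal (\<Psi> \<omega>) \<partial>PiM I (\<lambda>_. \<mu>)) \<le>
      ennreal (sqrt (card I) * (2 * C0 * (\<alpha> + 2) + 4 * C1 * (4 + 4 * \<alpha> + 6 * \<beta>) + 2 * C1))"
proof -
  let ?P = "PiM I (\<lambda>_. \<mu>)"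
  interpret prob_space \<mu> by fact
  interpret P: prob_space ?P by (intro prob_space_PiM prob_space_axioms)
  have n: "1 \<le> card I" using assms by (simp add: Suc_le_eq card_gt_0_iff)
  have int: "integrable \<mu> (\<xi> \<theta>)" if "\<theta> \<in> \<Theta>" for \<theta>
    using C(2) by (intro integrable_const_bound[of _ C0] \<xi>[OF that], eventually_elim) (use that in auto)
  have intle: "\<bar>\<integral>x. g x \<partial>\<mu>\<bar> \<le> c" if "integrable \<mu> g" "AE x in \<mu>. \<bar>g x\<bar> \<le> c" for g :: "'a \<Rightarrow> real" and c
  proof -
    have "\<bar>\<integral>x. g x \<partial>\<mu>\<bar> \<le> (\<integral>x. \<bar>g x\<bar> \<partial>\<mu>)" using integral_norm_bound[of \<mu> g] by simp
    also have "\<dots> \<le> (\<integral>x. c \<partial>\<mu>)" using that by (intro integral_mono_AE) auto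
    finally show ?thesis by (simp add: prob_space)
  qed
  have T1: "1 \<le> card (T j)" for j using T by (simp add: Suc_le_eq card_gt_0_iff)
  define g where "g \<theta> x = \<xi> \<theta> x - (\<integral>x. \<xi> \<theta> x \<partial>\<mu>)" for \<theta> x
  have g[measurable]: "g \<theta> \<in> borel_measurable \<mu>" if "\<theta> \<in> \<Theta>" for \<theta>
    unfolding g_def using \<xi>[OF that] by measurable
  have g0: "integrable \<mu> (g \<theta>)" "(\<integral>x. g \<theta> x \<partial>\<mu>) = 0" if "\<theta> \<in> \<Theta>" for \<theta>
    unfolding g_def using int[OF that] by (auto simp: prob_space)
  have gC0: "AE x in \<mu>. \<bar>g \<theta> x\<bar> \<le> 2 * C0" if "\<theta> \<in> \<Theta>" for \<theta>
  proof -
    have *: "AE x in \<mu>. \<bar>\<xi> \<theta> x\<bar> \<le> C0" using C(2) by eventually_elim (use that in auto)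
    have "\<bar>\<integral>x. \<xi> \<theta> x \<partial>\<mu>\<bar> \<le> C0" by (rule intle[OF int[OF that] *])
    show ?thesis using * by eventually_elim (use \<open>\<bar>\<integral>x. \<xi> \<theta> x \<partial>\<mu>\<bar> \<le> C0\<close> in \<open>auto simp: g_def\<close>)
  qed
  have gC1: "AE x in \<mu>. \<forall>\<theta>\<in>\<Theta>. \<forall>\<theta>'\<in>\<Theta>. \<bar>g \<theta> x - g \<theta>' x\<bar> \<le> 2 * C1 * \<rho> \<theta> \<theta>'"
  proof -
    \<comment> \<open>The means inherit the Lipschitz bound, so centring doubles the constant, just
      as it doubles the uniform bound.\<close>
    have *: "\<bar>(\<integral>x. \<xi> \<theta> x \<partial>\<mu>) - (\<integral>x. \<xi> \<theta>' x \<partial>\<mu>)\<bar> \<le> C1 * \<rho> \<theta> \<theta>'" if "\<theta> \<in> \<Theta>" "\<theta>' \<in> \<Theta>" for \<theta> \<theta>'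
    proof -
      have "AE x in \<mu>. \<bar>\<xi> \<theta> x - \<xi> \<theta>' x\<bar> \<le> C1 * \<rho> \<theta> \<theta>'"
        using C(4) by eventually_elim (use that in auto)
      from intle[OF _ this] show ?thesis using int that by simp
    qed
    show ?thesis using C(4)
    proof eventually_elim
      case (elim x)
      show ?case
      proof (intro ballI)
        fix \<theta> \<theta>' assume "\<theta> \<in> \<Theta>" "\<theta>' \<in> \<Theta>"
        then show "\<bar>g \<theta> x - g \<theta>' x\<bar> \<le> 2 * C1 * \<rho> \<theta> \<theta>'"
          using elim *[of \<theta> \<theta>'] unfolding g_def abs_le_iff by fastforce
      qed
    qed
  qed
  define Z where "Z \<theta> \<omega> = (\<Sum>k\<in>I. g \<theta> (\<omega> k))" for \<theta> \<omega>
  have "\<exists>\<Psi>\<in>borel_measurable ?P. (\<forall>\<omega>. 0 \<le> \<Psi> \<omega>) \<and> (\<forall>\<omega>. \<forall>t\<in>T 0. \<bar>\<Sum>k\<in>I. g t (\<omega> k)\<bar> \<le> \<Psi> \<omega>) \<and>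
    (\<integral>\<^sup>+\<omega>. ennreal (\<Psi> \<omega>) \<partial>?P) \<le> ennreal (2 * C0 * sqrt (card I) * (ln (2 * card (T 0)) + 1 / 2))"
    using T gC0 g0 g C(1) subsetD[OF T(3)] assms(1,2) by (intro iid_finite_class_majorant) auto
  then obtain \<Psi>0 where \<Psi>0[measurable]: "\<Psi>0 \<in> borel_measurable ?P" and \<Psi>0': "\<And>\<omega>. 0 \<le> \<Psi>0 \<omega>"
    "\<And>\<omega> t. t \<in> T 0 \<Longrightarrow> \<bar>Z t \<omega>\<bar> \<le> \<Psi>0 \<omega>"
    "(\<integral>\<^sup>+\<omega>. ennreal (\<Psi>0 \<omega>) \<partial>?P) \<le> ennreal (2 * C0 * sqrt (card I) * (ln (2 * card (T 0)) + 1 / 2))"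
    unfolding Z_def by metis
  have "\<exists>\<Psi>\<in>borel_measurable ?P. (\<forall>\<omega>. 0 \<le> \<Psi> \<omega>) \<and>
      (\<forall>\<omega>. \<forall>s\<in>T (Suc j). \<forall>t\<in>T j. \<rho> s t \<le> 2 * (1/2) ^ j \<longrightarrow> \<bar>Z s \<omega> - Z t \<omega>\<bar> \<le> \<Psi> \<omega>) \<and>
      (\<integral>\<^sup>+\<omega>. ennreal (\<Psi> \<omega>) \<partial>?P) \<le> ennreal (4 * C1 * (1/2) ^ j * sqrt (card I) * (2 + 2 * \<alpha> + \<beta> * (2 * j + 1)))" for j
  proof -
    \<comment> \<open>The links between consecutive scales. If \<open>s\<close> and \<open>t\<close>
      approximate the same parameter, their distance is at most
      \<open>(1/2) ^ Suc j + (1/2) ^ j\<close>, which \<open>2 * (1/2) ^ j\<close> covers.\<close>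
    define Q where "Q = {(s, t). s \<in> T (Suc j) \<and> t \<in> T j \<and> \<rho> s t \<le> 2 * (1/2) ^ j}"
    have Qsub: "Q \<subseteq> T (Suc j) \<times> T j" unfolding Q_def by auto
    have Qf: "finite Q" using finite_subset[OF Qsub] T(1) by simp
    have Qne: "Q \<noteq> {}"
    proof -
      obtain s where s: "s \<in> T (Suc j)" using T(2) by blast
      then obtain t where t: "t \<in> T j" "\<rho> s t \<le> (1/2) ^ j" using cover T(3) by blast
      moreover have "(1/2::real) ^ j \<le> 2 * (1/2) ^ j" by simp
      ultimately have "(s, t) \<in> Q" unfolding Q_def using s by (auto intro: order_trans)
      then show ?thesis by blast
    qed
    have Q\<Theta>: "fst p \<in> \<Theta>" "snd p \<in> \<Theta>" if "p \<in> Q" for p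
      using that subsetD[OF T(3)] unfolding Q_def by auto
    have gQ: "AE x in \<mu>. \<bar>g (fst p) x - g (snd p) x\<bar> \<le> 4 * C1 * (1/2) ^ j" if "p \<in> Q" for p
    proof -
      have le: "2 * C1 * \<rho> (fst p) (snd p) \<le> 2 * C1 * (2 * (1/2) ^ j)"
        using that C(3) unfolding Q_def by (intro mult_left_mono) auto
      show ?thesis using gC1
      proof eventually_elim
        case (elim x)
        then have "\<bar>g (fst p) x - g (snd p) x\<bar> \<le> 2 * C1 * \<rho> (fst p) (snd p)" using Q\<Theta>[OF that] by blast
        then show ?case using le by simp
      qed
    qed
    have "\<exists>\<Psi>\<in>borel_measurable ?P. (\<forall>\<omega>. 0 \<le> \<Psi> \<omega>) \<and>
      (\<forall>\<omega>. \<forall>p\<in>Q. \<bar>\<Sum>k\<in>I. g (fst p) (\<omega> k) - g (snd p) (\<omega> k)\<bar> \<le> \<Psi> \<omega>) \<and>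
      (\<integral>\<^sup>+\<omega>. ennreal (\<Psi> \<omega>) \<partial>?P) \<le> ennreal (4 * C1 * (1/2) ^ j * sqrt (card I) * (ln (2 * card Q) + 1 / 2))"
      using Qf Qne gQ g0 g C(3) Q\<Theta> assms(1,2) by (intro iid_finite_class_majorant) auto
    \<comment> \<open>A link is a pair of net points, so the entropies of the two scales add
      up.\<close>
    moreover have "ln (2 * card Q) + 1 / 2 \<le> 2 + 2 * \<alpha> + \<beta> * (2 * j + 1)"
    proof -
      have Q1: "1 \<le> card Q" using Qf Qne by (simp add: Suc_le_eq card_gt_0_iff)
      have "card Q \<le> card (T (Suc j)) * card (T j)"
        using card_mono[OF _ Qsub] T(1) by (simp add: card_cartesian_product)
      then have "real (card Q) \<le> real (card (T (Suc j))) * real (card (T j))"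
        using of_nat_mono by fastforce
      then have "ln (card Q) \<le> ln (real (card (T (Suc j))) * real (card (T j)))"
        using Q1 T1[of j] T1[of "Suc j"] by (subst ln_le_cancel_iff) auto
      also have "\<dots> = ln (card (T (Suc j))) + ln (card (T j))"
        using T1[of j] T1[of "Suc j"] by (simp add: ln_mult)
      also have "\<dots> \<le> (\<alpha> + \<beta> * Suc j) + (\<alpha> + \<beta> * j)" by (intro add_mono T)
      finally have "ln (card Q) \<le> 2 * \<alpha> + \<beta> * (2 * j + 1)" by (simp add: algebra_simps)
      moreover have "ln (2 * card Q) = ln 2 + ln (card Q)" using Q1 by (simp add: ln_mult)
      moreover have "ln (2::real) < 1" using ln_2_less_1 .
      ultimately show ?thesis by linarith
    qed
    then have "ennreal (4 * C1 * (1/2) ^ j * sqrt (card I) * (ln (2 * card Q) + 1 / 2)) \<le>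
        ennreal (4 * C1 * (1/2) ^ j * sqrt (card I) * (2 + 2 * \<alpha> + \<beta> * (2 * j + 1)))"
      using C(3) by (intro ennreal_leI mult_left_mono) auto
    ultimately obtain \<Psi> where "\<Psi> \<in> borel_measurable ?P" "\<And>\<omega>. 0 \<le> \<Psi> \<omega>"
      "\<And>\<omega> p. p \<in> Q \<Longrightarrow> \<bar>\<Sum>k\<in>I. g (fst p) (\<omega> k) - g (snd p) (\<omega> k)\<bar> \<le> \<Psi> \<omega>"
      "(\<integral>\<^sup>+\<omega>. ennreal (\<Psi> \<omega>) \<partial>?P) \<le> ennreal (4 * C1 * (1/2) ^ j * sqrt (card I) * (2 + 2 * \<alpha> + \<beta> * (2 * j + 1)))"
      by (meson order_trans)
    then show ?thesis
      by (intro bexI[of _ \<Psi>]) (force simp: Z_def Q_def sum_subtractf)+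
  qed
  then obtain \<Phi> where \<Phi>[measurable]: "\<And>j. \<Phi> j \<in> borel_measurable ?P" and \<Phi>': "\<And>j \<omega>. 0 \<le> \<Phi> j \<omega>"
    "\<And>j \<omega> s t. s \<in> T (Suc j) \<Longrightarrow> t \<in> T j \<Longrightarrow> \<rho> s t \<le> 2 * (1/2) ^ j \<Longrightarrow> \<bar>Z s \<omega> - Z t \<omega>\<bar> \<le> \<Phi> j \<omega>"
    "\<And>j. (\<integral>\<^sup>+\<omega>. ennreal (\<Phi> j \<omega>) \<partial>?P) \<le> ennreal (4 * C1 * (1/2) ^ j * sqrt (card I) * (2 + 2 * \<alpha> + \<beta> * (2 * j + 1)))"
    by metis
  \<comment> \<open>The chain stops at level \<open>card I\<close>. The error left in all summands
    together is at most \<open>2 * C1 * card I * (1/2) ^ card I\<close>, which is below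
    \<open>2 * C1 * sqrt (card I)\<close>; finitely many scales therefore suffice.\<close>
  let ?N = "card I"
  define \<Psi> where "\<Psi> \<omega> = \<Psi>0 \<omega> + (\<Sum>j<?N. \<Phi> j \<omega>) + 2 * C1 * sqrt ?N" for \<omega>
  have "\<Psi> \<in> borel_measurable ?P" unfolding \<Psi>_def by measurable
  moreover have "0 \<le> \<Psi> \<omega>" for \<omega>
    unfolding \<Psi>_def using \<Psi>0' \<Phi>' C by (intro add_nonneg_nonneg sum_nonneg) auto
  moreover have "AE \<omega> in ?P. \<forall>\<theta>\<in>\<Theta>. \<bar>Z \<theta> \<omega>\<bar> \<le> \<Psi> \<omega>"
  proof -
    have "AE \<omega> in ?P. \<forall>k\<in>I. \<forall>\<theta>\<in>\<Theta>. \<forall>\<theta>'\<in>\<Theta>. \<bar>g \<theta> (\<omega> k) - g \<theta>' (\<omega> k)\<bar> \<le> 2 * C1 * \<rho> \<theta> \<theta>'"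
    proof (rule AE_finite_allI[OF assms(2)])
      fix k assume "k \<in> I"
      then show "AE \<omega> in ?P. \<forall>\<theta>\<in>\<Theta>. \<forall>\<theta>'\<in>\<Theta>. \<bar>g \<theta> (\<omega> k) - g \<theta>' (\<omega> k)\<bar> \<le> 2 * C1 * \<rho> \<theta> \<theta>'"
        by (rule AE_PiM_component[OF prob_space_axioms _ gC1])
    qed
    then show ?thesis
    proof (rule AE_mp, intro AE_I2 impI ballI)
      fix \<omega> \<theta> assume *: "\<forall>k\<in>I. \<forall>\<theta>\<in>\<Theta>. \<forall>\<theta>'\<in>\<Theta>. \<bar>g \<theta> (\<omega> k) - g \<theta>' (\<omega> k)\<bar> \<le> 2 * C1 * \<rho> \<theta> \<theta>'"
        and \<theta>: "\<theta> \<in> \<Theta>"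
      obtain \<pi> where \<pi>: "\<And>j. \<pi> j \<in> T j" "\<And>j. \<rho> \<theta> (\<pi> j) \<le> (1/2) ^ j" using cover[OF \<theta>] by metis
      have step: "\<bar>Z (\<pi> (Suc j)) \<omega> - Z (\<pi> j) \<omega>\<bar> \<le> \<Phi> j \<omega>" for j
      proof (rule \<Phi>'(2)[OF \<pi>(1) \<pi>(1)])
        have "\<rho> (\<pi> (Suc j)) (\<pi> j) \<le> \<rho> \<theta> (\<pi> (Suc j)) + \<rho> \<theta> (\<pi> j)" using \<rho> by metis
        also have "\<dots> \<le> (1/2) ^ Suc j + (1/2) ^ j" by (intro add_mono \<pi>)
        also have "\<dots> \<le> 2 * (1/2) ^ j" by simp
        finally show "\<rho> (\<pi> (Suc j)) (\<pi> j) \<le> 2 * (1/2) ^ j" .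
      qed
      have "\<bar>Z (\<pi> m) \<omega>\<bar> \<le> \<Psi>0 \<omega> + (\<Sum>j<m. \<Phi> j \<omega>)" for m
      proof (induction m)
        case 0 then show ?case using \<Psi>0'(2)[OF \<pi>(1)] by simp
      next
        case (Suc m) then show ?case using step[of m] by simp
      qed
      from this[of ?N] have 1: "\<bar>Z (\<pi> ?N) \<omega>\<bar> \<le> \<Psi>0 \<omega> + (\<Sum>j<?N. \<Phi> j \<omega>)" .
      have "\<bar>Z \<theta> \<omega> - Z (\<pi> ?N) \<omega>\<bar> \<le> (\<Sum>k\<in>I. \<bar>g \<theta> (\<omega> k) - g (\<pi> ?N) (\<omega> k)\<bar>)"
        unfolding Z_def sum_subtractf[symmetric] by (rule sum_abs)
      also have "\<dots> \<le> (\<Sum>k\<in>I. 2 * C1 * (1/2) ^ ?N)"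
      proof (rule sum_mono)
        fix k assume k: "k \<in> I"
        have "\<bar>g \<theta> (\<omega> k) - g (\<pi> ?N) (\<omega> k)\<bar> \<le> 2 * C1 * \<rho> \<theta> (\<pi> ?N)" using * k \<theta> \<pi>(1) T(3) by blast
        also have "\<dots> \<le> 2 * C1 * (1/2) ^ ?N" using \<pi>(2) C by (intro mult_left_mono) auto
        finally show "\<bar>g \<theta> (\<omega> k) - g (\<pi> ?N) (\<omega> k)\<bar> \<le> 2 * C1 * (1/2) ^ ?N" .
      qed
      also have "\<dots> = 2 * C1 * (?N * (1/2) ^ ?N)" by simp
      also have "\<dots> \<le> 2 * C1 * sqrt ?N"
      proof (intro mult_left_mono)
        have "real ?N \<le> 2 ^ ?N" using of_nat_less_two_power[of ?N, where 'a = real] by simp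
        then have "?N * (1/2) ^ ?N \<le> (1::real)" by (simp add: field_simps)
        also have "\<dots> \<le> sqrt ?N" using n by simp
        finally show "?N * (1/2) ^ ?N \<le> sqrt ?N" .
      qed (use C in auto)
      finally show "\<bar>Z \<theta> \<omega>\<bar> \<le> \<Psi> \<omega>" using 1 unfolding \<Psi>_def by linarith
    qed
  qed
  moreover have "(\<integral>\<^sup>+\<omega>. ennreal (\<Psi> \<omega>) \<partial>?P) \<le>
      ennreal (sqrt ?N * (2 * C0 * (\<alpha> + 2) + 4 * C1 * (4 + 4 * \<alpha> + 6 * \<beta>) + 2 * C1))"
  proof -
    have ab: "0 \<le> \<alpha> + \<beta> * real j" for j using T1[of j] T(4)[of j] by (smt (verit) ln_ge_zero of_nat_1 of_nat_mono)
    have \<alpha>: "0 \<le> \<alpha>" using ab[of 0] by simp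
    have ab': "0 \<le> 2 + 2 * \<alpha> + \<beta> * (2 * real j + 1)" for j
      using ab[of j] ab[of "Suc j"] by (simp add: algebra_simps)
    have "(\<integral>\<^sup>+\<omega>. ennreal (\<Psi> \<omega>) \<partial>?P) = (\<integral>\<^sup>+\<omega>. ennreal (\<Psi>0 \<omega>) + (\<Sum>j<?N. ennreal (\<Phi> j \<omega>)) + ennreal (2 * C1 * sqrt ?N) \<partial>?P)"
      unfolding \<Psi>_def using \<Psi>0' \<Phi>' C
      by (intro nn_integral_cong) (simp add: ennreal_plus sum_nonneg)
    also have "\<dots> = (\<integral>\<^sup>+\<omega>. ennreal (\<Psi>0 \<omega>) \<partial>?P) + (\<Sum>j<?N. (\<integral>\<^sup>+\<omega>. ennreal (\<Phi> j \<omega>) \<partial>?P)) + ennreal (2 * C1 * sqrt ?N)"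
      by (simp add: nn_integral_add nn_integral_sum P.emeasure_space_1)
    also have "\<dots> \<le> ennreal (2 * C0 * sqrt ?N * (\<alpha> + 2)) +
        (\<Sum>j<?N. ennreal (4 * C1 * (1/2) ^ j * sqrt ?N * (2 + 2 * \<alpha> + \<beta> * (2 * j + 1)))) + ennreal (2 * C1 * sqrt ?N)"
    proof (intro add_mono sum_mono order.refl)
      show "(\<integral>\<^sup>+\<omega>. ennreal (\<Phi> j \<omega>) \<partial>?P) \<le> ennreal (4 * C1 * (1/2) ^ j * sqrt ?N * (2 + 2 * \<alpha> + \<beta> * (2 * j + 1)))" for j
        using \<Phi>'(3)[of j] by (simp add: add.commute)
      have "ln (2 * card (T 0)) = ln 2 + ln (card (T 0))" using T1[of 0] by (simp add: ln_mult)
      moreover have "ln (2::real) < 1" using ln_2_less_1 .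
      ultimately have "ln (2 * card (T 0)) + 1 / 2 \<le> \<alpha> + 2" using T(4)[of 0] by simp
      then have "ennreal (2 * C0 * sqrt ?N * (ln (2 * card (T 0)) + 1 / 2)) \<le> ennreal (2 * C0 * sqrt ?N * (\<alpha> + 2))"
        using C by (intro ennreal_leI mult_left_mono) auto
      with \<Psi>0'(3) show "(\<integral>\<^sup>+\<omega>. ennreal (\<Psi>0 \<omega>) \<partial>?P) \<le> ennreal (2 * C0 * sqrt ?N * (\<alpha> + 2))"
        by (rule order_trans)
    qed
    also have "\<dots> = ennreal (2 * C0 * sqrt ?N * (\<alpha> + 2) +
        (\<Sum>j<?N. 4 * C1 * (1/2) ^ j * sqrt ?N * (2 + 2 * \<alpha> + \<beta> * (2 * j + 1))) + 2 * C1 * sqrt ?N)"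
    proof -
      have "0 \<le> 4 * C1 * (1/2) ^ j * sqrt ?N * (2 + 2 * \<alpha> + \<beta> * (2 * j + 1))" for j
        using ab'[of j] C by (intro mult_nonneg_nonneg) (auto simp: add.commute)
      moreover have "0 \<le> 2 * C0 * sqrt ?N * (\<alpha> + 2)" "0 \<le> 2 * C1 * sqrt ?N"
        using C \<alpha> by (auto intro!: mult_nonneg_nonneg)
      ultimately show ?thesis
        by (simp add: sum_ennreal ennreal_plus[symmetric] sum_nonneg del: ennreal_plus)
    qed
    also have "(\<Sum>j<?N. 4 * C1 * (1/2) ^ j * sqrt ?N * (2 + 2 * \<alpha> + \<beta> * (2 * j + 1))) =
        4 * C1 * sqrt ?N * ((2 + 2 * \<alpha>) * (\<Sum>j<?N. (1/2) ^ j) + \<beta> * (\<Sum>j<?N. (1/2) ^ j * (2 * real j + 1)))"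
      by (simp add: sum_distrib_left sum.distrib[symmetric] algebra_simps)
    also have "ennreal (2 * C0 * sqrt ?N * (\<alpha> + 2) + \<dots> + 2 * C1 * sqrt ?N) \<le>
       ennreal (2 * C0 * sqrt ?N * (\<alpha> + 2) + 4 * C1 * sqrt ?N * ((2 + 2 * \<alpha>) * 2 + \<beta> * 6) + 2 * C1 * sqrt ?N)"
      using C \<alpha> T(5) sum_half_powers_le[of ?N]
      by (intro ennreal_leI add_mono order.refl mult_left_mono) auto
    also have "2 * C0 * sqrt ?N * (\<alpha> + 2) + 4 * C1 * sqrt ?N * ((2 + 2 * \<alpha>) * 2 + \<beta> * 6) + 2 * C1 * sqrt ?N =
       sqrt ?N * (2 * C0 * (\<alpha> + 2) + 4 * C1 * (4 + 4 * \<alpha> + 6 * \<beta>) + 2 * C1)"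
      by (simp add: algebra_simps)
    finally show ?thesis .
  qed
  ultimately show ?thesis unfolding Z_def g_def by blast
qed

section \<open>Nets of Euclidean balls\<close>

lemma edist_commute: "edist d x y = edist d y x"
  by (simp add: edist_def L2_set_def power2_commute)

lemma edist_nonneg: "0 \<le> edist d x y"
  by (simp add: edist_def)

lemma edist_triangle: "edist d x z \<le> edist d x y + edist d y z"
  using L2_set_triangle_ineq[of "\<lambda>i. x i - y i" "\<lambda>i. y i - z i" "{..<d}"]
  by (simp add: edist_def)

text \<open>Two points in the same grid cell of side \<open>s\<close> are at distance at most
  \<open>s * sqrt d\<close>. One point of the ball is kept for each occupied cell, which places the
  net inside the ball; occupied cells are counted coordinate by coordinate in the enclosing
  cube.\<close>

lemma eball_net:
  assumes s: "0 < s" and r: "0 \<le> r"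
  shows "\<exists>T. finite T \<and> T \<noteq> {} \<and> T \<subseteq> eball d r \<and> (\<forall>x\<in>eball d r. \<exists>t\<in>T. edist d x t \<le> s * sqrt d) \<and>
    real (card T) \<le> (2 * r / s + 2) ^ d"
proof -
  define cell where "cell x = (\<lambda>i\<in>{..<d}. \<lfloor>x i / s\<rfloor>)" for x :: point
  define C where "C = cell ` eball d r"
  define T where "T = inv_into (eball d r) cell ` C"
  have C_sub: "C \<subseteq> (\<Pi>\<^sub>E i\<in>{..<d}. {\<lfloor>- r / s\<rfloor>..\<lfloor>r / s\<rfloor>})"
  proof
    fix c assume "c \<in> C"
    then obtain x where x: "x \<in> eball d r" "c = cell x" by (auto simp: C_def)
    have "\<lfloor>- r / s\<rfloor> \<le> \<lfloor>x i / s\<rfloor> \<and> \<lfloor>x i / s\<rfloor> \<le> \<lfloor>r / s\<rfloor>" if "i < d" for i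
      using eball_abs_le[OF x(1) that] s by (intro conjI floor_mono divide_right_mono) auto
    then show "c \<in> (\<Pi>\<^sub>E i\<in>{..<d}. {\<lfloor>- r / s\<rfloor>..\<lfloor>r / s\<rfloor>})"
      by (auto simp: x(2) cell_def)
  qed
  have fin: "finite (\<Pi>\<^sub>E i\<in>{..<d}. {\<lfloor>- r / s\<rfloor>..\<lfloor>r / s\<rfloor>})" by (intro finite_PiE) auto
  then have finC: "finite C" using C_sub finite_subset by blast
  have "0 \<le> r / s" using s r by simp
  then have "real_of_int (\<lfloor>r / s\<rfloor> - \<lfloor>- r / s\<rfloor> + 1) \<le> 2 * r / s + 2" and le: "\<lfloor>- r / s\<rfloor> \<le> \<lfloor>r / s\<rfloor>"
    using s r by (linarith, intro floor_mono) (simp add: divide_right_mono)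
  then have "real (nat (\<lfloor>r / s\<rfloor> + 1 - \<lfloor>- r / s\<rfloor>)) \<le> 2 * r / s + 2"
    by simp
  have "real (card T) \<le> real (card C)" unfolding T_def using card_image_le[OF finC] by simp
  also have "\<dots> \<le> real (card (\<Pi>\<^sub>E i\<in>{..<d}. {\<lfloor>- r / s\<rfloor>..\<lfloor>r / s\<rfloor>}))"
    using card_mono[OF fin C_sub] by simp
  also have "\<dots> = real (nat (\<lfloor>r / s\<rfloor> + 1 - \<lfloor>- r / s\<rfloor>)) ^ d"
    by (simp add: card_PiE algebra_simps)
  also have "\<dots> \<le> (2 * r / s + 2) ^ d"
    by (intro power_mono of_nat_0_le_iff) fact
  finally have card: "real (card T) \<le> (2 * r / s + 2) ^ d" .
  have "\<exists>t\<in>T. edist d x t \<le> s * sqrt d" if x: "x \<in> eball d r" for x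
  proof
    define t where "t = inv_into (eball d r) cell (cell x)"
    show "t \<in> T" unfolding t_def T_def C_def using x by (intro imageI)
    have "cell t = cell x" unfolding t_def by (rule f_inv_into_f[OF imageI[OF x]])
    then have "\<lfloor>t i / s\<rfloor> = \<lfloor>x i / s\<rfloor>" if "i < d" for i
      using that by (auto simp: cell_def dest!: fun_cong[of _ _ i])
    then have "\<bar>x i / s - t i / s\<bar> \<le> 1" if "i < d" for i
      using that by (smt (verit) floor_eq_iff)
    then have "\<bar>x i - t i\<bar> \<le> s" if "i < d" for i
      using that s by (simp add: diff_divide_distrib[symmetric] abs_divide)
    then have "(x i - t i)\<^sup>2 \<le> s\<^sup>2" if "i < d" for i
      using that by (metis abs_le_square_iff abs_of_pos s)
    then have "(\<Sum>i<d. (x i - t i)\<^sup>2) \<le> (\<Sum>i<d. s\<^sup>2)" by (intro sum_mono) auto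
    then have "edist d x t \<le> sqrt (d * s\<^sup>2)"
      unfolding edist_def L2_set_def by (intro real_sqrt_le_mono) simp
    then show "edist d x t \<le> s * sqrt d" using s by (simp add: real_sqrt_mult mult.commute)
  qed
  moreover have "T \<subseteq> eball d r" unfolding T_def C_def by (auto intro: inv_into_into)
  moreover have "T \<noteq> {}" using zero_in_eball[OF r] unfolding T_def C_def by blast
  moreover have "finite T" unfolding T_def using finC by simp
  ultimately show ?thesis using card by blast
qed

text \<open>Halving the scale at most doubles the count in each of the \<open>2 * d\<close>
  coordinates, so by \<open>ln 2 \<le> 1\<close> the entropy grows in \<open>j\<close> with slope at
  most \<open>2 * d\<close>.\<close>

lemma product_nets:
  assumes r: "0 \<le> r" "0 \<le> r'" and d: "1 \<le> d"
  shows "\<exists>T. finite T \<and> T \<noteq> {} \<and> T \<subseteq> eball d r \<times> eball d r' \<and>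
    (\<forall>\<theta>\<in>eball d r \<times> eball d r'. \<exists>t\<in>T. edist d (fst \<theta>) (fst t) + edist d (snd \<theta>) (snd t) \<le> (1/2) ^ j) \<and>
    ln (card T) \<le> d * (ln (4 * r * sqrt d + 2) + ln (4 * r' * sqrt d + 2)) + 2 * real d * real j"
proof -
  \<comment> \<open>Cells of side \<open>s\<close> give distance \<open>s * sqrt d\<close>, which is
    half of the admissible \<open>(1/2) ^ j\<close> for each of the two factors.\<close>
  define s where "s = (1/2) ^ j / (2 * sqrt d)"
  have sd: "0 < sqrt d" using d by simp
  have s: "0 < s" "s * sqrt d = (1/2) ^ j / 2" using sd by (simp_all add: s_def)
  obtain T where T: "finite T" "T \<noteq> {}" "T \<subseteq> eball d r" "\<And>x. x \<in> eball d r \<Longrightarrow> \<exists>t\<in>T. edist d x t \<le> (1/2) ^ j / 2"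
    "real (card T) \<le> (2 * r / s + 2) ^ d"
    using eball_net[OF s(1) r(1), of d] unfolding s(2) by blast
  obtain U where U: "finite U" "U \<noteq> {}" "U \<subseteq> eball d r'" "\<And>x. x \<in> eball d r' \<Longrightarrow> \<exists>t\<in>U. edist d x t \<le> (1/2) ^ j / 2"
    "real (card U) \<le> (2 * r' / s + 2) ^ d"
    using eball_net[OF s(1) r(2), of d] unfolding s(2) by blast
  have ln_le: "ln (real n) \<le> d * ln (4 * q * sqrt d + 2) + d * j"
    if "real n \<le> (2 * q / s + 2) ^ d" "0 \<le> q" "0 < n" for n q
  proof -
    have "2 * q / s + 2 \<le> (4 * q * sqrt d + 2) * 2 ^ j"
    proof -
      have "2 * q / s = 4 * q * sqrt d * 2 ^ j" by (simp add: s_def power_one_over field_simps)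
      moreover have "(2::real) \<le> 2 * 2 ^ j" by simp
      ultimately show ?thesis unfolding distrib_right by linarith
    qed
    then have "(2 * q / s + 2) ^ d \<le> ((4 * q * sqrt d + 2) * 2 ^ j) ^ d"
      using s that by (intro power_mono) auto
    with that have "real n \<le> ((4 * q * sqrt d + 2) * 2 ^ j) ^ d" by linarith
    moreover have pos: "0 < 4 * q * sqrt d + 2" using that by (intro add_nonneg_pos) auto
    ultimately have "ln (real n) \<le> ln (((4 * q * sqrt d + 2) * 2 ^ j) ^ d)"
      using that by (subst ln_le_cancel_iff) auto
    also have "\<dots> = d * (ln (4 * q * sqrt d + 2) + j * ln 2)"
      using pos by (simp add: ln_realpow ln_mult)
    also have "\<dots> \<le> d * (ln (4 * q * sqrt d + 2) + j * 1)"
      using mult_left_mono[OF less_imp_le[OF ln_2_less_1], of "real j"]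
      by (intro mult_left_mono add_left_mono) auto
    finally show ?thesis by (simp add: algebra_simps)
  qed
  have "0 < card T" "0 < card U" using T U by (simp_all add: card_gt_0_iff)
  then have "ln (card (T \<times> U)) = ln (card T) + ln (card U)"
    by (simp add: card_cartesian_product ln_mult)
  also have "\<dots> \<le> d * ln (4 * r * sqrt d + 2) + d * j + (d * ln (4 * r' * sqrt d + 2) + d * j)"
    using T(5) U(5) r \<open>0 < card T\<close> \<open>0 < card U\<close> by (intro add_mono ln_le)
  also have "\<dots> = d * (ln (4 * r * sqrt d + 2) + ln (4 * r' * sqrt d + 2)) + 2 * real d * real j"
    by (simp add: algebra_simps)
  finally have card: "ln (card (T \<times> U)) \<le> \<dots>" .
  have cover: "\<exists>t\<in>T \<times> U. edist d (fst \<theta>) (fst t) + edist d (snd \<theta>) (snd t) \<le> (1/2) ^ j"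
    if \<theta>: "\<theta> \<in> eball d r \<times> eball d r'" for \<theta>
  proof -
    obtain t u where "t \<in> T" "edist d (fst \<theta>) t \<le> (1/2) ^ j / 2" "u \<in> U" "edist d (snd \<theta>) u \<le> (1/2) ^ j / 2"
      using T(4)[of "fst \<theta>"] U(4)[of "snd \<theta>"] \<theta> by auto
    then show ?thesis by (intro bexI[of _ "(t, u)"]) auto
  qed
  show ?thesis
    using T(1-3) U(1-3) card cover by (intro exI[of _ "T \<times> U"]) auto
qed

text \<open>The inscribed cube has half side \<open>r / sqrt d\<close>. Read backwards, the bound
  later limits the radius of the state space by its volume.\<close>

lemma cube_le_emeasure_lebesgue_ball:
  assumes "0 \<le> r" "1 \<le> d"
  shows "ennreal ((2 * r / sqrt d) ^ d) \<le> emeasure (lebesgue_ball d r) (eball d r)"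
proof -
  define c where "c = r / sqrt d"
  have c: "0 \<le> c" "d * c\<^sup>2 = r\<^sup>2" using assms by (simp_all add: c_def power_divide)
  have sub: "(\<Pi>\<^sub>E i\<in>{..<d}. {-c..c}) \<subseteq> eball d r"
  proof
    fix x assume x: "x \<in> (\<Pi>\<^sub>E i\<in>{..<d}. {-c..c})"
    have "(x i)\<^sup>2 \<le> c\<^sup>2" if "i < d" for i
    proof -
      have "\<bar>x i\<bar> \<le> \<bar>c\<bar>" using x that c by (force simp: PiE_iff abs_le_iff)
      then show ?thesis by (simp add: abs_le_square_iff)
    qed
    then have "(\<Sum>i<d. (x i)\<^sup>2) \<le> (\<Sum>i<d. c\<^sup>2)" by (intro sum_mono) auto
    then have "L2_set x {..<d} \<le> sqrt (r\<^sup>2)"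
      unfolding L2_set_def c(2)[symmetric] by (intro real_sqrt_le_mono) simp
    then show "x \<in> eball d r" using x assms by (auto simp: eball_def PiE_iff)
  qed
  have "ennreal ((2 * r / sqrt d) ^ d) = (\<Prod>i<d. emeasure lborel {-c..c})"
    using c by (simp add: emeasure_lborel_Icc_eq ennreal_power c_def)
  also have "\<dots> = emeasure (PiM {..<d} (\<lambda>_. lborel)) (\<Pi>\<^sub>E i\<in>{..<d}. {-c..c})"
    by (intro product_sigma_finite.emeasure_PiM[symmetric]) (auto simp: product_sigma_finite_def sigma_finite_lborel)
  also have "\<dots> \<le> emeasure (PiM {..<d} (\<lambda>_. lborel)) (eball d r)"
    by (intro emeasure_mono sub sets_eball)
  also have "\<dots> = emeasure (lebesgue_ball d r) (eball d r)"
    unfolding lebesgue_ball_def by (rule emeasure_restrict_space[symmetric]) auto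
  finally show ?thesis .
qed

section \<open>Dynamic programming\<close>

text \<open>Adding the bound makes the function nonnegative; in this way identities for nonnegative
  integrals transfer to bounded real functions.\<close>

lemma nn_integral_shift:
  fixes f :: "'a \<Rightarrow> real"
  assumes "prob_space M" and f[measurable]: "f \<in> borel_measurable M" and B: "\<And>x. x \<in> space M \<Longrightarrow> \<bar>f x\<bar> \<le> B"
  shows "(\<integral>\<^sup>+x. ennreal (f x + B) \<partial>M) = ennreal ((\<integral>x. f x \<partial>M) + B)" "\<bar>\<integral>x. f x \<partial>M\<bar> \<le> B" "integrable M f"
proof -
  interpret prob_space M by fact
  show int: "integrable M f"
    by (rule integrable_const_bound[of _ B]) (use B in \<open>auto intro: AE_I2\<close>)
  have B0: "0 \<le> f x + B" if "x \<in> space M" for x using B[OF that] by (simp add: abs_le_iff)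
  have "(\<integral>\<^sup>+x. ennreal (f x + B) \<partial>M) = ennreal (\<integral>x. f x + B \<partial>M)"
    using int B0 by (intro nn_integral_eq_integral) auto
  then show "(\<integral>\<^sup>+x. ennreal (f x + B) \<partial>M) = ennreal ((\<integral>x. f x \<partial>M) + B)"
    using int by (simp add: prob_space)
  have "\<bar>\<integral>x. f x \<partial>M\<bar> \<le> (\<integral>x. \<bar>f x\<bar> \<partial>M)" using integral_norm_bound[of M f] by simp
  also have "\<dots> \<le> (\<integral>x. B \<partial>M)" using int B by (intro integral_mono) auto
  finally show "\<bar>\<integral>x. f x \<partial>M\<bar> \<le> B" by (simp add: prob_space)
qed

text \<open>The tower property, transferred from nonnegative integrals by the shift with
  \<open>B\<close>.\<close>

lemma integral_bind_bounded:
  fixes f :: "'b \<Rightarrow> real"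
  assumes M: "M \<in> space (prob_algebra L)" and N: "N \<in> L \<rightarrow>\<^sub>M prob_algebra K"
    and f[measurable]: "f \<in> borel_measurable K" and B: "\<And>x. x \<in> space K \<Longrightarrow> \<bar>f x\<bar> \<le> B"
  shows "(\<integral>y. f y \<partial>(M \<bind> N)) = (\<integral>x. (\<integral>y. f y \<partial>N x) \<partial>M)"
proof -
  have pM: "prob_space M" and sM[measurable_cong]: "sets M = sets L" using M by (simp_all add: space_prob_algebra)
  have spM: "space M = space L" by (rule sets_eq_imp_space_eq[OF sM])
  have pB: "prob_space (M \<bind> N)" and sB: "sets (M \<bind> N) = sets K"
    using prob_space_bind'[OF M N] sets_bind'[OF M N] by auto
  have spB: "space (M \<bind> N) = space K" by (rule sets_eq_imp_space_eq[OF sB])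
  have N': "N \<in> L \<rightarrow>\<^sub>M subprob_algebra K" by (rule measurable_prob_algebraD[OF N])
  have pN: "prob_space (N x)" "sets (N x) = sets K" "space (N x) = space K" if "x \<in> space L" for x
    using measurable_space[OF N that] sets_eq_imp_space_eq[of "N x" K] by (auto simp: space_prob_algebra)
  have I: "(\<lambda>x. \<integral>y. f y \<partial>N x) \<in> borel_measurable L"
    by (rule measurable_compose[OF N' integral_measurable_subprob_algebra[OF f]])
  have I': "(\<lambda>x. \<integral>y. f y \<partial>N x) \<in> borel_measurable M" using I sM by (simp cong: measurable_cong_sets)
  have fN: "f \<in> borel_measurable (N x)" if "x \<in> space L" for x
    using f pN(2)[OF that] by (simp cong: measurable_cong_sets)
  have fB: "f \<in> borel_measurable (M \<bind> N)"
    using f sB by (simp cong: measurable_cong_sets)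
  have IB: "\<bar>\<integral>y. f y \<partial>N x\<bar> \<le> B" if "x \<in> space L" for x
    by (rule nn_integral_shift(2)[OF pN(1)[OF that] fN[OF that]]) (use B pN(3)[OF that] in auto)
  have "ennreal ((\<integral>y. f y \<partial>(M \<bind> N)) + B) = (\<integral>\<^sup>+y. ennreal (f y + B) \<partial>(M \<bind> N))"
    by (rule nn_integral_shift(1)[OF pB fB, symmetric]) (use B spB in auto)
  also have "\<dots> = (\<integral>\<^sup>+x. (\<integral>\<^sup>+y. ennreal (f y + B) \<partial>N x) \<partial>M)"
    by (rule nn_integral_bind[where B = K]) (use N' sM in \<open>auto cong: measurable_cong_sets\<close>)
  also have "\<dots> = (\<integral>\<^sup>+x. ennreal ((\<integral>y. f y \<partial>N x) + B) \<partial>M)"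
    by (intro nn_integral_cong nn_integral_shift(1)) (use pN fN B spM in auto)
  also have "\<dots> = ennreal ((\<integral>x. (\<integral>y. f y \<partial>N x) \<partial>M) + B)"
    by (rule nn_integral_shift(1)[OF pM I']) (use IB spM in auto)
  finally show ?thesis
    using nn_integral_shift(2)[OF pB fB, of B] nn_integral_shift(2)[OF pM I', of B] B spB IB spM
    by (subst (asm) ennreal_inj) (auto simp: abs_le_iff)
qed

text \<open>Fixes one such countable family, so that the backward recursion for the value function
  can be a definition. Its existence is \<open>ae_sup_selection\<close>.\<close>

definition near_maximizers :: "nat \<Rightarrow> mdp \<Rightarrow> (point \<times> point \<Rightarrow> real) \<Rightarrow> nat \<Rightarrow> point \<Rightarrow> point" where
  "near_maximizers d M f = (SOME \<alpha>. (\<forall>n::nat. \<alpha> n \<in> state_space d M \<rightarrow>\<^sub>M action_space d M) \<and>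
    (AE x in state_space d M. (SUP a\<in>actions d M. f (x, a)) = (SUP n. f (x, \<alpha> n x))))"

text \<open>The index counts remaining steps: the decision is taken at time
  \<open>H - Suc k\<close>, the transition leads into time \<open>H - k\<close>, and
  \<open>w\<close> stands for the value with \<open>k\<close> steps to go.\<close>

definition q_fun :: "nat \<Rightarrow> nat \<Rightarrow> mdp \<Rightarrow> nat \<Rightarrow> (point \<Rightarrow> real) \<Rightarrow> point \<times> point \<Rightarrow> real" where
  "q_fun d H M k w = (\<lambda>(x, a). reward M (H - Suc k) x a + (\<integral>y. w y \<partial>trans_kernel d M (H - k) x a))"

text \<open>A Borel version of the optimal value with \<open>k\<close> steps to go: the supremum over all actions is only
  almost everywhere equal to a Borel function.\<close>

primrec value_fun :: "nat \<Rightarrow> nat \<Rightarrow> mdp \<Rightarrow> nat \<Rightarrow> point \<Rightarrow> real" where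
  "value_fun d H M 0 = terminal M"
| "value_fun d H M (Suc k) =
    (\<lambda>x. SUP n. q_fun d H M k (value_fun d H M k) (x, near_maximizers d M (q_fun d H M k (value_fun d H M k)) n x))"

locale bounded_mdp =
  fixes d H :: nat and M :: mdp and G :: real
  assumes mdp: "is_mdp d H M" and rewards: "bounded_rewards d H M G"
begin

abbreviation "S \<equiv> state_space d M"
abbreviation "A \<equiv> action_space d M"
abbreviation "W \<equiv> value_fun d H M"
abbreviation "Q k \<equiv> q_fun d H M k (W k)"

lemma radii: "0 < state_radius M" "0 < action_radius M"
  using mdp by (auto simp: is_mdp_def)

lemma space_S[simp]: "space S = states d M" and space_A[simp]: "space A = actions d M"
  by (simp_all add: state_space_def states_def action_space_def actions_def)

lemma states_nonempty: "states d M \<noteq> {}" and actions_nonempty: "actions d M \<noteq> {}"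
  using zero_in_eball radii by (auto simp: states_def actions_def intro!: exI less_imp_le)

lemma kernel: "1 \<le> h \<Longrightarrow> h \<le> H \<Longrightarrow> (\<lambda>(x, a). trans_kernel d M h x a) \<in> S \<Otimes>\<^sub>M A \<rightarrow>\<^sub>M prob_algebra S"
  using mdp by (simp add: is_mdp_def)

lemma kernel_prob:
  assumes "1 \<le> h" "h \<le> H" "x \<in> states d M" "a \<in> actions d M"
  shows "prob_space (trans_kernel d M h x a)" "sets (trans_kernel d M h x a) = sets S"
    "space (trans_kernel d M h x a) = states d M"
  using measurable_space[OF kernel[OF assms(1,2)], of "(x, a)"] assms
  by (auto simp: space_prob_algebra space_pair_measure trans_kernel_def)

lemma reward_measurable: "h < H \<Longrightarrow> (\<lambda>(x, a). reward M h x a) \<in> borel_measurable (S \<Otimes>\<^sub>M A)"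
  using mdp by (simp add: is_mdp_def)

lemma reward_bound: "h < H \<Longrightarrow> x \<in> states d M \<Longrightarrow> a \<in> actions d M \<Longrightarrow> \<bar>reward M h x a\<bar> \<le> G"
  using rewards by (simp add: bounded_rewards_def)

lemma q_fun_props:
  assumes k: "k < H" and w: "w \<in> borel_measurable S" "\<forall>x\<in>states d M. \<bar>w x\<bar> \<le> B"
  shows "q_fun d H M k w \<in> borel_measurable (S \<Otimes>\<^sub>M A)"
    "\<And>x a. x \<in> states d M \<Longrightarrow> a \<in> actions d M \<Longrightarrow> \<bar>\<integral>y. w y \<partial>trans_kernel d M (H - k) x a\<bar> \<le> B"
    "\<And>x a. x \<in> states d M \<Longrightarrow> a \<in> actions d M \<Longrightarrow> \<bar>q_fun d H M k w (x, a)\<bar> \<le> G + B"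
proof -
  have "(\<lambda>p. \<integral>y. w y \<partial>(\<lambda>(x, a). trans_kernel d M (H - k) x a) p) \<in> borel_measurable (S \<Otimes>\<^sub>M A)"
    using measurable_prob_algebraD[OF kernel] w(1) k
    by (intro measurable_compose[OF _ integral_measurable_subprob_algebra]) auto
  then have 1: "(\<lambda>(x, a). \<integral>y. w y \<partial>trans_kernel d M (H - k) x a) \<in> borel_measurable (S \<Otimes>\<^sub>M A)"
    by (simp add: split_def)
  have 2: "(\<lambda>(x, a). reward M (H - Suc k) x a) \<in> borel_measurable (S \<Otimes>\<^sub>M A)"
    using k by (intro reward_measurable) simp
  show "q_fun d H M k w \<in> borel_measurable (S \<Otimes>\<^sub>M A)"
    using borel_measurable_add[OF 2 1] by (simp add: q_fun_def split_def)
  fix x a assume xa: "x \<in> states d M" "a \<in> actions d M"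
  note P = kernel_prob[of "H - k", OF _ _ xa]
  show *: "\<bar>\<integral>y. w y \<partial>trans_kernel d M (H - k) x a\<bar> \<le> B"
    by (rule nn_integral_shift(2)) (use P k w in \<open>auto cong: measurable_cong_sets\<close>)
  show "\<bar>q_fun d H M k w (x, a)\<bar> \<le> G + B"
    using * reward_bound[of "H - Suc k" x a] xa k unfolding q_fun_def by simp
qed

lemma near_maximizers:
  assumes "f \<in> borel_measurable (S \<Otimes>\<^sub>M A)" "\<forall>x\<in>states d M. \<forall>a\<in>actions d M. \<bar>f (x, a)\<bar> \<le> B"
  shows "near_maximizers d M f n \<in> S \<rightarrow>\<^sub>M A"
    "AE x in S. (SUP a\<in>actions d M. f (x, a)) = (SUP n. f (x, near_maximizers d M f n x))"
proof -
  have "\<exists>\<alpha>. (\<forall>n::nat. \<alpha> n \<in> S \<rightarrow>\<^sub>M A) \<and> (AE x in S. (SUP a\<in>actions d M. f (x, a)) = (SUP n. f (x, \<alpha> n x)))"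
    using ae_sup_selection[of f d "state_radius M" "action_radius M" B] assms radii
    unfolding state_space_def action_space_def states_def actions_def by (simp add: less_imp_le)
  from someI_ex[OF this, folded near_maximizers_def]
  show "near_maximizers d M f n \<in> S \<rightarrow>\<^sub>M A"
    "AE x in S. (SUP a\<in>actions d M. f (x, a)) = (SUP n. f (x, near_maximizers d M f n x))" by auto
qed

lemma value_fun_props:
  assumes "k \<le> H"
  shows "W k \<in> borel_measurable S \<and> (\<forall>x\<in>states d M. \<bar>W k x\<bar> \<le> (real k + 1) * G)"
  using assms
proof (induction k)
  case 0
  show ?case using mdp rewards by (simp add: is_mdp_def bounded_rewards_def)
next
  case (Suc k)
  then have k: "k < H" and IH: "W k \<in> borel_measurable S" "\<forall>x\<in>states d M. \<bar>W k x\<bar> \<le> (real k + 1) * G"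
    by auto
  note q = q_fun_props[OF k IH]
  have "\<forall>x\<in>states d M. \<forall>a\<in>actions d M. \<bar>Q k (x, a)\<bar> \<le> G + (real k + 1) * G" using q(3) by blast
  note m = near_maximizers[OF q(1) this]
  have Qn: "(\<lambda>x. Q k (x, near_maximizers d M (Q k) n x)) \<in> borel_measurable S" for n
  proof -
    have "(\<lambda>x. (x, near_maximizers d M (Q k) n x)) \<in> S \<rightarrow>\<^sub>M S \<Otimes>\<^sub>M A"
      by (rule measurable_Pair[OF measurable_ident_sets[OF refl] m(1)])
    from measurable_compose[OF this q(1)] show ?thesis .
  qed
  have b: "\<bar>Q k (x, near_maximizers d M (Q k) n x)\<bar> \<le> (real (Suc k) + 1) * G" if "x \<in> states d M" for n x
  proof -
    have "near_maximizers d M (Q k) n x \<in> actions d M"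
      using measurable_space[OF m(1)[of n], of x] that by simp
    from q(3)[OF that this] show ?thesis by (simp add: distrib_right)
  qed
  have bdd: "bdd_above (range (\<lambda>n. Q k (x, near_maximizers d M (Q k) n x)))" if "x \<in> states d M" for x
    using b[OF that] by (intro bdd_aboveI2) (auto simp: abs_le_iff)
  have "\<bar>W (Suc k) x\<bar> \<le> (real (Suc k) + 1) * G" if "x \<in> states d M" for x
  proof -
    have "W (Suc k) x \<le> (real (Suc k) + 1) * G"
      unfolding value_fun.simps using b[OF that] by (intro cSUP_least) (auto simp: abs_le_iff)
    moreover have "Q k (x, near_maximizers d M (Q k) 0 x) \<le> W (Suc k) x"
      unfolding value_fun.simps by (rule cSUP_upper[OF UNIV_I bdd[OF that]])
    ultimately show ?thesis using b[OF that, of 0] by (simp add: abs_le_iff)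
  qed
  moreover have "W (Suc k) \<in> borel_measurable S"
    unfolding value_fun.simps by (rule borel_measurable_cSUP[OF _ Qn]) (auto intro: bdd)
  ultimately show ?case by blast
qed

lemma
  assumes "k \<le> H"
  shows value_fun_measurable: "W k \<in> borel_measurable S"
    and value_fun_bound: "\<And>x. x \<in> states d M \<Longrightarrow> \<bar>W k x\<bar> \<le> (real k + 1) * G"
  using value_fun_props[OF assms] by auto

lemma
  assumes k: "k < H"
  shows Q_measurable: "Q k \<in> borel_measurable (S \<Otimes>\<^sub>M A)"
    and Q_bound: "\<And>x a. x \<in> states d M \<Longrightarrow> a \<in> actions d M \<Longrightarrow> \<bar>Q k (x, a)\<bar> \<le> (real k + 2) * G"
    and near_max_measurable: "near_maximizers d M (Q k) n \<in> S \<rightarrow>\<^sub>M A"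
    and value_fun_AE: "AE x in S. (SUP a\<in>actions d M. Q k (x, a)) = W (Suc k) x"
proof -
  have "W k \<in> borel_measurable S" "\<forall>x\<in>states d M. \<bar>W k x\<bar> \<le> (real k + 1) * G"
    using value_fun_props[of k] k by auto
  note q = q_fun_props[OF k this]
  have Q: "\<forall>x\<in>states d M. \<forall>a\<in>actions d M. \<bar>Q k (x, a)\<bar> \<le> G + (real k + 1) * G" using q(3) by blast
  note m = near_maximizers[OF q(1) Q]
  show "Q k \<in> borel_measurable (S \<Otimes>\<^sub>M A)" by (rule q)
  show "\<bar>Q k (x, a)\<bar> \<le> (real k + 2) * G" if "x \<in> states d M" "a \<in> actions d M" for x a
    using q(3)[OF that] by (simp add: distrib_right)
  show "near_maximizers d M (Q k) n \<in> S \<rightarrow>\<^sub>M A" by (rule m)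
  show "AE x in S. (SUP a\<in>actions d M. Q k (x, a)) = W (Suc k) x"
    unfolding value_fun.simps by (rule m)
qed

lemma bdd_above_Q: "k < H \<Longrightarrow> x \<in> states d M \<Longrightarrow> bdd_above ((\<lambda>a. Q k (x, a)) ` actions d M)"
  using Q_bound by (intro bdd_aboveI2[of _ _ "(real k + 2) * G"]) (auto simp: abs_le_iff)

end

lemma integral_const_plus:
  fixes f :: "'a \<Rightarrow> real"
  assumes "prob_space M" "f \<in> borel_measurable M" "\<And>x. x \<in> space M \<Longrightarrow> \<bar>f x\<bar> \<le> B"
  shows "(\<integral>x. c + f x \<partial>M) = c + (\<integral>x. f x \<partial>M)"
proof -
  interpret prob_space M by fact
  show ?thesis using nn_integral_shift(3)[OF assms] by (simp add: prob_space)
qed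

section \<open>Laws of histories and the optimality of the value function\<close>

context bounded_mdp
begin

abbreviation "hist t \<equiv> history_space d M t"

lemma space_hist: "space (hist t) = ({..t} \<rightarrow>\<^sub>E states d M) \<times> ({..<t} \<rightarrow>\<^sub>E actions d M)"
  by (simp add: history_space_def space_pair_measure space_PiM)

lemma hist_state_measurable: "i \<le> t \<Longrightarrow> (\<lambda>p. fst p i) \<in> hist t \<rightarrow>\<^sub>M S"
  unfolding history_space_def by (rule measurable_compose[OF measurable_fst measurable_component_singleton]) simp

lemma hist_action_measurable: "i < t \<Longrightarrow> (\<lambda>p. snd p i) \<in> hist t \<rightarrow>\<^sub>M A"
  unfolding history_space_def by (rule measurable_compose[OF measurable_snd measurable_component_singleton]) simp

lemma hist_extend_measurable:
  assumes "f \<in> N \<rightarrow>\<^sub>M hist t" "y \<in> N \<rightarrow>\<^sub>M S" "a \<in> N \<rightarrow>\<^sub>M A"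
  shows "(\<lambda>x. ((fst (f x))(Suc t := y x), (snd (f x))(t := a x))) \<in> N \<rightarrow>\<^sub>M hist (Suc t)"
  unfolding history_space_def
proof (rule measurable_Pair)
  have f: "(\<lambda>x. fst (f x)) \<in> N \<rightarrow>\<^sub>M PiM {..t} (\<lambda>_. S)" "(\<lambda>x. snd (f x)) \<in> N \<rightarrow>\<^sub>M PiM {..<t} (\<lambda>_. A)"
    using assms(1) unfolding history_space_def by (auto intro: measurable_compose[OF _ measurable_fst] measurable_compose[OF _ measurable_snd])
  show "(\<lambda>x. (fst (f x))(Suc t := y x)) \<in> N \<rightarrow>\<^sub>M PiM {..Suc t} (\<lambda>_. S)"
    by (rule measurable_fun_upd[OF _ f(1) assms(2)]) auto
  show "(\<lambda>x. (snd (f x))(t := a x)) \<in> N \<rightarrow>\<^sub>M PiM {..<Suc t} (\<lambda>_. A)"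
    by (rule measurable_fun_upd[OF _ f(2) assms(3)]) auto
qed

text \<open>The innermost part of the recursion for \<open>policy_law\<close>, isolated so that its
  joint measurability in history and action can be stated.\<close>

definition ext_kernel :: "nat \<Rightarrow> (nat \<Rightarrow> point) \<times> (nat \<Rightarrow> point) \<Rightarrow> point \<Rightarrow> ((nat \<Rightarrow> point) \<times> (nat \<Rightarrow> point)) measure" where
  "ext_kernel t p a = distr (trans_kernel d M (Suc t) (fst p t) a) (hist (Suc t))
     (\<lambda>y. ((fst p)(Suc t := y), (snd p)(t := a)))"

lemma ext_kernel_measurable:
  assumes "t < H"
  shows "(\<lambda>(p, a). ext_kernel t p a) \<in> hist t \<Otimes>\<^sub>M A \<rightarrow>\<^sub>M prob_algebra (hist (Suc t))"
proof -
  have 1: "(\<lambda>q. (fst (fst q) t, snd q)) \<in> hist t \<Otimes>\<^sub>M A \<rightarrow>\<^sub>M S \<Otimes>\<^sub>M A"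
    by (intro measurable_Pair measurable_snd measurable_compose[OF measurable_fst hist_state_measurable]) simp
  have "(\<lambda>q. trans_kernel d M (Suc t) (fst (fst q) t) (snd q)) \<in> hist t \<Otimes>\<^sub>M A \<rightarrow>\<^sub>M prob_algebra S"
    using measurable_compose[OF 1 kernel[of "Suc t"]] assms by (simp add: split_def)
  moreover have "(\<lambda>(q, y). ((fst (fst q))(Suc t := y), (snd (fst q))(t := snd q)))
      \<in> (hist t \<Otimes>\<^sub>M A) \<Otimes>\<^sub>M S \<rightarrow>\<^sub>M hist (Suc t)"
    unfolding split_def
    by (rule hist_extend_measurable[where f = "\<lambda>q. fst (fst q)"])
       (intro measurable_compose[OF measurable_fst measurable_fst] measurable_compose[OF measurable_fst measurable_snd]
         measurable_snd)+
  ultimately show ?thesis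
    unfolding ext_kernel_def split_def by (rule measurable_distr_prob_space2[where M = S, unfolded split_def])
qed

lemma policy_step_measurable:
  assumes "t < H" and \<pi>: "\<pi> t \<in> S \<rightarrow>\<^sub>M prob_algebra A"
  shows "(\<lambda>p. \<pi> t (fst p t) \<bind> ext_kernel t p) \<in> hist t \<rightarrow>\<^sub>M prob_algebra (hist (Suc t))"
  by (rule measurable_bind_prob_space2[OF measurable_compose[OF hist_state_measurable \<pi>] ext_kernel_measurable])
     (use assms in auto)

lemma policy_law_Suc:
  "policy_law d M \<pi> x0 (Suc t) = policy_law d M \<pi> x0 t \<bind> (\<lambda>p. \<pi> t (fst p t) \<bind> ext_kernel t p)"
  by (simp add: ext_kernel_def[abs_def] split_def)

lemma policy_law_prob:
  assumes "\<pi> \<in> policies d H M" "x0 \<in> states d M" "t \<le> H"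
  shows "policy_law d M \<pi> x0 t \<in> space (prob_algebra (hist t))"
  using assms(3)
proof (induction t)
  case 0
  have "(\<lambda>i\<in>{..0}. x0, \<lambda>i\<in>{}. undefined) \<in> space (hist 0)"
    using assms(2) by (auto simp: space_hist)
  then show ?case by (simp add: space_prob_algebra prob_space_return)
next
  case (Suc t)
  then have "policy_law d M \<pi> x0 t \<in> space (prob_algebra (hist t))" by simp
  moreover have "(\<lambda>p. \<pi> t (fst p t) \<bind> ext_kernel t p) \<in> hist t \<rightarrow>\<^sub>M prob_algebra (hist (Suc t))"
    using assms(1) Suc.prems by (intro policy_step_measurable) (auto simp: policies_def)
  ultimately show ?case
    unfolding policy_law_Suc space_prob_algebra[of "hist (Suc t)"]
    using prob_space_bind' sets_bind' by blast
qed

text \<open>Rewards collected so far plus the optimal value of the remaining steps. From time 1 on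
  its mean cannot increase under any policy, and at \<open>t = H\<close> the mean is the value of
  the policy.\<close>

definition run_value :: "nat \<Rightarrow> (nat \<Rightarrow> point) \<times> (nat \<Rightarrow> point) \<Rightarrow> real" where
  "run_value t p = (\<Sum>i<t. reward M i (fst p i) (snd p i)) + W (H - t) (fst p t)"

lemma past_reward_measurable:
  assumes "t \<le> H"
  shows "(\<lambda>p. \<Sum>i<t. reward M i (fst p i) (snd p i)) \<in> borel_measurable (hist t)"
proof (rule borel_measurable_sum)
  fix i assume "i \<in> {..<t}"
  then have i: "i < t" by simp
  have "(\<lambda>p. (fst p i, snd p i)) \<in> hist t \<rightarrow>\<^sub>M S \<Otimes>\<^sub>M A"
    using i by (intro measurable_Pair hist_state_measurable hist_action_measurable) auto
  from measurable_compose[OF this reward_measurable[of i]] i assms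
  show "(\<lambda>p. reward M i (fst p i) (snd p i)) \<in> borel_measurable (hist t)" by simp
qed

lemma past_reward_bound:
  assumes "t \<le> H" "p \<in> space (hist t)"
  shows "\<bar>\<Sum>i<t. reward M i (fst p i) (snd p i)\<bar> \<le> real t * G"
proof -
  have "\<bar>reward M i (fst p i) (snd p i)\<bar> \<le> G" if "i < t" for i
    using assms that by (intro reward_bound) (auto simp: space_hist PiE_iff)
  then have "(\<Sum>i<t. \<bar>reward M i (fst p i) (snd p i)\<bar>) \<le> (\<Sum>i<t. G)" by (intro sum_mono) auto
  then have "(\<Sum>i<t. \<bar>reward M i (fst p i) (snd p i)\<bar>) \<le> real t * G" by simp
  then show ?thesis by (rule order_trans[OF sum_abs])
qed

lemma run_value_measurable: "t \<le> H \<Longrightarrow> run_value t \<in> borel_measurable (hist t)"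
  unfolding run_value_def
  by (intro borel_measurable_add past_reward_measurable
      measurable_compose[OF hist_state_measurable value_fun_measurable]) auto

lemma run_value_bound:
  assumes t: "t \<le> H" and p: "p \<in> space (hist t)"
  shows "\<bar>run_value t p\<bar> \<le> (real H + 1) * G"
proof -
  have "fst p t \<in> states d M" using p by (auto simp: space_hist PiE_iff)
  then have "\<bar>W (H - t) (fst p t)\<bar> \<le> (real (H - t) + 1) * G" by (intro value_fun_bound) auto
  with past_reward_bound[OF assms] have "\<bar>run_value t p\<bar> \<le> real t * G + (real (H - t) + 1) * G"
    unfolding run_value_def by linarith
  also have "\<dots> = (real H + 1) * G" using t by (simp add: of_nat_diff algebra_simps)
  finally show ?thesis .
qed

text \<open>The conditional mean of \<open>run_value (Suc t)\<close> given the history up to time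
  \<open>t\<close>.\<close>

definition action_value :: "(nat \<Rightarrow> point \<Rightarrow> point measure) \<Rightarrow> nat \<Rightarrow> (nat \<Rightarrow> point) \<times> (nat \<Rightarrow> point) \<Rightarrow> real" where
  "action_value \<pi> t p = (\<Sum>i<t. reward M i (fst p i) (snd p i)) + (\<integral>a. Q (H - Suc t) (fst p t, a) \<partial>\<pi> t (fst p t))"

context
  fixes \<pi> x0
  assumes \<pi>: "\<pi> \<in> policies d H M" and x0: "x0 \<in> states d M"
begin

lemma action_law:
  assumes "t < H" "x \<in> states d M"
  shows "prob_space (\<pi> t x)" "sets (\<pi> t x) = sets A" "space (\<pi> t x) = actions d M"
proof -
  have "\<pi> t x \<in> space (prob_algebra A)"
    using \<pi> assms measurable_space[of "\<pi> t" S "prob_algebra A" x] by (auto simp: policies_def)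
  then show "prob_space (\<pi> t x)" "sets (\<pi> t x) = sets A" by (auto simp: space_prob_algebra)
  then show "space (\<pi> t x) = actions d M" using sets_eq_imp_space_eq[of "\<pi> t x" A] by simp
qed

lemma Q_section:
  assumes "t < H" "x \<in> states d M"
  shows "(\<lambda>a. Q (H - Suc t) (x, a)) \<in> borel_measurable (\<pi> t x)"
proof -
  have "(\<lambda>a. (x, a)) \<in> A \<rightarrow>\<^sub>M S \<Otimes>\<^sub>M A" using assms by (intro measurable_Pair1') simp
  from measurable_compose[OF this Q_measurable[of "H - Suc t"]] assms
  have "(\<lambda>a. Q (H - Suc t) (x, a)) \<in> borel_measurable A" by simp
  then show ?thesis using action_law(2)[OF assms] by (simp cong: measurable_cong_sets)
qed

lemma integral_ext_kernel:
  assumes t: "t < H" and p: "p \<in> space (hist t)" and a: "a \<in> actions d M"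
  shows "(\<integral>q. run_value (Suc t) q \<partial>ext_kernel t p a) =
    (\<Sum>i<t. reward M i (fst p i) (snd p i)) + Q (H - Suc t) (fst p t, a)"
proof -
  have x: "fst p t \<in> states d M" using p by (auto simp: space_hist PiE_iff)
  let ?K = "trans_kernel d M (Suc t) (fst p t) a"
  have K: "prob_space ?K" "sets ?K = sets S" "space ?K = states d M" using kernel_prob[OF _ _ x a] t by auto
  have W: "W (H - Suc t) \<in> borel_measurable ?K"
    using value_fun_measurable[of "H - Suc t"] K(2) by (simp cong: measurable_cong_sets)
  have "(\<lambda>y. ((fst p)(Suc t := y), (snd p)(t := a))) \<in> S \<rightarrow>\<^sub>M hist (Suc t)"
    by (rule hist_extend_measurable[where f = "\<lambda>_. p"]) (use p a in auto)
  then have m: "(\<lambda>y. ((fst p)(Suc t := y), (snd p)(t := a))) \<in> ?K \<rightarrow>\<^sub>M hist (Suc t)"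
    using K(2) by (simp cong: measurable_cong_sets)
  have "(\<integral>q. run_value (Suc t) q \<partial>ext_kernel t p a) =
      (\<integral>y. run_value (Suc t) ((fst p)(Suc t := y), (snd p)(t := a)) \<partial>?K)"
    unfolding ext_kernel_def using t by (intro integral_distr m run_value_measurable) simp
  also have "\<dots> = (\<integral>y. ((\<Sum>i<t. reward M i (fst p i) (snd p i)) + reward M t (fst p t) a) + W (H - Suc t) y \<partial>?K)"
    by (intro Bochner_Integration.integral_cong) (auto simp: run_value_def)
  also have "\<dots> = ((\<Sum>i<t. reward M i (fst p i) (snd p i)) + reward M t (fst p t) a) + (\<integral>y. W (H - Suc t) y \<partial>?K)"
    using value_fun_bound[of "H - Suc t"] K(3) by (intro integral_const_plus[OF K(1) W]) auto
  also have "\<dots> = (\<Sum>i<t. reward M i (fst p i) (snd p i)) + Q (H - Suc t) (fst p t, a)"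
    using t by (simp add: q_fun_def Suc_diff_Suc)
  finally show ?thesis .
qed

lemma action_value_eq:
  assumes t: "t < H" and p: "p \<in> space (hist t)"
  shows "(\<integral>q. run_value (Suc t) q \<partial>(\<pi> t (fst p t) \<bind> ext_kernel t p)) = action_value \<pi> t p"
proof -
  have bd: "\<And>q. q \<in> space (hist (Suc t)) \<Longrightarrow> \<bar>run_value (Suc t) q\<bar> \<le> (real H + 1) * G"
    and mr: "run_value (Suc t) \<in> borel_measurable (hist (Suc t))"
    using t by (auto intro!: run_value_bound run_value_measurable)
  have x: "fst p t \<in> states d M" using p by (auto simp: space_hist PiE_iff)
  note al = action_law[OF t x]
  have "\<pi> t (fst p t) \<in> space (prob_algebra A)" using al by (simp add: space_prob_algebra)
  moreover have "ext_kernel t p \<in> A \<rightarrow>\<^sub>M prob_algebra (hist (Suc t))"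
    using measurable_compose[OF measurable_Pair1'[OF p] ext_kernel_measurable[OF t]] by simp
  ultimately have "(\<integral>q. run_value (Suc t) q \<partial>(\<pi> t (fst p t) \<bind> ext_kernel t p)) =
      (\<integral>a. (\<integral>q. run_value (Suc t) q \<partial>ext_kernel t p a) \<partial>\<pi> t (fst p t))"
    by (rule integral_bind_bounded[OF _ _ mr bd])
  also have "\<dots> = (\<integral>a. (\<Sum>i<t. reward M i (fst p i) (snd p i)) + Q (H - Suc t) (fst p t, a) \<partial>\<pi> t (fst p t))"
    using al by (intro Bochner_Integration.integral_cong integral_ext_kernel t p) auto
  also have "\<dots> = action_value \<pi> t p"
    unfolding action_value_def using Q_bound[of "H - Suc t" "fst p t"] al(3) t x
    by (intro integral_const_plus[OF al(1) Q_section[OF t x]]) auto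
  finally show ?thesis .
qed

lemma run_value_step:
  assumes t: "t < H"
  shows "(\<integral>p. run_value (Suc t) p \<partial>policy_law d M \<pi> x0 (Suc t)) = (\<integral>p. action_value \<pi> t p \<partial>policy_law d M \<pi> x0 t)"
proof -
  have L: "policy_law d M \<pi> x0 t \<in> space (prob_algebra (hist t))" using policy_law_prob[OF \<pi> x0] t by simp
  then have spL: "space (policy_law d M \<pi> x0 t) = space (hist t)"
    using sets_eq_imp_space_eq by (auto simp: space_prob_algebra)
  have \<pi>t: "\<pi> t \<in> S \<rightarrow>\<^sub>M prob_algebra A" using \<pi> t by (simp add: policies_def)
  have bd: "\<And>q. q \<in> space (hist (Suc t)) \<Longrightarrow> \<bar>run_value (Suc t) q\<bar> \<le> (real H + 1) * G"
    and mr: "run_value (Suc t) \<in> borel_measurable (hist (Suc t))"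
    using t by (auto intro!: run_value_bound run_value_measurable)
  have "(\<integral>p. (\<integral>q. run_value (Suc t) q \<partial>(\<pi> t (fst p t) \<bind> ext_kernel t p)) \<partial>policy_law d M \<pi> x0 t) =
      (\<integral>p. action_value \<pi> t p \<partial>policy_law d M \<pi> x0 t)"
    by (intro Bochner_Integration.integral_cong refl) (simp add: spL action_value_eq[OF t])
  then show ?thesis
    unfolding policy_law_Suc
    using integral_bind_bounded[OF L policy_step_measurable[of t \<pi>, OF t \<pi>t] mr bd] by simp
qed

text \<open>Transition kernels have densities, so a null set of states has probability zero at every
  time after the start. This is what makes a Borel version of the supremum, correct only almost
  everywhere, good enough.\<close>

lemma policy_law_AE_state:
  assumes "t < H" "AE x in S. P x"
  shows "AE p in policy_law d M \<pi> x0 (Suc t). P (fst p (Suc t))"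
proof -
  obtain N where N: "{x \<in> space S. \<not> P x} \<subseteq> N" "emeasure S N = 0" "N \<in> sets S"
    using assms(2) by (rule AE_E)
  have L: "policy_law d M \<pi> x0 t \<in> space (prob_algebra (hist t))" using policy_law_prob[OF \<pi> x0] assms by simp
  then have sL: "sets (policy_law d M \<pi> x0 t) = sets (hist t)" by (simp add: space_prob_algebra)
  then have spL: "space (policy_law d M \<pi> x0 t) = space (hist t)" by (rule sets_eq_imp_space_eq)
  have \<pi>t: "\<pi> t \<in> S \<rightarrow>\<^sub>M prob_algebra A" using \<pi> assms by (simp add: policies_def)
  note step = policy_step_measurable[of t \<pi>, OF assms(1) \<pi>t]
  have pr: "Measurable.pred (hist (Suc t)) (\<lambda>q. fst q (Suc t) \<notin> N)"
  proof -
    have "(\<lambda>q. fst q (Suc t)) -` (space S - N) \<inter> space (hist (Suc t)) \<in> sets (hist (Suc t))"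
      by (rule measurable_sets[OF hist_state_measurable[OF order.refl] sets.Diff[OF sets.top N(3)]])
    also have "(\<lambda>q. fst q (Suc t)) -` (space S - N) \<inter> space (hist (Suc t)) = {q \<in> space (hist (Suc t)). fst q (Suc t) \<notin> N}"
      by (auto simp: space_hist PiE_iff)
    finally show ?thesis by (simp add: pred_def)
  qed
  have AE_ext: "AE q in ext_kernel t p a. fst q (Suc t) \<notin> N" if p: "p \<in> space (hist t)" and a: "a \<in> actions d M" for p a
  proof -
    have x: "fst p t \<in> states d M" using p by (auto simp: space_hist PiE_iff)
    let ?K = "trans_kernel d M (Suc t) (fst p t) a"
    have K: "prob_space ?K" "sets ?K = sets S" "space ?K = states d M" using kernel_prob[OF _ _ x a] assms(1) by auto
    have "(\<lambda>y. ((fst p)(Suc t := y), (snd p)(t := a))) \<in> S \<rightarrow>\<^sub>M hist (Suc t)"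
      by (rule hist_extend_measurable[where f = "\<lambda>_. p"]) (use p a in auto)
    then have m: "(\<lambda>y. ((fst p)(Suc t := y), (snd p)(t := a))) \<in> ?K \<rightarrow>\<^sub>M hist (Suc t)"
      using K(2) by (simp cong: measurable_cong_sets)
    have "AE y in S. y \<notin> N" using N by (intro AE_not_in) (simp add: null_sets_def)
    moreover have "(\<lambda>y. ennreal (trans_dens M (Suc t) a (fst p t) y)) \<in> borel_measurable S"
      using mdp x a assms(1) by (auto simp: is_mdp_def intro!: measurable_compose[OF _ measurable_ennreal])
    ultimately have "AE y in ?K. y \<notin> N"
      unfolding trans_kernel_def by (subst AE_density) auto
    then show ?thesis
      unfolding ext_kernel_def using pr by (subst AE_distr_iff[OF m]) (auto simp: pred_def)
  qed
  have "AE q in \<pi> t (fst p t) \<bind> ext_kernel t p. fst q (Suc t) \<notin> N" if p: "p \<in> space (hist t)" for p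
  proof -
    have x: "fst p t \<in> states d M" using p by (auto simp: space_hist PiE_iff)
    note al = action_law[OF assms(1) x]
    have "ext_kernel t p \<in> A \<rightarrow>\<^sub>M prob_algebra (hist (Suc t))"
      using measurable_compose[OF measurable_Pair1'[OF p] ext_kernel_measurable[OF assms(1)]] by simp
    then have "ext_kernel t p \<in> \<pi> t (fst p t) \<rightarrow>\<^sub>M subprob_algebra (hist (Suc t))"
      using al(2) measurable_prob_algebraD by (metis measurable_cong_sets)
    note bind = AE_bind[OF this pr]
    have "AE a in \<pi> t (fst p t). AE q in ext_kernel t p a. fst q (Suc t) \<notin> N"
      by (rule AE_I2) (use AE_ext[OF p] al(3) in auto)
    then show ?thesis unfolding bind .
  qed
  then have AE: "AE p in policy_law d M \<pi> x0 t. AE q in \<pi> t (fst p t) \<bind> ext_kernel t p. fst q (Suc t) \<notin> N"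
    by (rule AE_I2) (simp add: spL)
  have "(\<lambda>p. \<pi> t (fst p t) \<bind> ext_kernel t p) \<in> policy_law d M \<pi> x0 t \<rightarrow>\<^sub>M subprob_algebra (hist (Suc t))"
    using measurable_prob_algebraD[OF step] measurable_cong_sets[OF sL refl] by blast
  from AE_bind[OF this pr] AE have "AE q in policy_law d M \<pi> x0 (Suc t). fst q (Suc t) \<notin> N"
    unfolding policy_law_Suc by simp
  moreover have "space (policy_law d M \<pi> x0 (Suc t)) = space (hist (Suc t))"
    using policy_law_prob[OF \<pi> x0, of "Suc t"] assms(1) sets_eq_imp_space_eq by (auto simp: space_prob_algebra)
  ultimately show ?thesis
  proof (elim AE_mp, intro AE_I2 impI)
    fix q assume "q \<in> space (policy_law d M \<pi> x0 (Suc t))" "fst q (Suc t) \<notin> N"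
      "space (policy_law d M \<pi> x0 (Suc t)) = space (hist (Suc t))"
    then have "fst q (Suc t) \<in> states d M" by (auto simp only: space_hist PiE_iff mem_Times_iff)
    then show "P (fst q (Suc t))" using N(1) \<open>fst q (Suc t) \<notin> N\<close> by auto
  qed
qed

lemma
  assumes t: "t < H"
  shows action_value_measurable: "action_value \<pi> t \<in> borel_measurable (hist t)"
    and action_value_bound: "\<And>p. p \<in> space (hist t) \<Longrightarrow> \<bar>action_value \<pi> t p\<bar> \<le> (real H + 1) * G"
proof -
  have \<pi>t: "\<pi> t \<in> S \<rightarrow>\<^sub>M prob_algebra A" using \<pi> t by (simp add: policies_def)
  note step = policy_step_measurable[of t \<pi>, OF t \<pi>t]
  have mr: "run_value (Suc t) \<in> borel_measurable (hist (Suc t))"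
    using t by (auto intro!: run_value_measurable)
  \<comment> \<open>Measurability and the bound are read off the representation of
    \<open>action_value\<close> as an integral against a measurable kernel.\<close>
  have "(\<lambda>p. \<integral>q. run_value (Suc t) q \<partial>(\<pi> t (fst p t) \<bind> ext_kernel t p)) \<in> borel_measurable (hist t)"
    by (rule measurable_compose[OF measurable_prob_algebraD[OF step] integral_measurable_subprob_algebra[OF mr]])
  then show "action_value \<pi> t \<in> borel_measurable (hist t)"
    by (rule measurable_cong[THEN iffD1, rotated]) (rule action_value_eq[OF t])
  fix p assume p: "p \<in> space (hist t)"
  have "\<pi> t (fst p t) \<bind> ext_kernel t p \<in> space (prob_algebra (hist (Suc t)))"
    by (rule measurable_space[OF step p])
  then have P: "prob_space (\<pi> t (fst p t) \<bind> ext_kernel t p)" "sets (\<pi> t (fst p t) \<bind> ext_kernel t p) = sets (hist (Suc t))"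
    by (auto simp: space_prob_algebra)
  then have "run_value (Suc t) \<in> borel_measurable (\<pi> t (fst p t) \<bind> ext_kernel t p)"
    using mr by (simp cong: measurable_cong_sets)
  from nn_integral_shift(2)[OF P(1) this] run_value_bound[of "Suc t"] t sets_eq_imp_space_eq[OF P(2)]
  show "\<bar>action_value \<pi> t p\<bar> \<le> (real H + 1) * G"
    unfolding action_value_eq[OF t p, symmetric] by simp
qed

abbreviation "mean_run t \<equiv> (\<integral>p. run_value t p \<partial>policy_law d M \<pi> x0 t)"

lemma
  assumes t: "t < H"
  shows mean_run_step_le: "(AE p in policy_law d M \<pi> x0 t. action_value \<pi> t p \<le> run_value t p) \<Longrightarrow> mean_run (Suc t) \<le> mean_run t"
    and mean_run_step_ge: "(\<And>p. p \<in> space (hist t) \<Longrightarrow> run_value t p - e \<le> action_value \<pi> t p) \<Longrightarrow> mean_run t - e \<le> mean_run (Suc t)"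
proof -
  let ?L = "policy_law d M \<pi> x0 t"
  have L: "prob_space ?L" "sets ?L = sets (hist t)" using policy_law_prob[OF \<pi> x0, of t] t by (auto simp: space_prob_algebra)
  then interpret prob_space ?L by simp
  have spL: "space ?L = space (hist t)" by (rule sets_eq_imp_space_eq[OF L(2)])
  have a: "action_value \<pi> t \<in> borel_measurable ?L" and r: "run_value t \<in> borel_measurable ?L"
    using action_value_measurable[OF t] run_value_measurable[of t] t L(2) by (simp_all cong: measurable_cong_sets)
  have ia: "integrable ?L (action_value \<pi> t)" and ir: "integrable ?L (run_value t)"
    using nn_integral_shift(3)[OF L(1) a] nn_integral_shift(3)[OF L(1) r] action_value_bound[OF t] run_value_bound[of t] t spL
    by auto
  show "mean_run (Suc t) \<le> mean_run t" if "AE p in ?L. action_value \<pi> t p \<le> run_value t p"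
    unfolding run_value_step[OF t] by (rule integral_mono_AE[OF ia ir that])
  show "mean_run t - e \<le> mean_run (Suc t)" if "\<And>p. p \<in> space (hist t) \<Longrightarrow> run_value t p - e \<le> action_value \<pi> t p"
  proof -
    have "mean_run t - e = (\<integral>p. run_value t p - e \<partial>?L)" using ir by (simp add: prob_space)
    also have "\<dots> \<le> (\<integral>p. action_value \<pi> t p \<partial>?L)"
      using ia ir that spL by (intro integral_mono) auto
    finally show ?thesis unfolding run_value_step[OF t] .
  qed
qed

text \<open>The start is a single point, about which almost-everywhere statements say nothing; the
  first step is therefore evaluated exactly.\<close>

lemma mean_run_1:
  assumes "0 < H"
  shows "mean_run (Suc 0) = (\<integral>a. Q (H - 1) (x0, a) \<partial>\<pi> 0 x0)"
proof -
  have "(\<lambda>i\<in>{..0}. x0, \<lambda>i\<in>{}. undefined) \<in> space (hist 0)"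
    using x0 by (auto simp: space_hist)
  then show ?thesis
    unfolding run_value_step[OF assms] unfolding policy_law.simps
    by (subst integral_return[OF _ action_value_measurable[OF assms]]) (simp_all add: action_value_def)
qed

lemma policy_value_eq: "policy_value d H M \<pi> x0 = mean_run H"
  unfolding policy_value_def by (rule Bochner_Integration.integral_cong) (auto simp: run_value_def)

text \<open>Averages of \<open>Q\<close> over an action law stay below the supremum over actions,
  and almost surely this supremum is the value function at the states visited after time 0. Hence
  the means decrease along the steps, and the induction starts at time 1.\<close>

lemma policy_value_le:
  assumes H: "0 < H"
  shows "policy_value d H M \<pi> x0 \<le> (SUP a\<in>actions d M. Q (H - 1) (x0, a))"
proof -
  have "mean_run (Suc t) \<le> (SUP a\<in>actions d M. Q (H - 1) (x0, a))" if "t < H" for t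
    using that
  proof (induction t)
    case 0
    note al = action_law[OF H x0]
    have "(\<integral>a. Q (H - 1) (x0, a) \<partial>\<pi> 0 x0) \<le> (\<integral>a. (SUP a\<in>actions d M. Q (H - 1) (x0, a)) \<partial>\<pi> 0 x0)"
      using nn_integral_shift(3)[OF al(1) Q_section[OF H x0], of "(real (H - 1) + 2) * G"] Q_bound[of "H - 1" x0] al(3) H x0
      by (intro integral_mono cSUP_upper bdd_above_Q) (auto simp: prob_space.finite_measure[OF al(1)] finite_measure.integrable_const)
    also have "\<dots> = (SUP a\<in>actions d M. Q (H - 1) (x0, a))"
      using prob_space.prob_space[OF al(1)] by simp
    finally show ?case unfolding mean_run_1[OF H] .
  next
    case (Suc t)
    then have t: "t < H" "Suc t < H" by auto
    have "AE x in S. (SUP a\<in>actions d M. Q (H - Suc (Suc t)) (x, a)) = W (Suc (H - Suc (Suc t))) x"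
      using t by (intro value_fun_AE) simp
    from policy_law_AE_state[OF t(1) this]
    have AE: "AE p in policy_law d M \<pi> x0 (Suc t). (SUP a\<in>actions d M. Q (H - Suc (Suc t)) (fst p (Suc t), a)) = W (H - Suc t) (fst p (Suc t))"
      using t by (simp add: Suc_diff_Suc)
    have spL: "space (policy_law d M \<pi> x0 (Suc t)) = space (hist (Suc t))"
      using policy_law_prob[OF \<pi> x0, of "Suc t"] t by (auto simp: space_prob_algebra intro!: sets_eq_imp_space_eq)
    have "AE p in policy_law d M \<pi> x0 (Suc t). action_value \<pi> (Suc t) p \<le> run_value (Suc t) p"
      using AE
    proof (rule AE_mp, intro AE_I2 impI)
      fix p assume "p \<in> space (policy_law d M \<pi> x0 (Suc t))"
        and eq: "(SUP a\<in>actions d M. Q (H - Suc (Suc t)) (fst p (Suc t), a)) = W (H - Suc t) (fst p (Suc t))"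
      then have x: "fst p (Suc t) \<in> states d M" unfolding spL by (auto simp: space_hist PiE_iff)
      note al = action_law[OF t(2) x]
      have "(\<integral>a. Q (H - Suc (Suc t)) (fst p (Suc t), a) \<partial>\<pi> (Suc t) (fst p (Suc t)))
          \<le> (\<integral>a. W (H - Suc t) (fst p (Suc t)) \<partial>\<pi> (Suc t) (fst p (Suc t)))"
        using nn_integral_shift(3)[OF al(1) Q_section[OF t(2) x], of "(real (H - Suc (Suc t)) + 2) * G"]
          Q_bound[of "H - Suc (Suc t)" "fst p (Suc t)"] al(3) t x unfolding eq[symmetric]
        by (intro integral_mono cSUP_upper bdd_above_Q) (auto simp: prob_space.finite_measure[OF al(1)] finite_measure.integrable_const)
      also have "\<dots> = W (H - Suc t) (fst p (Suc t))" using prob_space.prob_space[OF al(1)] by simp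
      finally show "action_value \<pi> (Suc t) p \<le> run_value (Suc t) p"
        by (simp add: action_value_def run_value_def)
    qed
    from mean_run_step_le[OF t(2) this] Suc.IH[OF t(1)] show ?case by simp
  qed
  from this[of "H - 1"] H show ?thesis unfolding policy_value_eq by simp
qed

end

text \<open>\<open>W (Suc k)\<close> is the supremum over the countable family at every state, not
  just almost everywhere, so the least index that comes within \<open>e\<close> of it exists
  everywhere and depends measurably on the state.\<close>

lemma near_optimal_selector:
  assumes k: "k < H" and e: "0 < e"
  shows "\<exists>\<beta>\<in>S \<rightarrow>\<^sub>M A. \<forall>x\<in>states d M. W (Suc k) x - e \<le> Q k (x, \<beta> x)"
proof -
  let ?m = "near_maximizers d M (Q k)"
  have m: "?m n \<in> S \<rightarrow>\<^sub>M A" for n by (rule near_max_measurable[OF k])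
  have Qn[measurable]: "(\<lambda>x. Q k (x, ?m n x)) \<in> borel_measurable S" for n
  proof -
    have "(\<lambda>x. (x, ?m n x)) \<in> S \<rightarrow>\<^sub>M S \<Otimes>\<^sub>M A"
      by (rule measurable_Pair[OF measurable_ident_sets[OF refl] m])
    from measurable_compose[OF this Q_measurable[OF k]] show ?thesis .
  qed
  define w where "w = W (Suc k)"
  have w: "w \<in> borel_measurable S" unfolding w_def by (rule value_fun_measurable) (use k in simp)
  define N where "N x = (LEAST n. w x - e \<le> Q k (x, ?m n x))" for x
  have "N \<in> S \<rightarrow>\<^sub>M count_space UNIV"
    unfolding N_def
  proof (rule measurable_Least)
    show "Measurable.pred S (\<lambda>x. w x - e \<le> Q k (x, ?m n x))" for n
      unfolding pred_def by (rule borel_measurable_le[OF borel_measurable_diff[OF w borel_measurable_const] Qn])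
  qed
  then have "(\<lambda>x. ?m (N x) x) \<in> S \<rightarrow>\<^sub>M A"
    by (rule measurable_compose_countable[OF m])
  moreover have "w x - e \<le> Q k (x, ?m (N x) x)" if x: "x \<in> states d M" for x
  proof -
    have "?m n x \<in> actions d M" for n using measurable_space[OF m, of x n] x by simp
    then have bdd: "bdd_above (range (\<lambda>n. Q k (x, ?m n x)))"
      using Q_bound[OF k x] by (intro bdd_aboveI2[of _ _ "(real k + 2) * G"]) (auto simp: abs_le_iff)
    have "w x - e < (SUP n. Q k (x, ?m n x))" using e by (simp add: w_def)
    from less_cSUP_iff[THEN iffD1, OF UNIV_not_empty bdd this]
    obtain n where "w x - e < Q k (x, ?m n x)" by blast
    then show ?thesis
      unfolding N_def by (intro LeastI[of "\<lambda>n. w x - e \<le> Q k (x, ?m n x)" n] less_imp_le)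
  qed
  ultimately show ?thesis unfolding w_def by (intro bexI[of _ "\<lambda>x. ?m (N x) x"] ballI)
qed

text \<open>A deterministic policy: a constant action that is nearly optimal at \<open>x0\<close>,
  followed by the selectors. Each of the \<open>H\<close> decisions loses at most
  \<open>e\<close>.\<close>

lemma near_optimal_policy:
  assumes H: "0 < H" and x0: "x0 \<in> states d M" and e: "0 < e"
  shows "\<exists>\<pi>\<in>policies d H M. (SUP a\<in>actions d M. Q (H - 1) (x0, a)) - real H * e \<le> policy_value d H M \<pi> x0"
proof -
  let ?v = "SUP a\<in>actions d M. Q (H - 1) (x0, a)"
  have "?v - e < ?v" using e by simp
  from less_cSUP_iff[THEN iffD1, OF actions_nonempty bdd_above_Q[of "H - 1" x0] this]
  obtain a0 where a0: "a0 \<in> actions d M" "?v - e < Q (H - 1) (x0, a0)"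
    using H x0 by auto
  have "\<exists>\<beta>. \<beta> \<in> S \<rightarrow>\<^sub>M A \<and> (\<forall>x\<in>states d M. W (Suc k) x - e \<le> Q k (x, \<beta> x))" if "k < H" for k
    using near_optimal_selector[OF that e] by blast
  then obtain \<gamma> where \<gamma>: "\<And>k. k < H \<Longrightarrow> \<gamma> k \<in> S \<rightarrow>\<^sub>M A"
    "\<And>k x. k < H \<Longrightarrow> x \<in> states d M \<Longrightarrow> W (Suc k) x - e \<le> Q k (x, \<gamma> k x)" by metis
  define \<beta> where "\<beta> t = (if t = 0 then (\<lambda>_. a0) else \<gamma> (H - Suc t))" for t
  define \<pi> where "\<pi> t x = return A (\<beta> t x)" for t x
  have \<beta>: "\<beta> t \<in> S \<rightarrow>\<^sub>M A" if "t < H" for t using \<gamma>(1)[of "H - Suc t"] a0 that by (auto simp: \<beta>_def)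
  have \<pi>: "\<pi> \<in> policies d H M"
    unfolding policies_def \<pi>_def by (auto intro: measurable_compose[OF \<beta> measurable_return_prob_space])
  have Q\<pi>: "(\<integral>a. Q k (x, a) \<partial>\<pi> t x) = Q k (x, \<beta> t x)" if "t < H" "k < H" "x \<in> states d M" for t k x
  proof -
    have "(\<lambda>a. Q k (x, a)) \<in> borel_measurable A"
      using measurable_compose[OF measurable_Pair1'[of x S A] Q_measurable[OF that(2)]] that by simp
    moreover have "\<beta> t x \<in> space A" by (rule measurable_space[OF \<beta>]) (use that in auto)
    ultimately show ?thesis unfolding \<pi>_def by (intro integral_return)
  qed
  have "?v - real (Suc t) * e \<le> (\<integral>p. run_value (Suc t) p \<partial>policy_law d M \<pi> x0 (Suc t))" if "t < H" for t
    using that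
  proof (induction t)
    case 0
    show ?case unfolding mean_run_1[OF \<pi> x0 H] using Q\<pi>[of 0 "H - 1" x0] H x0 a0 by (simp add: \<beta>_def)
  next
    case (Suc t)
    have "(\<integral>p. run_value (Suc t) p \<partial>policy_law d M \<pi> x0 (Suc t)) - e
        \<le> (\<integral>p. run_value (Suc (Suc t)) p \<partial>policy_law d M \<pi> x0 (Suc (Suc t)))"
    proof (rule mean_run_step_ge[OF \<pi> x0 Suc.prems])
      fix p assume "p \<in> space (hist (Suc t))"
      then have x: "fst p (Suc t) \<in> states d M" by (auto simp: space_hist PiE_iff)
      have "W (H - Suc t) (fst p (Suc t)) - e \<le> Q (H - Suc (Suc t)) (fst p (Suc t), \<beta> (Suc t) (fst p (Suc t)))"
        using \<gamma>(2)[of "H - Suc (Suc t)", OF _ x] Suc.prems by (simp add: \<beta>_def Suc_diff_Suc del: value_fun.simps)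
      then show "run_value (Suc t) p - e \<le> action_value \<pi> (Suc t) p"
        unfolding run_value_def action_value_def using Q\<pi>[OF Suc.prems _ x, of "H - Suc (Suc t)"] Suc.prems by simp
    qed
    with Suc show ?case by (simp add: algebra_simps)
  qed
  from this[of "H - 1"] H have "?v - real H * e \<le> policy_value d H M \<pi> x0"
    unfolding policy_value_eq[OF \<pi> x0] by simp
  then show ?thesis using \<pi> by blast
qed

text \<open>The full supremum at \<open>x0\<close> appears instead of \<open>W H x0\<close>, because
  the two are known to agree only almost everywhere. The last step of the algorithm takes the same
  full supremum.\<close>

theorem optimal_value_eq:
  assumes H: "0 < H" and x0: "x0 \<in> states d M"
  shows "optimal_value d H M x0 = (SUP a\<in>actions d M. Q (H - 1) (x0, a))"
proof (rule antisym)
  let ?v = "SUP a\<in>actions d M. Q (H - 1) (x0, a)"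
  have "policies d H M \<noteq> {}" using near_optimal_policy[OF H x0, of 1] by auto
  then show "optimal_value d H M x0 \<le> ?v"
    unfolding optimal_value_def by (rule cSUP_least) (rule policy_value_le[OF _ x0 H])
  have bdd: "bdd_above ((\<lambda>\<pi>. policy_value d H M \<pi> x0) ` policies d H M)"
    using policy_value_le[OF _ x0 H] by (intro bdd_aboveI2)
  show "?v \<le> optimal_value d H M x0"
  proof (rule field_le_epsilon)
    fix e :: real assume "0 < e"
    then obtain \<pi> where "\<pi> \<in> policies d H M" "?v - real H * (e / real H) \<le> policy_value d H M \<pi> x0"
      using near_optimal_policy[OF H x0, of "e / real H"] H by auto
    moreover from this have "policy_value d H M \<pi> x0 \<le> optimal_value d H M x0"
      unfolding optimal_value_def by (intro cSUP_upper bdd)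
    ultimately show "?v \<le> optimal_value d H M x0 + e" using H by simp
  qed
qed

end

section \<open>The law of the simulated chains\<close>

locale mesh_setting = bounded_mdp +
  fixes \<delta> \<Lambda> L :: real and x0 :: point and b :: "nat \<Rightarrow> point"
  assumes regular: "regular_densities d H M \<delta> \<Lambda> L" and x0: "x0 \<in> states d M"
    and controls: "\<And>h. h < H \<Longrightarrow> b h \<in> actions d M" and d: "1 \<le> d"
begin

lemma constants_pos: "0 < \<delta>" "0 < \<Lambda>" "0 < L"
  using regular by (auto simp: regular_densities_def)

lemma
  assumes "1 \<le> h" "h \<le> H" "a \<in> actions d M" "x \<in> states d M"
  shows dens_measurable: "trans_dens M h a x \<in> borel_measurable S"
    and dens_bounds: "\<And>y. y \<in> states d M \<Longrightarrow> \<delta> \<le> trans_dens M h a x y"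
      "\<And>y. y \<in> states d M \<Longrightarrow> trans_dens M h a x y \<le> \<Lambda>"
      "\<And>y. y \<in> states d M \<Longrightarrow> 0 < trans_dens M h a x y"
  using regular mdp assms by (auto simp: regular_densities_def is_mdp_def intro: less_le_trans)

lemma lipschitz_densities:
  obtains lip where "\<forall>y\<in>states d M. 0 \<le> lip y" "AE y in S. lip y \<le> L"
    "\<forall>h\<in>{1..H}. \<forall>a1\<in>actions d M. \<forall>a2\<in>actions d M. \<forall>x1\<in>states d M. \<forall>x2\<in>states d M. \<forall>y\<in>states d M.
      \<bar>trans_dens M h a1 x1 y - trans_dens M h a2 x2 y\<bar> \<le> lip y * (edist d x1 x2 + edist d a1 a2)"
  using regular unfolding regular_densities_def by (elim conjE exE)

lemma edist_measurable: "(\<lambda>x. edist d x c) \<in> borel_measurable S"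
proof -
  have "(\<lambda>x. x i) \<in> borel_measurable S" for i
    using measurable_product_then_coordinatewise[OF lebesgue_ball_to_borel] by (simp add: state_space_def)
  then show ?thesis unfolding edist_def L2_set_def by measurable
qed

text \<open>The densities are continuous in the first and measurable in the second argument.\<close>

lemma dens_joint_measurable:
  assumes h: "1 \<le> h" "h \<le> H" and a: "a \<in> actions d M"
  shows "(\<lambda>(x, y). trans_dens M h a x y) \<in> borel_measurable (S \<Otimes>\<^sub>M S)"
proof -
  obtain lip where lip': "\<forall>y\<in>states d M. 0 \<le> lip y"
    "\<forall>h\<in>{1..H}. \<forall>a1\<in>actions d M. \<forall>a2\<in>actions d M. \<forall>x1\<in>states d M. \<forall>x2\<in>states d M. \<forall>y\<in>states d M.
      \<bar>trans_dens M h a1 x1 y - trans_dens M h a2 x2 y\<bar> \<le> lip y * (edist d x1 x2 + edist d a1 a2)"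
    by (rule lipschitz_densities)
  then have lip: "0 \<le> lip y"
    "\<bar>trans_dens M h a x1 y - trans_dens M h a x2 y\<bar> \<le> lip y * (edist d x1 x2 + edist d a a)"
    if "x1 \<in> states d M" "x2 \<in> states d M" "y \<in> states d M" for x1 x2 y
    using that h a by simp_all
  have aa: "edist d a a = 0" by (simp add: edist_def L2_set_def)
  have "\<exists>xs. set xs \<subseteq> states d M \<and> (\<forall>x\<in>states d M. \<exists>j<length xs. edist d x (xs ! j) \<le> 1 / Suc m)" for m
  proof -
    have s: "0 < 1 / (Suc m * sqrt d)" using d by simp
    obtain T where T: "finite T" "T \<subseteq> states d M"
      "\<forall>x\<in>states d M. \<exists>t\<in>T. edist d x t \<le> 1 / (Suc m * sqrt d) * sqrt d"
      using eball_net[OF s less_imp_le[OF radii(1)], of d] unfolding states_def by auto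
    moreover obtain xs where "set xs = T" using finite_list[OF T(1)] by blast
    moreover have "1 / (Suc m * sqrt d) * sqrt d = 1 / Suc m" using d by simp
    ultimately show ?thesis by (intro exI[of _ xs]) (metis in_set_conv_nth)
  qed
  then obtain xs where xs: "\<And>m. set (xs m) \<subseteq> states d M"
    "\<And>m x. x \<in> states d M \<Longrightarrow> \<exists>j<length (xs m). edist d x (xs m ! j) \<le> 1 / Suc m" by metis
  \<comment> \<open>Index of a net point within \<open>1 / Suc m\<close> of \<open>x\<close>; taking
    the least one makes it measurable in \<open>x\<close>. Freezing the first argument of the
    density at this net point gives measurable functions, which converge to the density by the
    Lipschitz bound.\<close>
  define J where "J m x = (LEAST j. j < length (xs m) \<and> edist d x (xs m ! j) \<le> 1 / Suc m)" for m x
  have J: "J m x < length (xs m)" "edist d x (xs m ! J m x) \<le> 1 / Suc m" if "x \<in> states d M" for m x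
    using LeastI_ex[OF xs(2)[OF that, of m, folded J_def]] unfolding J_def by auto
  have J_meas: "J m \<in> S \<rightarrow>\<^sub>M count_space UNIV" for m
    unfolding J_def
  proof (rule measurable_Least)
    fix j
    have "{x \<in> space S. edist d x (xs m ! j) \<le> 1 / Suc m} \<in> sets S"
      by (rule borel_measurable_le[OF edist_measurable borel_measurable_const])
    then show "Measurable.pred S (\<lambda>x. j < length (xs m) \<and> edist d x (xs m ! j) \<le> 1 / Suc m)"
      unfolding pred_def by (cases "j < length (xs m)") auto
  qed
  define g where "g m j p = (if j < length (xs m) then trans_dens M h a (xs m ! j) (snd p) else 0)"
    for m j and p :: "point \<times> point"
  have "g m j \<in> borel_measurable (S \<Otimes>\<^sub>M S)" for m j
  proof (cases "j < length (xs m)")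
    case True
    then have "xs m ! j \<in> states d M" using xs(1) nth_mem by blast
    then have "(\<lambda>p. trans_dens M h a (xs m ! j) (snd p)) \<in> borel_measurable (S \<Otimes>\<^sub>M S)"
      by (rule measurable_compose[OF measurable_snd dens_measurable[OF h a]])
    then show ?thesis using True by (simp add: g_def[abs_def])
  qed (simp add: g_def[abs_def])
  from measurable_compose_countable[OF this measurable_compose[OF measurable_fst J_meas]]
  have gm: "(\<lambda>p. g m (J m (fst p)) p) \<in> borel_measurable (S \<Otimes>\<^sub>M S)" for m .
  show ?thesis
    unfolding split_def
  proof (rule borel_measurable_LIMSEQ_real[OF _ gm])
    fix p assume "p \<in> space (S \<Otimes>\<^sub>M S)"
    then have p: "fst p \<in> states d M" "snd p \<in> states d M" by (auto simp: space_pair_measure)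
    have "\<bar>g m (J m (fst p)) p - trans_dens M h a (fst p) (snd p)\<bar> \<le> lip (snd p) * (1 / Suc m)" for m
    proof -
      have "xs m ! J m (fst p) \<in> states d M" using J(1)[OF p(1)] xs(1) nth_mem by blast
      from lip(2)[OF p(1) this p(2)] aa
      have "\<bar>trans_dens M h a (fst p) (snd p) - trans_dens M h a (xs m ! J m (fst p)) (snd p)\<bar>
          \<le> lip (snd p) * edist d (fst p) (xs m ! J m (fst p))" by simp
      also have "\<dots> \<le> lip (snd p) * (1 / Suc m)" by (rule mult_left_mono[OF J(2)[OF p(1)] lip(1)[OF p(1,1,2)]])
      finally show ?thesis using J(1)[OF p(1), of m] by (simp add: g_def abs_minus_commute)
    qed
    then have le: "\<forall>\<^sub>F m in sequentially. norm (g m (J m (fst p)) p - trans_dens M h a (fst p) (snd p)) \<le> lip (snd p) * (1 / Suc m)"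
      by (intro always_eventually) simp
    have "(\<lambda>m. lip (snd p) * (1 / Suc m)) \<longlonglongrightarrow> lip (snd p) * 0"
      using LIMSEQ_inverse_real_of_nat by (intro tendsto_mult tendsto_const) (simp add: inverse_eq_divide)
    then have "(\<lambda>m. lip (snd p) * (1 / Suc m)) \<longlonglongrightarrow> 0" by simp
    from Lim_null_comparison[OF le this]
    show "(\<lambda>m. g m (J m (fst p)) p) \<longlonglongrightarrow> trans_dens M h a (fst p) (snd p)"
      by (rule LIM_zero_cancel)
  qed
qed

section \<open>The law of one chain and its marginal densities\<close>

abbreviation "CS t \<equiv> PiM {..t} (\<lambda>_. S)"
abbreviation "chain t \<equiv> chain_law d M b x0 t"

definition chain_kernel :: "nat \<Rightarrow> (nat \<Rightarrow> point) \<Rightarrow> (nat \<Rightarrow> point) measure" where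
  "chain_kernel t s = distr (trans_kernel d M (Suc t) (s t) (b t)) (CS (Suc t)) (\<lambda>y. s(Suc t := y))"

lemma chain_component: "i \<le> t \<Longrightarrow> (\<lambda>s. s i) \<in> CS t \<rightarrow>\<^sub>M S"
  by (rule measurable_component_singleton) simp

lemma space_CS: "space (CS t) = {..t} \<rightarrow>\<^sub>E states d M" by (simp add: space_PiM)

lemma chain_extend: "(\<lambda>(s, y). s(Suc t := y)) \<in> CS t \<Otimes>\<^sub>M S \<rightarrow>\<^sub>M CS (Suc t)"
  unfolding split_def by (rule measurable_fun_upd[of _ "{..t}"]) auto

lemma chain_kernel_measurable:
  assumes "t < H"
  shows "chain_kernel t \<in> CS t \<rightarrow>\<^sub>M prob_algebra (CS (Suc t))"
proof -
  have 1: "(\<lambda>s. (s t, b t)) \<in> CS t \<rightarrow>\<^sub>M S \<Otimes>\<^sub>M A"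
    using controls[OF assms] by (intro measurable_Pair chain_component) auto
  have "(\<lambda>s. trans_kernel d M (Suc t) (s t) (b t)) \<in> CS t \<rightarrow>\<^sub>M prob_algebra S"
    using measurable_compose[OF 1 kernel[of "Suc t"]] assms by simp
  from measurable_distr_prob_space2[OF this chain_extend]
  show ?thesis unfolding chain_kernel_def[abs_def] .
qed

lemma chain_Suc: "chain (Suc t) = chain t \<bind> chain_kernel t"
  by (simp add: chain_kernel_def[abs_def])

declare chain_law.simps(2)[simp del]

lemma chain_prob_algebra: "t \<le> H \<Longrightarrow> chain t \<in> space (prob_algebra (CS t))"
proof (induction t)
  case 0
  have "(\<lambda>i\<in>{..0}. x0) \<in> space (CS 0)" using x0 by (auto simp: space_CS)
  from prob_space_return[OF this] show ?case by (simp add: space_prob_algebra del: atMost_0)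
next
  case (Suc t)
  then have "chain t \<in> space (prob_algebra (CS t))" by simp
  moreover have "chain_kernel t \<in> CS t \<rightarrow>\<^sub>M prob_algebra (CS (Suc t))"
    using Suc.prems by (intro chain_kernel_measurable) simp
  ultimately show ?case
    unfolding chain_Suc space_prob_algebra[of "CS (Suc t)"] using prob_space_bind' sets_bind' by blast
qed

lemma
  assumes "t \<le> H"
  shows chain_prob: "prob_space (chain t)" and chain_sets: "sets (chain t) = sets (CS t)"
    and chain_space: "space (chain t) = space (CS t)"
  using chain_prob_algebra[OF assms] sets_eq_imp_space_eq by (auto simp: space_prob_algebra)

lemma nn_integral_trans_kernel:
  assumes "1 \<le> h" "h \<le> H" "x \<in> states d M" "a \<in> actions d M" "f \<in> borel_measurable S"
  shows "(\<integral>\<^sup>+y. f y \<partial>trans_kernel d M h x a) = (\<integral>\<^sup>+y. f y * ennreal (trans_dens M h a x y) \<partial>S)"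
  unfolding trans_kernel_def using assms dens_measurable[OF assms(1,2,4,3)]
  by (subst nn_integral_density) (auto simp: mult.commute)

lemma nn_integral_chain_Suc:
  assumes t: "t < H" and f: "f \<in> borel_measurable (CS (Suc t))"
  shows "(\<integral>\<^sup>+s. f s \<partial>chain (Suc t)) =
    (\<integral>\<^sup>+s. (\<integral>\<^sup>+y. f (s(Suc t := y)) * ennreal (trans_dens M (Suc t) (b t) (s t) y) \<partial>S) \<partial>chain t)"
proof -
  have "chain_kernel t \<in> chain t \<rightarrow>\<^sub>M subprob_algebra (CS (Suc t))"
    using measurable_prob_algebraD[OF chain_kernel_measurable[OF t]] chain_sets[of t] t
      measurable_cong_sets[of "chain t" "CS t"] by simp
  then have "(\<integral>\<^sup>+s. f s \<partial>chain (Suc t)) = (\<integral>\<^sup>+s. (\<integral>\<^sup>+s'. f s' \<partial>chain_kernel t s) \<partial>chain t)"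
    unfolding chain_Suc by (rule nn_integral_bind[OF f])
  also have "\<dots> = (\<integral>\<^sup>+s. (\<integral>\<^sup>+y. f (s(Suc t := y)) * ennreal (trans_dens M (Suc t) (b t) (s t) y) \<partial>S) \<partial>chain t)"
  proof (rule nn_integral_cong)
    fix s assume "s \<in> space (chain t)"
    then have s: "s \<in> space (CS t)" using chain_space[of t] t by simp
    then have st: "s t \<in> states d M" by (auto simp: space_CS)
    have m: "(\<lambda>y. s(Suc t := y)) \<in> S \<rightarrow>\<^sub>M CS (Suc t)"
      using measurable_compose[OF measurable_Pair1'[OF s] chain_extend] by simp
    have "(\<integral>\<^sup>+s'. f s' \<partial>chain_kernel t s) = (\<integral>\<^sup>+y. f (s(Suc t := y)) \<partial>trans_kernel d M (Suc t) (s t) (b t))"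
      unfolding chain_kernel_def using m f by (intro nn_integral_distr) (simp_all add: trans_kernel_def)
    also have "\<dots> = (\<integral>\<^sup>+y. f (s(Suc t := y)) * ennreal (trans_dens M (Suc t) (b t) (s t) y) \<partial>S)"
      using t st controls measurable_compose[OF m f] by (intro nn_integral_trans_kernel) auto
    finally show "(\<integral>\<^sup>+s'. f s' \<partial>chain_kernel t s) = \<dots>" .
  qed
  finally show ?thesis .
qed

text \<open>Later transition kernels have total mass 1, so they integrate out. The hypothesis
  \<open>past\<close> expresses that \<open>f\<close> ignores the coordinates after time
  \<open>t\<close>.\<close>

lemma chain_forget:
  assumes t: "t \<le> t'" "t' \<le> H" and f: "\<And>u. t \<le> u \<Longrightarrow> f \<in> borel_measurable (CS u)"
    and past: "\<And>u s y. t \<le> u \<Longrightarrow> f (s(Suc u := y)) = f s"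
  shows "(\<integral>\<^sup>+s. f s \<partial>chain t') = (\<integral>\<^sup>+s. f s \<partial>chain t)"
  using t
proof (induction t' rule: dec_induct)
  case (step u)
  then have u: "u < H" by simp
  have "(\<integral>\<^sup>+s. f s \<partial>chain (Suc u)) =
      (\<integral>\<^sup>+s. (\<integral>\<^sup>+y. f (s(Suc u := y)) * ennreal (trans_dens M (Suc u) (b u) (s u) y) \<partial>S) \<partial>chain u)"
    using step by (intro nn_integral_chain_Suc f) auto
  also have "\<dots> = (\<integral>\<^sup>+s. f s \<partial>chain u)"
  proof (rule nn_integral_cong)
    fix s assume "s \<in> space (chain u)"
    then have s: "s u \<in> states d M" using chain_space[of u] u by (auto simp: space_CS)
    note K = kernel_prob[of "Suc u", OF _ _ s controls[OF u]]
    have "(\<integral>\<^sup>+y. f (s(Suc u := y)) * ennreal (trans_dens M (Suc u) (b u) (s u) y) \<partial>S) =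
        (\<integral>\<^sup>+y. f s * ennreal (trans_dens M (Suc u) (b u) (s u) y) \<partial>S)"
      using step by (simp add: past)
    also have "\<dots> = (\<integral>\<^sup>+y. f s \<partial>trans_kernel d M (Suc u) (s u) (b u))"
      using u s controls by (intro nn_integral_trans_kernel[symmetric]) auto
    also have "\<dots> = f s" using prob_space.emeasure_space_1[OF K(1)] u by simp
    finally show "(\<integral>\<^sup>+y. f (s(Suc u := y)) * ennreal (trans_dens M (Suc u) (b u) (s u) y) \<partial>S) = f s" .
  qed
  finally show ?case using step by simp
qed simp

text \<open>The marginal density of a mesh state at time \<open>Suc h\<close>, and the expectation
  of one summand of a leave-one-out denominator. The average runs over the law of the full chain,
  the law from which the whole sample is drawn.\<close>

definition qbar :: "nat \<Rightarrow> point \<Rightarrow> real" where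
  "qbar h y = (\<integral>s. trans_dens M (Suc h) (b h) (s h) y \<partial>chain H)"

context
  fixes h assumes h: "h < H"
begin

lemma chain_dens_measurable:
  "(\<lambda>(s, y). trans_dens M (Suc h) (b h) (s h) y) \<in> borel_measurable (CS H \<Otimes>\<^sub>M S)"
proof -
  have "(\<lambda>p. (fst p h, snd p)) \<in> CS H \<Otimes>\<^sub>M S \<rightarrow>\<^sub>M S \<Otimes>\<^sub>M S"
    using h by (intro measurable_Pair measurable_snd measurable_compose[OF measurable_fst chain_component]) simp
  from measurable_compose[OF this dens_joint_measurable[of "Suc h" "b h"]] show ?thesis
    using h controls by (simp add: split_def)
qed

lemma chain_dens_section:
  assumes "y \<in> states d M"
  shows "(\<lambda>s. trans_dens M (Suc h) (b h) (s h) y) \<in> borel_measurable (chain H)"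
proof -
  have "y \<in> space S" using assms by simp
  from measurable_compose[OF measurable_Pair2'[OF this, of "CS H"] chain_dens_measurable]
  show ?thesis using chain_sets[of H] by (simp cong: measurable_cong_sets)
qed

lemma chain_dens_bounds:
  assumes "s \<in> space (chain H)" "y \<in> states d M"
  shows "\<delta> \<le> trans_dens M (Suc h) (b h) (s h) y" "trans_dens M (Suc h) (b h) (s h) y \<le> \<Lambda>"
proof -
  have "s h \<in> states d M" using assms(1) chain_space[of H] h by (auto simp: space_CS)
  then show "\<delta> \<le> trans_dens M (Suc h) (b h) (s h) y" "trans_dens M (Suc h) (b h) (s h) y \<le> \<Lambda>"
    using dens_bounds[of "Suc h" "b h" "s h" y] h controls assms(2) by auto
qed

lemma
  assumes y: "y \<in> states d M"
  shows chain_dens_integrable: "integrable (chain H) (\<lambda>s. trans_dens M (Suc h) (b h) (s h) y)"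
    and qbar_bounds: "\<delta> \<le> qbar h y" "qbar h y \<le> \<Lambda>" "0 < qbar h y"
    and nn_integral_qbar: "(\<integral>\<^sup>+s. ennreal (trans_dens M (Suc h) (b h) (s h) y) \<partial>chain H) = ennreal (qbar h y)"
proof -
  interpret prob_space "chain H" by (rule chain_prob) simp
  show int: "integrable (chain H) (\<lambda>s. trans_dens M (Suc h) (b h) (s h) y)"
  proof (rule integrable_const_bound[of _ \<Lambda>, OF AE_I2 chain_dens_section[OF y]])
    fix s assume "s \<in> space (chain H)"
    from chain_dens_bounds[OF this y] constants_pos show "norm (trans_dens M (Suc h) (b h) (s h) y) \<le> \<Lambda>" by simp
  qed
  have "(\<integral>s. \<delta> \<partial>chain H) \<le> qbar h y" "qbar h y \<le> (\<integral>s. \<Lambda> \<partial>chain H)"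
    unfolding qbar_def using chain_dens_bounds[OF _ y] int by (intro integral_mono; simp)+
  then show "\<delta> \<le> qbar h y" "qbar h y \<le> \<Lambda>" "0 < qbar h y" using constants_pos by (simp_all add: prob_space)
  show "(\<integral>\<^sup>+s. ennreal (trans_dens M (Suc h) (b h) (s h) y) \<partial>chain H) = ennreal (qbar h y)"
    unfolding qbar_def using chain_dens_bounds(1)[OF _ y] constants_pos
    by (intro nn_integral_eq_integral[OF int] AE_I2) (auto intro: order_trans less_imp_le)
qed

lemma qbar_measurable: "qbar h \<in> borel_measurable S"
proof -
  interpret prob_space "chain H" by (rule chain_prob) simp
  have "(\<lambda>p. (snd p, fst p)) \<in> S \<Otimes>\<^sub>M chain H \<rightarrow>\<^sub>M CS H \<Otimes>\<^sub>M S"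
    using measurable_Pair[OF measurable_snd measurable_fst, of S "chain H"] chain_sets[of H]
    by (simp cong: measurable_cong_sets sets_pair_measure_cong)
  from measurable_compose[OF this chain_dens_measurable]
  have "(\<lambda>(y, s). trans_dens M (Suc h) (b h) (s h) y) \<in> borel_measurable (S \<Otimes>\<^sub>M chain H)"
    by (simp add: split_def)
  then show ?thesis unfolding qbar_def[abs_def] by (rule borel_measurable_lebesgue_integral)
qed

text \<open>Forgetting the states after time \<open>Suc h\<close>, writing out the transition into
  that time and exchanging integrals exhibits the mixture of the transition densities as the density
  of the next state.\<close>

lemma chain_next_distr: "distr (chain H) S (\<lambda>s. s (Suc h)) = density S (\<lambda>y. ennreal (qbar h y))"
proof (rule measure_eqI)
  interpret C: prob_space "chain H" by (rule chain_prob) simp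
  interpret S: finite_measure S unfolding state_space_def by (rule finite_lebesgue_ball)
  interpret CS: pair_sigma_finite "chain H" S by unfold_locales
  have m: "(\<lambda>s. s (Suc h)) \<in> chain H \<rightarrow>\<^sub>M S"
    using chain_component[of "Suc h" H] h chain_sets[of H] by (simp cong: measurable_cong_sets)
  fix E assume "E \<in> sets (distr (chain H) S (\<lambda>s. s (Suc h)))"
  then have E: "E \<in> sets S" by simp
  have I: "indicator E \<in> borel_measurable S" using E by simp
  \<comment> \<open>Required for every \<open>u\<close>, since \<open>chain_forget\<close> passes
    through all times from \<open>h\<close> to \<open>H\<close>.\<close>
  have F_meas: "(\<lambda>s. \<integral>\<^sup>+y. indicator E y * ennreal (trans_dens M (Suc h) (b h) (s h) y) \<partial>S) \<in> borel_measurable (CS u)"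
    if "h \<le> u" for u
  proof (rule S.borel_measurable_nn_integral)
    have "(\<lambda>p. (fst p h, snd p)) \<in> CS u \<Otimes>\<^sub>M S \<rightarrow>\<^sub>M S \<Otimes>\<^sub>M S"
      using that by (intro measurable_Pair measurable_snd measurable_compose[OF measurable_fst chain_component]) simp
    from measurable_compose[OF this dens_joint_measurable[of "Suc h" "b h"]]
    have "(\<lambda>p. trans_dens M (Suc h) (b h) (fst p h) (snd p)) \<in> borel_measurable (CS u \<Otimes>\<^sub>M S)"
      using h controls by (simp add: split_def)
    then show "(\<lambda>(s, y). indicator E y * ennreal (trans_dens M (Suc h) (b h) (s h) y)) \<in> borel_measurable (CS u \<Otimes>\<^sub>M S)"
      unfolding split_def
      by (intro borel_measurable_times_ennreal measurable_compose[OF measurable_snd I] measurable_compose[OF _ measurable_ennreal])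
  qed
  have "emeasure (distr (chain H) S (\<lambda>s. s (Suc h))) E = (\<integral>\<^sup>+s. indicator E (s (Suc h)) \<partial>chain H)"
    using nn_integral_distr[OF m, of "indicator E"] I E by simp
  also have "\<dots> = (\<integral>\<^sup>+s. indicator E (s (Suc h)) \<partial>chain (Suc h))"
    using h measurable_compose[OF chain_component I] by (intro chain_forget) auto
  also have "\<dots> = (\<integral>\<^sup>+s. (\<integral>\<^sup>+y. indicator E y * ennreal (trans_dens M (Suc h) (b h) (s h) y) \<partial>S) \<partial>chain h)"
    using nn_integral_chain_Suc[OF h measurable_compose[OF chain_component I]] by simp
  also have "\<dots> = (\<integral>\<^sup>+s. (\<integral>\<^sup>+y. indicator E y * ennreal (trans_dens M (Suc h) (b h) (s h) y) \<partial>S) \<partial>chain H)"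
    using h F_meas by (intro chain_forget[symmetric]) auto
  also have "\<dots> = (\<integral>\<^sup>+y. (\<integral>\<^sup>+s. indicator E y * ennreal (trans_dens M (Suc h) (b h) (s h) y) \<partial>chain H) \<partial>S)"
  proof (rule CS.Fubini'[symmetric])
    have "(\<lambda>p. trans_dens M (Suc h) (b h) (fst p h) (snd p)) \<in> borel_measurable (chain H \<Otimes>\<^sub>M S)"
      using chain_dens_measurable chain_sets[of H] by (simp add: split_def cong: measurable_cong_sets sets_pair_measure_cong)
    then show "(\<lambda>(s, y). indicator E y * ennreal (trans_dens M (Suc h) (b h) (s h) y)) \<in> borel_measurable (chain H \<Otimes>\<^sub>M S)"
      unfolding split_def
      by (intro borel_measurable_times_ennreal measurable_compose[OF measurable_snd I] measurable_compose[OF _ measurable_ennreal])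
  qed
  also have "\<dots> = (\<integral>\<^sup>+y. ennreal (qbar h y) * indicator E y \<partial>S)"
  proof (rule nn_integral_cong)
    fix y assume "y \<in> space S"
    then have y: "y \<in> states d M" by simp
    show "(\<integral>\<^sup>+s. indicator E y * ennreal (trans_dens M (Suc h) (b h) (s h) y) \<partial>chain H) = ennreal (qbar h y) * indicator E y"
      using chain_dens_section[OF y] nn_integral_qbar[OF y] by (subst nn_integral_cmult) (auto simp: mult.commute)
  qed
  also have "\<dots> = emeasure (density S (\<lambda>y. ennreal (qbar h y))) E"
    using qbar_measurable E by (subst emeasure_density) auto
  finally show "emeasure (distr (chain H) S (\<lambda>s. s (Suc h))) E = emeasure (density S (\<lambda>y. ennreal (qbar h y))) E" .
qed simp

lemma chain_next_measurable: "(\<lambda>s. s (Suc h)) \<in> chain H \<rightarrow>\<^sub>M S"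
  using chain_component[of "Suc h" H] h chain_sets[of H] by (simp cong: measurable_cong_sets)

text \<open>Carries the almost-everywhere facts about the Lipschitz factor and about the value
  function over to the mesh states.\<close>

lemma chain_next_AE:
  assumes "AE y in S. P y"
  shows "AE s in chain H. P (s (Suc h))"
proof (rule AE_distrD[OF chain_next_measurable])
  show "AE y in distr (chain H) S (\<lambda>s. s (Suc h)). P y"
    unfolding chain_next_distr using assms qbar_measurable
    by (subst AE_density) (auto elim: eventually_mono)
qed

end

end

section \<open>Error of the mesh estimate\<close>

lemma nn_integral_affine_le:
  fixes f g :: "'a \<Rightarrow> real"
  assumes "prob_space M" and [measurable]: "f \<in> borel_measurable M" "g \<in> borel_measurable M"
    and fg: "\<And>x. 0 \<le> f x" "\<And>x. 0 \<le> g x" "(\<integral>\<^sup>+x. ennreal (f x) \<partial>M) \<le> ennreal u" "(\<integral>\<^sup>+x. ennreal (g x) \<partial>M) \<le> ennreal v"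
    and c: "0 \<le> c" "0 \<le> c'" "0 \<le> c''" "0 \<le> u" "0 \<le> v"
  shows "(\<integral>\<^sup>+x. ennreal (c * f x + c' * g x + c'') \<partial>M) \<le> ennreal (c * u + c' * v + c'')"
proof -
  interpret prob_space M by fact
  have "(\<integral>\<^sup>+x. ennreal (c * f x + c' * g x + c'') \<partial>M) =
      (\<integral>\<^sup>+x. ennreal c * ennreal (f x) + ennreal c' * ennreal (g x) + ennreal c'' \<partial>M)"
    using c fg by (intro nn_integral_cong) (simp add: ennreal_plus ennreal_mult)
  also have "\<dots> = ennreal c * (\<integral>\<^sup>+x. ennreal (f x) \<partial>M) + ennreal c' * (\<integral>\<^sup>+x. ennreal (g x) \<partial>M) + ennreal c''"
    by (simp add: nn_integral_add nn_integral_cmult emeasure_space_1)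
  also have "\<dots> \<le> ennreal c * ennreal u + ennreal c' * ennreal v + ennreal c''"
    using fg by (intro add_mono mult_left_mono) auto
  also have "\<dots> = ennreal (c * u + c' * v + c'')"
    using c by (simp add: ennreal_plus ennreal_mult)
  finally show ?thesis .
qed

context mesh_setting
begin

text \<open>The bound of \<open>product_nets\<close> for the logarithm of the net of state-action
  pairs at scale 1; it serves as the intercept in the chaining bound.\<close>

definition metric_entropy :: real where
  "metric_entropy = d * (ln (4 * state_radius M * sqrt d + 2) + ln (4 * action_radius M * sqrt d + 2))"

text \<open>The first term pays for the denominators: \<open>3 / 2\<close> for their fluctuation and
  1 for \<open>N\<close> against \<open>N - 1\<close>, rounded up to 3. The bracket is the chaining
  constant for uniform bound \<open>\<Lambda> / \<delta>\<close>, Lipschitz constant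
  \<open>L / \<delta>\<close> and entropy slope \<open>2 * d\<close>; the bound on the averaged
  function is factored out.\<close>

definition noise_const :: real where
  "noise_const = 3 * \<Lambda>\<^sup>2 / \<delta>\<^sup>2 + (2 * (\<Lambda> / \<delta>) * (metric_entropy + 2) +
     4 * (L / \<delta>) * (4 + 4 * metric_entropy + 12 * d) + 2 * (L / \<delta>))"

lemma metric_entropy_nonneg: "0 \<le> metric_entropy"
  unfolding metric_entropy_def using radii by (intro mult_nonneg_nonneg add_nonneg_nonneg ln_ge_zero) auto

lemma noise_const_nonneg: "0 \<le> noise_const"
  unfolding noise_const_def using constants_pos metric_entropy_nonneg by (intro add_nonneg_nonneg mult_nonneg_nonneg divide_nonneg_nonneg) auto

text \<open>Importance sampling: dividing by the sampling density turns the mean over mesh states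
  into the mean under the target kernel.\<close>

lemma chain_next_expectation:
  assumes h: "h < H" and V: "V \<in> borel_measurable S" and x: "x \<in> states d M" and a: "a \<in> actions d M"
  shows "(\<integral>s. V (s (Suc h)) * trans_dens M (Suc h) a x (s (Suc h)) / qbar h (s (Suc h)) \<partial>chain H) =
    (\<integral>y. V y \<partial>trans_kernel d M (Suc h) x a)"
proof -
  note [measurable] = V qbar_measurable[OF h]
  have [measurable]: "trans_dens M (Suc h) a x \<in> borel_measurable S" using h x a by (intro dens_measurable) auto
  have "(\<integral>s. V (s (Suc h)) * trans_dens M (Suc h) a x (s (Suc h)) / qbar h (s (Suc h)) \<partial>chain H) =
      (\<integral>y. V y * trans_dens M (Suc h) a x y / qbar h y \<partial>distr (chain H) S (\<lambda>s. s (Suc h)))"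
    by (rule integral_distr[OF chain_next_measurable[OF h], symmetric]) measurable
  also have "\<dots> = (\<integral>y. qbar h y *\<^sub>R (V y * trans_dens M (Suc h) a x y / qbar h y) \<partial>S)"
    unfolding chain_next_distr[OF h]
    by (rule integral_density) (use qbar_bounds(3)[OF h] in \<open>auto intro!: AE_I2 less_imp_le\<close>)
  also have "\<dots> = (\<integral>y. trans_dens M (Suc h) a x y *\<^sub>R V y \<partial>S)"
    using qbar_bounds(3)[OF h] by (intro Bochner_Integration.integral_cong) (auto simp: less_imp_neq[symmetric])
  also have "\<dots> = (\<integral>y. V y \<partial>trans_kernel d M (Suc h) x a)"
    unfolding trans_kernel_def
    by (rule integral_density[symmetric]) (use dens_bounds(3)[of "Suc h" a x] h x a in \<open>auto intro!: AE_I2 less_imp_le\<close>)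
  finally show ?thesis .
qed

section \<open>Uniform noise bounds for a single backward step\<close>

context
  fixes N :: nat assumes N: "2 \<le> N"
begin

abbreviation "P \<equiv> sample_law d H M b x0 N"

lemma prob_P: "prob_space P"
  unfolding sample_law_def by (intro prob_space_PiM chain_prob) simp

lemma sample_component:
  assumes "n < N" "t \<le> H"
  shows "(\<lambda>\<omega>. \<omega> n t) \<in> P \<rightarrow>\<^sub>M S"
proof -
  have "(\<lambda>s. s t) \<in> chain H \<rightarrow>\<^sub>M S"
    using chain_component[OF assms(2)] chain_sets[of H] by (simp cong: measurable_cong_sets)
  then show ?thesis unfolding sample_law_def
    using assms by (intro measurable_compose[OF measurable_component_singleton]) auto
qed

lemma sample_states: "\<omega> \<in> space P \<Longrightarrow> n < N \<Longrightarrow> t \<le> H \<Longrightarrow> \<omega> n t \<in> states d M"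
  using measurable_space[OF sample_component] by auto

lemma sample_AE:
  assumes "AE s in chain H. R s"
  shows "AE \<omega> in P. \<forall>n<N. R (\<omega> n)"
proof -
  have "AE \<omega> in P. \<forall>n\<in>{..<N}. R (\<omega> n)"
    unfolding sample_law_def
    by (intro AE_finite_allI AE_PiM_component chain_prob assms) auto
  then show ?thesis by (auto elim: eventually_mono)
qed

text \<open>With chain \<open>n\<close> frozen, the other chains are still independent and the
  summands are centred with bound \<Lambda>, so the finite-class bound applies to a class with one
  function. The factor \<open>3 / 2\<close> is \<open>ln 2 + 1 / 2\<close> rounded up.\<close>

lemma leave_one_out_majorant:
  assumes h: "h < H"
  defines "\<Psi> \<equiv> \<lambda>\<omega>. \<Sum>n<N. \<bar>\<Sum>k\<in>{..<N} - {n}. trans_dens M (Suc h) (b h) (\<omega> k h) (\<omega> n (Suc h)) - qbar h (\<omega> n (Suc h))\<bar>"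
  shows "\<Psi> \<in> borel_measurable P" "(\<integral>\<^sup>+\<omega>. ennreal (\<Psi> \<omega>) \<partial>P) \<le> ennreal (N * (\<Lambda> * sqrt (real N - 1) * (3 / 2)))"
proof -
  interpret C: prob_space "chain H" by (rule chain_prob) simp
  interpret PS: product_sigma_finite "\<lambda>_. chain H" by unfold_locales
  define f where "f n \<omega> = \<bar>\<Sum>k\<in>{..<N} - {n}. trans_dens M (Suc h) (b h) (\<omega> k h) (\<omega> n (Suc h)) - qbar h (\<omega> n (Suc h))\<bar>"
    for n and \<omega> :: "nat \<Rightarrow> nat \<Rightarrow> point"
  have f: "f n \<in> borel_measurable P" if "n < N" for n
    unfolding f_def[abs_def]
  proof (intro borel_measurable_abs borel_measurable_sum borel_measurable_diff)
    fix k assume k: "k \<in> {..<N} - {n}"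
    have "(\<lambda>\<omega>. (\<omega> k h, \<omega> n (Suc h))) \<in> P \<rightarrow>\<^sub>M S \<Otimes>\<^sub>M S"
      using k that h by (intro measurable_Pair sample_component) auto
    from measurable_compose[OF this dens_joint_measurable[of "Suc h" "b h"]]
    show "(\<lambda>\<omega>. trans_dens M (Suc h) (b h) (\<omega> k h) (\<omega> n (Suc h))) \<in> borel_measurable P"
      using h controls by simp
    show "(\<lambda>\<omega>. qbar h (\<omega> n (Suc h))) \<in> borel_measurable P"
      using that h by (intro measurable_compose[OF sample_component qbar_measurable]) auto
  qed
  have \<Psi>: "\<Psi> = (\<lambda>\<omega>. \<Sum>n<N. f n \<omega>)" unfolding assms(2) f_def ..
  show "\<Psi> \<in> borel_measurable P" unfolding \<Psi> by (rule borel_measurable_sum) (simp add: f)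
  have bound: "(\<integral>\<^sup>+\<omega>. ennreal (f n \<omega>) \<partial>P) \<le> ennreal (\<Lambda> * sqrt (real N - 1) * (3 / 2))" if n: "n < N" for n
  proof -
    let ?J = "{..<N} - {n}"
    have ins: "{..<N} = insert n ?J" using n by auto
    have fm: "(\<lambda>\<omega>. ennreal (f n \<omega>)) \<in> borel_measurable (PiM (insert n ?J) (\<lambda>_. chain H))"
      using f[OF n] unfolding sample_law_def ins[symmetric] by (intro measurable_compose[OF _ measurable_ennreal])
    have "(\<integral>\<^sup>+\<omega>. ennreal (f n \<omega>) \<partial>P) = (\<integral>\<^sup>+\<omega>. ennreal (f n \<omega>) \<partial>PiM (insert n ?J) (\<lambda>_. chain H))"
      unfolding sample_law_def ins[symmetric] ..
    also have "\<dots> = (\<integral>\<^sup>+s. (\<integral>\<^sup>+\<omega>. ennreal (f n (fun_upd \<omega> n s)) \<partial>PiM ?J (\<lambda>_. chain H)) \<partial>chain H)"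
      by (rule PS.product_nn_integral_insert_rev[OF _ _ fm]) auto
    also have "\<dots> \<le> (\<integral>\<^sup>+s. ennreal (\<Lambda> * sqrt (real N - 1) * (3 / 2)) \<partial>chain H)"
    proof (rule nn_integral_mono)
      fix s assume "s \<in> space (chain H)"
      then have y: "s (Suc h) \<in> states d M" using chain_space[of H] h by (auto simp: space_CS)
      define g where "g s' = trans_dens M (Suc h) (b h) (s' h) (s (Suc h)) - qbar h (s (Suc h))" for s' :: "nat \<Rightarrow> point"
      have gm: "g \<in> borel_measurable (chain H)"
        unfolding g_def[abs_def] by (intro borel_measurable_diff chain_dens_section[OF h y] borel_measurable_const)
      have gb: "AE s' in chain H. \<bar>g s'\<bar> \<le> \<Lambda>"
      proof (rule AE_I2)
        fix s' assume "s' \<in> space (chain H)"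
        from chain_dens_bounds[OF h this y] qbar_bounds[OF h y] constants_pos
        show "\<bar>g s'\<bar> \<le> \<Lambda>" unfolding g_def abs_le_iff by linarith
      qed
      have g0: "(\<integral>s'. g s' \<partial>chain H) = 0"
        unfolding g_def using chain_dens_integrable[OF h y] by (simp add: C.prob_space qbar_def)
      have "\<exists>\<Psi>\<in>borel_measurable (PiM ?J (\<lambda>_. chain H)). (\<forall>\<omega>. 0 \<le> \<Psi> \<omega>) \<and>
        (\<forall>\<omega>. \<forall>t\<in>{()}. \<bar>\<Sum>k\<in>?J. (\<lambda>_. g) t (\<omega> k)\<bar> \<le> \<Psi> \<omega>) \<and>
        (\<integral>\<^sup>+\<omega>. ennreal (\<Psi> \<omega>) \<partial>PiM ?J (\<lambda>_. chain H)) \<le> ennreal (\<Lambda> * sqrt (card ?J) * (ln (2 * card {()}) + 1 / 2))"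
        by (rule iid_finite_class_majorant) (use gm gb g0 constants_pos C.prob_space_axioms in auto)
      then obtain \<Psi>' where \<Psi>': "\<And>\<omega>. \<bar>\<Sum>k\<in>?J. g (\<omega> k)\<bar> \<le> \<Psi>' \<omega>"
        "(\<integral>\<^sup>+\<omega>. ennreal (\<Psi>' \<omega>) \<partial>PiM ?J (\<lambda>_. chain H)) \<le> ennreal (\<Lambda> * sqrt (card ?J) * (ln 2 + 1 / 2))" by auto
      have "f n (fun_upd \<omega> n s) = \<bar>\<Sum>k\<in>?J. g (\<omega> k)\<bar>" for \<omega>
        unfolding f_def g_def by (auto intro!: arg_cong[where f = abs] sum.cong)
      then have "(\<integral>\<^sup>+\<omega>. ennreal (f n (fun_upd \<omega> n s)) \<partial>PiM ?J (\<lambda>_. chain H)) \<le> (\<integral>\<^sup>+\<omega>. ennreal (\<Psi>' \<omega>) \<partial>PiM ?J (\<lambda>_. chain H))"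
        using \<Psi>'(1) by (intro nn_integral_mono ennreal_leI) simp
      also have "\<dots> \<le> ennreal (\<Lambda> * sqrt (card ?J) * (ln 2 + 1 / 2))" by (rule \<Psi>'(2))
      also have "card ?J = N - 1" using n by simp
      also have "real (N - 1) = real N - 1" using N by (simp add: of_nat_diff)
      also have "ennreal (\<Lambda> * sqrt (real N - 1) * (ln 2 + 1 / 2)) \<le> ennreal (\<Lambda> * sqrt (real N - 1) * (3 / 2))"
        using constants_pos N ln_2_less_1 by (intro ennreal_leI mult_left_mono) auto
      finally show "(\<integral>\<^sup>+\<omega>. ennreal (f n (fun_upd \<omega> n s)) \<partial>PiM ?J (\<lambda>_. chain H)) \<le> ennreal (\<Lambda> * sqrt (real N - 1) * (3 / 2))" .
    qed
    finally show ?thesis by (simp add: C.emeasure_space_1)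
  qed
  have "(\<integral>\<^sup>+\<omega>. ennreal (\<Psi> \<omega>) \<partial>P) = (\<integral>\<^sup>+\<omega>. (\<Sum>n<N. ennreal (f n \<omega>)) \<partial>P)"
    unfolding \<Psi> by (intro nn_integral_cong sum_ennreal[symmetric]) (simp add: f_def)
  also have "\<dots> = (\<Sum>n<N. \<integral>\<^sup>+\<omega>. ennreal (f n \<omega>) \<partial>P)"
    using f by (intro nn_integral_sum) (auto intro: measurable_compose[OF _ measurable_ennreal])
  also have "\<dots> \<le> (\<Sum>n<N. ennreal (\<Lambda> * sqrt (real N - 1) * (3 / 2)))"
    using bound by (intro sum_mono) auto
  also have "\<dots> = ennreal (N * (\<Lambda> * sqrt (real N - 1) * (3 / 2)))"
    using constants_pos N by (simp add: ennreal_of_nat_eq_real_of_nat ennreal_mult'[symmetric] mult.assoc)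
  finally show "(\<integral>\<^sup>+\<omega>. ennreal (\<Psi> \<omega>) \<partial>P) \<le> ennreal (N * (\<Lambda> * sqrt (real N - 1) * (3 / 2)))" .
qed

text \<open>With the deterministic \<open>qbar\<close> as denominator the summands are independent,
  and chaining over state-action pairs applies with bounds \<open>B * \<Lambda> / \<delta>\<close>
  and \<open>B * L / \<delta>\<close>. The Lipschitz factor is at most \<open>L\<close> only almost
  everywhere, hence almost surely at the mesh states.\<close>

lemma empirical_majorant:
  assumes h: "h < H" and V: "V \<in> borel_measurable S" and B: "0 < B" "\<And>y. y \<in> states d M \<Longrightarrow> \<bar>V y\<bar> \<le> B"
  defines "\<xi> \<equiv> \<lambda>\<theta> s. V (s (Suc h)) * trans_dens M (Suc h) (snd \<theta>) (fst \<theta>) (s (Suc h)) / qbar h (s (Suc h))"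
  shows "\<exists>\<Psi>\<in>borel_measurable P. (\<forall>\<omega>. 0 \<le> \<Psi> \<omega>) \<and>
    (AE \<omega> in P. \<forall>\<theta>\<in>states d M \<times> actions d M.
       \<bar>\<Sum>n<N. (\<xi> \<theta> (\<omega> n) - (\<integral>y. V y \<partial>trans_kernel d M (Suc h) (fst \<theta>) (snd \<theta>)))\<bar> \<le> \<Psi> \<omega>) \<and>
    (\<integral>\<^sup>+\<omega>. ennreal (\<Psi> \<omega>) \<partial>P) \<le>
      ennreal (sqrt N * (2 * (B * \<Lambda> / \<delta>) * (metric_entropy + 2) + 4 * (B * L / \<delta>) * (4 + 4 * metric_entropy + 6 * (2 * d)) + 2 * (B * L / \<delta>)))"
proof -
  let ?\<Theta> = "states d M \<times> actions d M"
  define \<rho> where "\<rho> \<theta> \<theta>' = edist d (fst \<theta>) (fst \<theta>') + edist d (snd \<theta>) (snd \<theta>')" for \<theta> \<theta>' :: "point \<times> point"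
  obtain lip where lip: "AE y in S. lip y \<le> L"
    "\<forall>h\<in>{1..H}. \<forall>a1\<in>actions d M. \<forall>a2\<in>actions d M. \<forall>x1\<in>states d M. \<forall>x2\<in>states d M. \<forall>y\<in>states d M.
      \<bar>trans_dens M h a1 x1 y - trans_dens M h a2 x2 y\<bar> \<le> lip y * (edist d x1 x2 + edist d a1 a2)"
    by (rule lipschitz_densities)
  have "\<forall>j. \<exists>T. finite T \<and> T \<noteq> {} \<and> T \<subseteq> ?\<Theta> \<and> (\<forall>\<theta>\<in>?\<Theta>. \<exists>t\<in>T. \<rho> \<theta> t \<le> (1/2) ^ j) \<and>
      ln (card T) \<le> metric_entropy + (2 * real d) * real j"
    using product_nets[of "state_radius M" "action_radius M" d] radii d
    unfolding states_def actions_def metric_entropy_def \<rho>_def by (simp add: less_imp_le)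
  then obtain T where T: "\<And>j. finite (T j)" "\<And>j. T j \<noteq> {}" "\<And>j. T j \<subseteq> ?\<Theta>"
    "\<And>j \<theta>. \<theta> \<in> ?\<Theta> \<Longrightarrow> \<exists>t\<in>T j. \<rho> \<theta> t \<le> (1/2) ^ j"
    "\<And>j. ln (card (T j)) \<le> metric_entropy + (2 * real d) * real j" by metis
  have p_meas: "trans_dens M (Suc h) (snd \<theta>) (fst \<theta>) \<in> borel_measurable S" if "\<theta> \<in> ?\<Theta>" for \<theta>
    using that h by (intro dens_measurable) auto
  have \<xi>_meas: "\<xi> \<theta> \<in> borel_measurable (chain H)" if "\<theta> \<in> ?\<Theta>" for \<theta>
  proof -
    have "(\<lambda>y. V y * trans_dens M (Suc h) (snd \<theta>) (fst \<theta>) y / qbar h y) \<in> borel_measurable S"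
      by (intro borel_measurable_divide borel_measurable_times V p_meas that qbar_measurable h)
    from measurable_compose[OF chain_next_measurable[OF h] this] show ?thesis unfolding \<xi>_def .
  qed
  have next_states: "s (Suc h) \<in> states d M" if "s \<in> space (chain H)" for s
    using that chain_space[of H] h by (auto simp: space_CS)
  have \<xi>_bound: "AE s in chain H. \<forall>\<theta>\<in>?\<Theta>. \<bar>\<xi> \<theta> s\<bar> \<le> B * \<Lambda> / \<delta>"
  proof (intro AE_I2 ballI)
    fix s \<theta> assume "s \<in> space (chain H)" and \<theta>: "\<theta> \<in> ?\<Theta>"
    note y = next_states[OF this(1)]
    have p: "0 < trans_dens M (Suc h) (snd \<theta>) (fst \<theta>) (s (Suc h))" "trans_dens M (Suc h) (snd \<theta>) (fst \<theta>) (s (Suc h)) \<le> \<Lambda>"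
      using dens_bounds[of "Suc h" "snd \<theta>" "fst \<theta>"] h \<theta> y by auto
    have "\<bar>\<xi> \<theta> s\<bar> = \<bar>V (s (Suc h))\<bar> * trans_dens M (Suc h) (snd \<theta>) (fst \<theta>) (s (Suc h)) / qbar h (s (Suc h))"
      unfolding \<xi>_def using p qbar_bounds[OF h y] by (simp add: abs_mult)
    also have "\<dots> \<le> B * \<Lambda> / \<delta>"
      using B(1) B(2)[OF y] p constants_pos qbar_bounds[OF h y] by (intro frac_le mult_mono mult_nonneg_nonneg) auto
    finally show "\<bar>\<xi> \<theta> s\<bar> \<le> B * \<Lambda> / \<delta>" .
  qed
  have \<xi>_lip: "AE s in chain H. \<forall>\<theta>\<in>?\<Theta>. \<forall>\<theta>'\<in>?\<Theta>. \<bar>\<xi> \<theta> s - \<xi> \<theta>' s\<bar> \<le> B * L / \<delta> * \<rho> \<theta> \<theta>'"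
    using chain_next_AE[OF h lip(1)]
  proof (rule AE_mp, intro AE_I2 impI ballI)
    fix s \<theta> \<theta>' assume s: "s \<in> space (chain H)" and lipL: "lip (s (Suc h)) \<le> L" and \<theta>: "\<theta> \<in> ?\<Theta>" "\<theta>' \<in> ?\<Theta>"
    note y = next_states[OF s]
    have \<rho>0: "0 \<le> \<rho> \<theta> \<theta>'" unfolding \<rho>_def by (intro add_nonneg_nonneg edist_nonneg)
    let ?p = "\<lambda>\<theta>. trans_dens M (Suc h) (snd \<theta>) (fst \<theta>) (s (Suc h))"
    have "\<bar>?p \<theta> - ?p \<theta>'\<bar> \<le> lip (s (Suc h)) * \<rho> \<theta> \<theta>'"
      unfolding \<rho>_def using h \<theta> y lip(2) by auto
    also have "\<dots> \<le> L * \<rho> \<theta> \<theta>'" by (rule mult_right_mono[OF lipL \<rho>0])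
    finally have pp: "\<bar>?p \<theta> - ?p \<theta>'\<bar> \<le> L * \<rho> \<theta> \<theta>'" .
    have "\<xi> \<theta> s - \<xi> \<theta>' s = V (s (Suc h)) * (?p \<theta> - ?p \<theta>') / qbar h (s (Suc h))"
      unfolding \<xi>_def by (simp add: right_diff_distrib diff_divide_distrib)
    then have "\<bar>\<xi> \<theta> s - \<xi> \<theta>' s\<bar> = \<bar>V (s (Suc h))\<bar> * \<bar>?p \<theta> - ?p \<theta>'\<bar> / qbar h (s (Suc h))"
      using qbar_bounds(3)[OF h y] by (simp add: abs_mult)
    also have "\<dots> \<le> B * (L * \<rho> \<theta> \<theta>') / \<delta>"
      using B(1) B(2)[OF y] pp constants_pos qbar_bounds[OF h y] \<rho>0 by (intro frac_le mult_mono mult_nonneg_nonneg) auto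
    finally show "\<bar>\<xi> \<theta> s - \<xi> \<theta>' s\<bar> \<le> B * L / \<delta> * \<rho> \<theta> \<theta>'" by simp
  qed
  have \<rho>_sym: "\<rho> s t = \<rho> t s" for s t unfolding \<rho>_def by (simp add: edist_commute)
  have \<rho>_tri: "\<rho> s u \<le> \<rho> s t + \<rho> t u" for s t u
    unfolding \<rho>_def using edist_triangle[of d "fst s" "fst u" "fst t"] edist_triangle[of d "snd s" "snd u" "snd t"] by linarith
  have "\<exists>\<Psi>\<in>borel_measurable (PiM {..<N} (\<lambda>_. chain H)). (\<forall>\<omega>. 0 \<le> \<Psi> \<omega>) \<and>
    (AE \<omega> in PiM {..<N} (\<lambda>_. chain H). \<forall>\<theta>\<in>?\<Theta>. \<bar>\<Sum>k<N. (\<xi> \<theta> (\<omega> k) - (\<integral>x. \<xi> \<theta> x \<partial>chain H))\<bar> \<le> \<Psi> \<omega>) \<and>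
    (\<integral>\<^sup>+\<omega>. ennreal (\<Psi> \<omega>) \<partial>PiM {..<N} (\<lambda>_. chain H)) \<le>
      ennreal (sqrt (card {..<N}) * (2 * (B * \<Lambda> / \<delta>) * (metric_entropy + 2) + 4 * (B * L / \<delta>) * (4 + 4 * metric_entropy + 6 * (2 * real d)) + 2 * (B * L / \<delta>)))"
  proof (rule chaining_majorant[OF chain_prob _ _ T(1) T(2) T(3) T(5) _ T(4) \<rho>_sym \<rho>_tri \<xi>_meas _ \<xi>_bound _ \<xi>_lip])
    show "{..<N} \<noteq> {}" using N by (simp add: lessThan_empty_iff)
  qed (use B constants_pos in auto)
  moreover have "(\<integral>x. \<xi> \<theta> x \<partial>chain H) = (\<integral>y. V y \<partial>trans_kernel d M (Suc h) (fst \<theta>) (snd \<theta>))" if "\<theta> \<in> ?\<Theta>" for \<theta>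
    unfolding \<xi>_def using that by (intro chain_next_expectation[OF h V]) auto
  ultimately show ?thesis unfolding sample_law_def by simp
qed

text \<open>The comparison is with \<open>N * q\<close> so that a plain empirical mean results,
  although \<open>D\<close> has only \<open>N - 1\<close> summands. The discrepancy is a single
  \<open>q\<close>, which accounts for the added \<Lambda>.\<close>

lemma inverse_denominator_diff:
  fixes q D :: real
  assumes q: "\<delta> \<le> q" "q \<le> \<Lambda>" and D: "(real N - 1) * \<delta> \<le> D"
  shows "\<bar>1 / D - 1 / (N * q)\<bar> \<le> (\<bar>D - (real N - 1) * q\<bar> + \<Lambda>) / ((real N - 1) * N * \<delta>\<^sup>2)"
proof -
  have N1: "0 < real N - 1" "0 < real N" using N by auto
  have \<delta>: "0 < \<delta>" by (rule constants_pos)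
  have "0 < (real N - 1) * \<delta>" using N1 \<delta> by simp
  then have D0: "0 < D" and q0: "0 < q" using D q \<delta> by linarith+
  have "1 / D - 1 / (N * q) = (N * q - D) / (D * (N * q))" using D0 q0 N1 by (simp add: field_simps)
  then have "\<bar>1 / D - 1 / (N * q)\<bar> = \<bar>N * q - D\<bar> / (D * (N * q))" using D0 q0 N1 by (simp add: abs_divide)
  also have "\<dots> \<le> (\<bar>D - (real N - 1) * q\<bar> + \<Lambda>) / (((real N - 1) * \<delta>) * (N * \<delta>))"
  proof (rule frac_le)
    have "N * q - D = q - (D - (real N - 1) * q)" by (simp add: algebra_simps)
    then show "\<bar>N * q - D\<bar> \<le> \<bar>D - (real N - 1) * q\<bar> + \<Lambda>" using q q0 by linarith
    show "(real N - 1) * \<delta> * (N * \<delta>) \<le> D * (N * q)"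
      using D q N1 \<delta> D0 by (intro mult_mono mult_left_mono mult_nonneg_nonneg) auto
  qed (use N1 \<delta> constants_pos(2) in auto)
  also have "((real N - 1) * \<delta>) * (N * \<delta>) = (real N - 1) * N * \<delta>\<^sup>2" by (simp add: power2_eq_square)
  finally show ?thesis .
qed

text \<open>The error splits in two: replacing each leave-one-out sum by \<open>N * qbar\<close>,
  where state and action enter only through bounded factors, and the empirical process with
  denominators \<open>qbar\<close>, divided by \<open>N\<close>.\<close>

lemma mesh_sum_majorant:
  assumes h: "h < H" and V: "V \<in> borel_measurable S" and B: "0 < B" "\<And>y. y \<in> states d M \<Longrightarrow> \<bar>V y\<bar> \<le> B"
  shows "\<exists>\<Psi>\<in>borel_measurable P. (\<forall>\<omega>. 0 \<le> \<Psi> \<omega>) \<and>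
    (AE \<omega> in P. \<forall>x\<in>states d M. \<forall>a\<in>actions d M.
       \<bar>(\<Sum>n<N. V (\<omega> n (Suc h)) * mesh_ratio M b N \<omega> h n x a) - (\<integral>y. V y \<partial>trans_kernel d M (Suc h) x a)\<bar> \<le> \<Psi> \<omega>) \<and>
    (\<integral>\<^sup>+\<omega>. ennreal (\<Psi> \<omega>) \<partial>P) \<le> ennreal (B * noise_const / sqrt (real N - 1))"
proof -
  define \<Psi>1 where "\<Psi>1 \<omega> = (\<Sum>n<N. \<bar>\<Sum>k\<in>{..<N} - {n}. trans_dens M (Suc h) (b h) (\<omega> k h) (\<omega> n (Suc h)) - qbar h (\<omega> n (Suc h))\<bar>)"
    for \<omega> :: "nat \<Rightarrow> nat \<Rightarrow> point"
  have \<Psi>1: "\<Psi>1 \<in> borel_measurable P" "(\<integral>\<^sup>+\<omega>. ennreal (\<Psi>1 \<omega>) \<partial>P) \<le> ennreal (N * (\<Lambda> * sqrt (real N - 1) * (3 / 2)))"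
    using leave_one_out_majorant[OF h] unfolding \<Psi>1_def[abs_def] by auto
  define E where "E = 2 * (B * \<Lambda> / \<delta>) * (metric_entropy + 2) + 4 * (B * L / \<delta>) * (4 + 4 * metric_entropy + 6 * (2 * d)) + 2 * (B * L / \<delta>)"
  have E0: "0 \<le> E"
    unfolding E_def using B constants_pos metric_entropy_nonneg
    by (intro add_nonneg_nonneg mult_nonneg_nonneg divide_nonneg_nonneg) auto
  obtain \<Psi>2 where \<Psi>2: "\<Psi>2 \<in> borel_measurable P" "\<And>\<omega>. 0 \<le> \<Psi>2 \<omega>"
    "AE \<omega> in P. \<forall>\<theta>\<in>states d M \<times> actions d M.
       \<bar>\<Sum>n<N. (V (\<omega> n (Suc h)) * trans_dens M (Suc h) (snd \<theta>) (fst \<theta>) (\<omega> n (Suc h)) / qbar h (\<omega> n (Suc h))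
          - (\<integral>y. V y \<partial>trans_kernel d M (Suc h) (fst \<theta>) (snd \<theta>)))\<bar> \<le> \<Psi>2 \<omega>"
    "(\<integral>\<^sup>+\<omega>. ennreal (\<Psi>2 \<omega>) \<partial>P) \<le> ennreal (sqrt N * E)"
    using empirical_majorant[OF h V B] unfolding E_def by blast
  define r where "r = real N - 1"
  have r: "0 < r" "1 \<le> r" "r \<le> N" and N0: "0 < real N" using N by (auto simp: r_def)
  \<comment> \<open>\<open>c\<close> collects \<open>B * \<Lambda>\<close> and the denominator of
    \<open>inverse_denominator_diff\<close>. The added \<Lambda> of that bound, summed over the
    \<open>N\<close> chains and multiplied by \<open>c\<close>, is \<open>c''\<close>.\<close>
  define c where "c = B * \<Lambda> / (r * N * \<delta>\<^sup>2)"
  define c'' where "c'' = B * \<Lambda>\<^sup>2 / (r * \<delta>\<^sup>2)"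
  define \<Psi> where "\<Psi> \<omega> = c * \<Psi>1 \<omega> + (1 / N) * \<Psi>2 \<omega> + c''" for \<omega>
  have c: "0 \<le> c" "0 \<le> c''" unfolding c_def c''_def using B constants_pos r N0 by auto
  have \<Psi>1_nonneg: "0 \<le> \<Psi>1 \<omega>" for \<omega> unfolding \<Psi>1_def by (intro sum_nonneg) auto
  have "\<Psi> \<in> borel_measurable P"
    unfolding \<Psi>_def[abs_def] by (intro borel_measurable_add borel_measurable_times borel_measurable_const \<Psi>1 \<Psi>2)
  moreover have "0 \<le> \<Psi> \<omega>" for \<omega>
    unfolding \<Psi>_def using c \<Psi>1_nonneg \<Psi>2(2) by (intro add_nonneg_nonneg mult_nonneg_nonneg) auto
  moreover have "AE \<omega> in P. \<forall>x\<in>states d M. \<forall>a\<in>actions d M.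
       \<bar>(\<Sum>n<N. V (\<omega> n (Suc h)) * mesh_ratio M b N \<omega> h n x a) - (\<integral>y. V y \<partial>trans_kernel d M (Suc h) x a)\<bar> \<le> \<Psi> \<omega>"
    using \<Psi>2(3)
  proof (rule AE_mp, intro AE_I2 impI ballI)
    fix \<omega> x a assume \<omega>: "\<omega> \<in> space P" and x: "x \<in> states d M" and a: "a \<in> actions d M"
      and *: "\<forall>\<theta>\<in>states d M \<times> actions d M.
       \<bar>\<Sum>n<N. (V (\<omega> n (Suc h)) * trans_dens M (Suc h) (snd \<theta>) (fst \<theta>) (\<omega> n (Suc h)) / qbar h (\<omega> n (Suc h))
          - (\<integral>y. V y \<partial>trans_kernel d M (Suc h) (fst \<theta>) (snd \<theta>)))\<bar> \<le> \<Psi>2 \<omega>"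
    define Y where "Y n = \<omega> n (Suc h)" for n
    define p where "p n = trans_dens M (Suc h) a x (Y n)" for n
    define q where "q n = qbar h (Y n)" for n
    define D where "D n = (\<Sum>k\<in>{..<N} - {n}. trans_dens M (Suc h) (b h) (\<omega> k h) (Y n))" for n
    define I where "I = (\<integral>y. V y \<partial>trans_kernel d M (Suc h) x a)"
    have Y: "Y n \<in> states d M" if "n < N" for n unfolding Y_def using sample_states[OF \<omega> that] h by simp
    have p: "0 < p n" "p n \<le> \<Lambda>" if "n < N" for n
      unfolding p_def using dens_bounds[of "Suc h" a x] Y[OF that] h x a by auto
    have q: "\<delta> \<le> q n" "q n \<le> \<Lambda>" if "n < N" for n
      unfolding q_def using qbar_bounds[OF h Y[OF that]] by auto
    have D: "r * \<delta> \<le> D n" if "n < N" for n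
    proof -
      have "(\<Sum>k\<in>{..<N} - {n}. \<delta>) \<le> D n"
        unfolding D_def using sample_states[OF \<omega>] Y[OF that] h controls by (intro sum_mono dens_bounds(1)) auto
      then show ?thesis using that N by (simp add: r_def of_nat_diff)
    qed
    have D_diff: "D n - r * q n = (\<Sum>k\<in>{..<N} - {n}. trans_dens M (Suc h) (b h) (\<omega> k h) (\<omega> n (Suc h)) - qbar h (\<omega> n (Suc h)))"
      if "n < N" for n
      using that N by (simp add: D_def q_def Y_def r_def sum_subtractf of_nat_diff)
    have summand: "\<bar>V (Y n) * (p n / D n) - (1 / N) * (V (Y n) * p n / q n)\<bar>
        \<le> B * \<Lambda> * ((\<bar>D n - r * q n\<bar> + \<Lambda>) / (r * N * \<delta>\<^sup>2))" if n: "n < N" for n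
    proof -
      have "V (Y n) * (p n / D n) - (1 / N) * (V (Y n) * p n / q n) = V (Y n) * p n * (1 / D n - 1 / (N * q n))"
        by (simp add: algebra_simps)
      then have "\<bar>V (Y n) * (p n / D n) - (1 / N) * (V (Y n) * p n / q n)\<bar> = \<bar>V (Y n)\<bar> * p n * \<bar>1 / D n - 1 / (N * q n)\<bar>"
        using p[OF n] by (simp add: abs_mult)
      also have "\<dots> \<le> B * \<Lambda> * ((\<bar>D n - r * q n\<bar> + \<Lambda>) / (r * N * \<delta>\<^sup>2))"
        using inverse_denominator_diff[OF q[OF n], of "D n"] D[OF n] B(1) B(2)[OF Y[OF n]] p[OF n] constants_pos
        unfolding r_def[symmetric] by (intro mult_mono mult_nonneg_nonneg) auto
      finally show ?thesis .
    qed
    have "\<bar>(\<Sum>n<N. V (Y n) * (p n / D n)) - (1 / N) * (\<Sum>n<N. V (Y n) * p n / q n)\<bar>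
        \<le> (\<Sum>n<N. \<bar>V (Y n) * (p n / D n) - (1 / N) * (V (Y n) * p n / q n)\<bar>)"
      unfolding sum_distrib_left sum_subtractf[symmetric] by (rule sum_abs)
    also have "\<dots> \<le> (\<Sum>n<N. B * \<Lambda> * ((\<bar>D n - r * q n\<bar> + \<Lambda>) / (r * N * \<delta>\<^sup>2)))"
      using summand by (intro sum_mono) auto
    also have "\<dots> = c * (\<Sum>n<N. \<bar>D n - r * q n\<bar> + \<Lambda>)"
      unfolding c_def by (simp add: sum_distrib_left)
    also have "(\<Sum>n<N. \<bar>D n - r * q n\<bar> + \<Lambda>) = \<Psi>1 \<omega> + N * \<Lambda>"
      unfolding \<Psi>1_def using D_diff by (simp add: sum.distrib)
    also have "c * (\<Psi>1 \<omega> + N * \<Lambda>) = c * \<Psi>1 \<omega> + c''"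
      unfolding c_def c''_def using N0 r constants_pos by (simp add: distrib_left power2_eq_square)
    finally have 1: "\<bar>(\<Sum>n<N. V (Y n) * (p n / D n)) - (1 / N) * (\<Sum>n<N. V (Y n) * p n / q n)\<bar> \<le> c * \<Psi>1 \<omega> + c''" .
    have "\<bar>\<Sum>n<N. (V (Y n) * p n / q n - I)\<bar> \<le> \<Psi>2 \<omega>"
      using bspec[OF *, of "(x, a)"] x a by (simp add: Y_def p_def q_def I_def)
    then have "\<bar>(\<Sum>n<N. V (Y n) * p n / q n) - N * I\<bar> \<le> \<Psi>2 \<omega>" by (simp add: sum_subtractf)
    moreover have "(1 / N) * (\<Sum>n<N. V (Y n) * p n / q n) - I = (1 / N) * ((\<Sum>n<N. V (Y n) * p n / q n) - N * I)"
      using N0 by (simp add: right_diff_distrib)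
    then have "\<bar>(1 / N) * (\<Sum>n<N. V (Y n) * p n / q n) - I\<bar> = (1 / N) * \<bar>(\<Sum>n<N. V (Y n) * p n / q n) - N * I\<bar>"
      by (simp add: abs_mult)
    ultimately have 2: "\<bar>(1 / N) * (\<Sum>n<N. V (Y n) * p n / q n) - I\<bar> \<le> (1 / N) * \<Psi>2 \<omega>"
      using N0 by (simp add: divide_right_mono)
    have "(\<Sum>n<N. V (\<omega> n (Suc h)) * mesh_ratio M b N \<omega> h n x a) = (\<Sum>n<N. V (Y n) * (p n / D n))"
      by (simp add: mesh_ratio_def Y_def p_def D_def)
    with 1 2 show "\<bar>(\<Sum>n<N. V (\<omega> n (Suc h)) * mesh_ratio M b N \<omega> h n x a) - (\<integral>y. V y \<partial>trans_kernel d M (Suc h) x a)\<bar> \<le> \<Psi> \<omega>"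
      unfolding \<Psi>_def I_def[symmetric] by linarith
  qed
  moreover have "(\<integral>\<^sup>+\<omega>. ennreal (\<Psi> \<omega>) \<partial>P) \<le> ennreal (B * noise_const / sqrt (real N - 1))"
  proof -
    have "(\<integral>\<^sup>+\<omega>. ennreal (\<Psi> \<omega>) \<partial>P) \<le> ennreal (c * (N * (\<Lambda> * sqrt (real N - 1) * (3 / 2))) + (1 / N) * (sqrt N * E) + c'')"
      unfolding \<Psi>_def using c E0 constants_pos N
      by (intro nn_integral_affine_le[OF prob_P \<Psi>1(1) \<Psi>2(1) \<Psi>1_nonneg \<Psi>2(2) \<Psi>1(2) \<Psi>2(4)]) auto
    also have "\<dots> \<le> ennreal (B * noise_const / sqrt r)"
    proof (rule ennreal_leI)
      have sr: "0 < sqrt r" "sqrt r * sqrt r = r" "sqrt r \<le> r" using r by (auto simp: real_le_rsqrt real_sqrt_le_iff' power2_eq_square intro!: real_le_lsqrt)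
      define X where "X = B * \<Lambda>\<^sup>2 / \<delta>\<^sup>2"
      have X0: "0 \<le> X" unfolding X_def using B by simp
      have "c * (N * (\<Lambda> * sqrt r * (3 / 2))) = 3 / 2 * X * (sqrt r / r)"
        unfolding c_def X_def using N0 r constants_pos by (simp add: field_simps power2_eq_square)
      also have "sqrt r / r = 1 / sqrt r" using sr r by (simp add: field_simps)
      finally have 1: "c * (N * (\<Lambda> * sqrt r * (3 / 2))) = 3 / 2 * (X / sqrt r)" by simp
      have "c'' = X / r" unfolding c''_def X_def by simp
      also have "\<dots> \<le> X / sqrt r" using sr X0 r by (intro divide_left_mono) auto
      finally have 2: "c'' \<le> X / sqrt r" .
      have "(1 / N) * (sqrt N * E) = E / sqrt N" using N0 by (simp add: field_simps)
      also have "\<dots> \<le> E / sqrt r" using E0 r sr by (intro divide_left_mono) auto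
      finally have 3: "(1 / N) * (sqrt N * E) \<le> E / sqrt r" .
      \<comment> \<open>\<open>3 / 2\<close> from the fluctuation of the denominators and 1 from
        \<open>c''\<close>, against the 3 provided in \<open>noise_const\<close>.\<close>
      have "5 / 2 * X + E \<le> B * noise_const"
      proof -
        have "B * noise_const = 3 * X + E"
          unfolding noise_const_def E_def X_def by (simp add: algebra_simps)
        then show ?thesis using X0 by simp
      qed
      then have "(5 / 2 * X + E) / sqrt r \<le> B * noise_const / sqrt r"
        using sr by (intro divide_right_mono) auto
      then have "5 / 2 * (X / sqrt r) + E / sqrt r \<le> B * noise_const / sqrt r"
        by (simp add: add_divide_distrib)
      with 1 2 3 show "c * (N * (\<Lambda> * sqrt (real N - 1) * (3 / 2))) + (1 / N) * (sqrt N * E) + c'' \<le> B * noise_const / sqrt r"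
        unfolding r_def[symmetric] by linarith
    qed
    finally show ?thesis unfolding r_def .
  qed
  ultimately show ?thesis by (intro bexI[of _ \<Psi>]) auto
qed

end

end

text \<open>A real \<open>SUP\<close> is meaningful only for bounded families. Boundedness is known
  for the true values \<open>g\<close> and is passed on to the mesh values \<open>f\<close> by the
  comparison itself.\<close>

lemma abs_SUP_diff_le:
  fixes f g :: "'a \<Rightarrow> real"
  assumes "I \<noteq> {}" and g: "bdd_above (g ` I)" and fg: "\<And>i. i \<in> I \<Longrightarrow> \<bar>f i - g i\<bar> \<le> c"
  shows "\<bar>(SUP i\<in>I. f i) - (SUP i\<in>I. g i)\<bar> \<le> c"
proof -
  have f_le: "f i \<le> (SUP i\<in>I. g i) + c" if "i \<in> I" for i
    using fg[OF that] cSUP_upper[OF that g] by (simp add: abs_le_iff)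
  then have f: "bdd_above (f ` I)" by (rule bdd_aboveI2)
  have "g i \<le> (SUP i\<in>I. f i) + c" if "i \<in> I" for i
    using fg[OF that] cSUP_upper[OF that f] by (simp add: abs_le_iff)
  then have "(SUP i\<in>I. g i) \<le> (SUP i\<in>I. f i) + c" using assms(1) by (intro cSUP_least)
  moreover have "(SUP i\<in>I. f i) \<le> (SUP i\<in>I. g i) + c" using assms(1) f_le by (intro cSUP_least)
  ultimately show ?thesis by (simp add: abs_le_iff)
qed

section \<open>Normalised weights and propagation of the error\<close>

context mesh_setting
begin

context
  fixes N :: nat assumes N: "2 \<le> N"
begin

lemma mesh_ratio_pos:
  assumes \<omega>: "\<omega> \<in> space (P N)" and "h < H" "n < N" "x \<in> states d M" "a \<in> actions d M"
  shows "0 < mesh_ratio M b N \<omega> h n x a"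
proof -
  have st: "\<omega> m t \<in> states d M" if "m < N" "t \<le> H" for m t
    using sample_states[OF N \<omega> that] .
  have "0 < trans_dens M (Suc h) a x (\<omega> n (Suc h))"
    using assms st by (intro dens_bounds(3)) auto
  moreover have "0 < (\<Sum>k\<in>{..<N} - {n}. trans_dens M (Suc h) (b h) (\<omega> k h) (\<omega> n (Suc h)))"
  proof (rule sum_pos)
    \<comment> \<open>A chain other than \<open>n\<close> exists because \<open>N \<ge> 2\<close>,
      so the leave-one-out sum is not empty.\<close>
    have "(if n = 0 then 1 else 0) \<in> {..<N} - {n}" using N by auto
    then show "{..<N} - {n} \<noteq> {}" by blast
    show "0 < trans_dens M (Suc h) (b h) (\<omega> k h) (\<omega> n (Suc h))" if "k \<in> {..<N} - {n}" for k
      using assms st that controls by (intro dens_bounds(3)) auto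
  qed simp
  ultimately show ?thesis by (simp add: mesh_ratio_def)
qed

lemma
  assumes \<omega>: "\<omega> \<in> space (P N)" and h: "h < H" and x: "x \<in> states d M" and a: "a \<in> actions d M"
  shows mesh_ratio_sum_pos: "0 < (\<Sum>n<N. mesh_ratio M b N \<omega> h n x a)"
    and mesh_weight_nonneg: "n < N \<Longrightarrow> 0 \<le> mesh_weight M b N \<omega> h n x a"
    and mesh_weight_sum: "(\<Sum>n<N. mesh_weight M b N \<omega> h n x a) = 1"
proof -
  show pos: "0 < (\<Sum>n<N. mesh_ratio M b N \<omega> h n x a)"
    using mesh_ratio_pos[OF \<omega> h _ x a] N by (intro sum_pos) (auto simp: lessThan_empty_iff)
  show "n < N \<Longrightarrow> 0 \<le> mesh_weight M b N \<omega> h n x a"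
    using mesh_ratio_pos[OF \<omega> h _ x a, of n] pos by (simp add: mesh_weight_def less_imp_le)
  show "(\<Sum>n<N. mesh_weight M b N \<omega> h n x a) = 1"
    unfolding mesh_weight_def sum_divide_distrib[symmetric] using pos by simp
qed

text \<open>Applied to the constant 1, \<open>mesh_sum_majorant\<close> shows that the normalising
  sum is close to 1. The normalised average is at most \<open>B\<close> in absolute value, so
  normalising costs at most \<open>B\<close> times the deviation of that sum, which doubles the
  bound.\<close>

lemma mesh_average_majorant:
  assumes h: "h < H" and V: "V \<in> borel_measurable S" and B: "0 < B" "\<And>y. y \<in> states d M \<Longrightarrow> \<bar>V y\<bar> \<le> B"
  shows "\<exists>\<Phi>\<in>borel_measurable (P N). (\<forall>\<omega>. 0 \<le> \<Phi> \<omega>) \<and>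
    (AE \<omega> in P N. \<forall>x\<in>states d M. \<forall>a\<in>actions d M.
       \<bar>(\<Sum>n<N. V (\<omega> n (Suc h)) * mesh_weight M b N \<omega> h n x a) - (\<integral>y. V y \<partial>trans_kernel d M (Suc h) x a)\<bar> \<le> \<Phi> \<omega>) \<and>
    (\<integral>\<^sup>+\<omega>. ennreal (\<Phi> \<omega>) \<partial>P N) \<le> ennreal (2 * B * noise_const / sqrt (real N - 1))"
proof -
  obtain \<Psi> where \<Psi>: "\<Psi> \<in> borel_measurable (P N)" "\<And>\<omega>. 0 \<le> \<Psi> \<omega>"
    "AE \<omega> in P N. \<forall>x\<in>states d M. \<forall>a\<in>actions d M.
       \<bar>(\<Sum>n<N. V (\<omega> n (Suc h)) * mesh_ratio M b N \<omega> h n x a) - (\<integral>y. V y \<partial>trans_kernel d M (Suc h) x a)\<bar> \<le> \<Psi> \<omega>"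
    "(\<integral>\<^sup>+\<omega>. ennreal (\<Psi> \<omega>) \<partial>P N) \<le> ennreal (B * noise_const / sqrt (real N - 1))"
    using mesh_sum_majorant[OF N h V B] by blast
  have "\<exists>\<Psi>\<in>borel_measurable (P N). (\<forall>\<omega>. 0 \<le> \<Psi> \<omega>) \<and>
    (AE \<omega> in P N. \<forall>x\<in>states d M. \<forall>a\<in>actions d M.
       \<bar>(\<Sum>n<N. (\<lambda>_. 1) (\<omega> n (Suc h)) * mesh_ratio M b N \<omega> h n x a) - (\<integral>y. (\<lambda>_. 1) y \<partial>trans_kernel d M (Suc h) x a)\<bar> \<le> \<Psi> \<omega>) \<and>
    (\<integral>\<^sup>+\<omega>. ennreal (\<Psi> \<omega>) \<partial>P N) \<le> ennreal (1 * noise_const / sqrt (real N - 1))"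
    by (rule mesh_sum_majorant[OF N h]) auto
  then obtain \<Psi>1 where \<Psi>1: "\<Psi>1 \<in> borel_measurable (P N)" "\<And>\<omega>. 0 \<le> \<Psi>1 \<omega>"
    "AE \<omega> in P N. \<forall>x\<in>states d M. \<forall>a\<in>actions d M.
       \<bar>(\<Sum>n<N. 1 * mesh_ratio M b N \<omega> h n x a) - (\<integral>y. 1 \<partial>trans_kernel d M (Suc h) x a)\<bar> \<le> \<Psi>1 \<omega>"
    "(\<integral>\<^sup>+\<omega>. ennreal (\<Psi>1 \<omega>) \<partial>P N) \<le> ennreal (1 * noise_const / sqrt (real N - 1))" by blast
  define \<Phi> where "\<Phi> \<omega> = B * \<Psi>1 \<omega> + 1 * \<Psi> \<omega> + 0" for \<omega>
  have "\<Phi> \<in> borel_measurable (P N)"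
    unfolding \<Phi>_def[abs_def] by (intro borel_measurable_add borel_measurable_times borel_measurable_const \<Psi>1 \<Psi>)
  moreover have "0 \<le> \<Phi> \<omega>" for \<omega> unfolding \<Phi>_def using B \<Psi>(2) \<Psi>1(2) by simp
  moreover have "AE \<omega> in P N. \<forall>x\<in>states d M. \<forall>a\<in>actions d M.
       \<bar>(\<Sum>n<N. V (\<omega> n (Suc h)) * mesh_weight M b N \<omega> h n x a) - (\<integral>y. V y \<partial>trans_kernel d M (Suc h) x a)\<bar> \<le> \<Phi> \<omega>"
    using \<Psi>(3) \<Psi>1(3) AE_space
  proof eventually_elim
    case (elim \<omega>)
    show ?case
    proof (intro ballI)
      fix x a assume x: "x \<in> states d M" and a: "a \<in> actions d M"
      define I where "I = (\<integral>y. V y \<partial>trans_kernel d M (Suc h) x a)"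
      define r where "r n = mesh_ratio M b N \<omega> h n x a" for n
      define Z where "Z = (\<Sum>n<N. V (\<omega> n (Suc h)) * r n)"
      define Z1 where "Z1 = (\<Sum>n<N. r n)"
      have Z1: "0 < Z1" unfolding Z1_def r_def by (rule mesh_ratio_sum_pos[OF elim(3) h x a])
      have "prob_space (trans_kernel d M (Suc h) x a)" using h by (intro kernel_prob x a) auto
      then have total: "(\<integral>y. 1 \<partial>trans_kernel d M (Suc h) x a) = (1::real)" by (simp add: prob_space.prob_space)
      have 1: "\<bar>Z1 - 1\<bar> \<le> \<Psi>1 \<omega>"
        using bspec[OF bspec[OF elim(2) x] a] unfolding total by (simp add: Z1_def r_def)
      have 2: "\<bar>Z - I\<bar> \<le> \<Psi> \<omega>" using elim(1) x a by (simp add: Z_def r_def I_def)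
      have "\<bar>Z\<bar> \<le> (\<Sum>n<N. \<bar>V (\<omega> n (Suc h)) * r n\<bar>)" unfolding Z_def by (rule sum_abs)
      also have "\<dots> \<le> (\<Sum>n<N. B * r n)"
      proof (rule sum_mono)
        fix n assume "n \<in> {..<N}"
        then have "0 < r n" "\<omega> n (Suc h) \<in> states d M"
          unfolding r_def using mesh_ratio_pos[OF elim(3) h _ x a] sample_states[OF N elim(3)] h by auto
        then show "\<bar>V (\<omega> n (Suc h)) * r n\<bar> \<le> B * r n" using B(2) by (simp add: abs_mult)
      qed
      also have "\<dots> = B * Z1" unfolding Z1_def sum_distrib_left ..
      finally have ZB: "\<bar>Z / Z1\<bar> \<le> B" using Z1 by (simp add: abs_divide field_simps)
      have "\<bar>Z / Z1 - Z\<bar> = \<bar>Z / Z1\<bar> * \<bar>Z1 - 1\<bar>"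
      proof -
        have "Z / Z1 - Z = (Z / Z1) * (1 - Z1)" using Z1 by (simp add: field_simps)
        then show ?thesis by (simp add: abs_mult abs_minus_commute)
      qed
      also have "\<dots> \<le> B * \<Psi>1 \<omega>" by (intro mult_mono ZB 1) (use B in auto)
      finally have "\<bar>Z / Z1 - I\<bar> \<le> \<Phi> \<omega>" unfolding \<Phi>_def using 2 by linarith
      moreover have "(\<Sum>n<N. V (\<omega> n (Suc h)) * mesh_weight M b N \<omega> h n x a) = Z / Z1"
        by (simp add: mesh_weight_def Z_def Z1_def r_def sum_divide_distrib)
      ultimately show "\<bar>(\<Sum>n<N. V (\<omega> n (Suc h)) * mesh_weight M b N \<omega> h n x a) - (\<integral>y. V y \<partial>trans_kernel d M (Suc h) x a)\<bar> \<le> \<Phi> \<omega>"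
        by (simp add: I_def)
    qed
  qed
  moreover have "(\<integral>\<^sup>+\<omega>. ennreal (\<Phi> \<omega>) \<partial>P N) \<le> ennreal (2 * B * noise_const / sqrt (real N - 1))"
  proof -
    have "(\<integral>\<^sup>+\<omega>. ennreal (\<Phi> \<omega>) \<partial>P N) \<le>
        ennreal (B * (1 * noise_const / sqrt (real N - 1)) + 1 * (B * noise_const / sqrt (real N - 1)) + 0)"
      unfolding \<Phi>_def using B noise_const_nonneg N
      by (intro nn_integral_affine_le[OF prob_P[OF N] \<Psi>1(1) \<Psi>(1) \<Psi>1(2) \<Psi>(2) \<Psi>1(4) \<Psi>(4)]) auto
    then show ?thesis by (simp add: algebra_simps)
  qed
  ultimately show ?thesis by (intro bexI[of _ \<Phi>]) auto
qed

text \<open>The comparison is with the full supremum over actions, so it is also available at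
  \<open>x0\<close>. Exchanging that supremum for \<open>W (Suc k)\<close> is an almost sure step at
  random mesh points and is left to the induction.\<close>

lemma mesh_value_step:
  assumes \<omega>: "\<omega> \<in> space (P N)" and k: "k < H" and x: "x \<in> states d M"
    and noise: "\<forall>a\<in>actions d M. \<bar>(\<Sum>n<N. W k (\<omega> n (H - k)) * mesh_weight M b N \<omega> (H - Suc k) n x a)
        - (\<integral>y. W k y \<partial>trans_kernel d M (H - k) x a)\<bar> \<le> \<phi>"
    and prev: "\<And>n. n < N \<Longrightarrow> \<bar>mesh_value d H M b N \<omega> k (\<omega> n (H - k)) - W k (\<omega> n (H - k))\<bar> \<le> e"
  shows "\<bar>mesh_value d H M b N \<omega> (Suc k) x - (SUP a\<in>actions d M. Q k (x, a))\<bar> \<le> e + \<phi>"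
  unfolding mesh_value.simps
proof (rule abs_SUP_diff_le[OF actions_nonempty bdd_above_Q[OF k x]])
  fix a assume a: "a \<in> actions d M"
  define w where "w n = mesh_weight M b N \<omega> (H - Suc k) n x a" for n
  define v where "v n = mesh_value d H M b N \<omega> k (\<omega> n (H - k))" for n
  define u where "u n = W k (\<omega> n (H - k))" for n
  have h: "H - Suc k < H" using k by simp
  have w: "0 \<le> w n" if "n < N" for n unfolding w_def by (rule mesh_weight_nonneg[OF \<omega> h x a that])
  have w1: "(\<Sum>n<N. w n) = 1" unfolding w_def by (rule mesh_weight_sum[OF \<omega> h x a])
  have "\<bar>(\<Sum>n<N. v n * w n) - (\<Sum>n<N. u n * w n)\<bar> \<le> (\<Sum>n<N. \<bar>(v n - u n) * w n\<bar>)"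
    unfolding sum_subtractf[symmetric] left_diff_distrib[symmetric] by (rule sum_abs)
  also have "\<dots> \<le> (\<Sum>n<N. e * w n)"
  proof (rule sum_mono)
    fix n assume "n \<in> {..<N}"
    then have n: "n < N" by simp
    show "\<bar>(v n - u n) * w n\<bar> \<le> e * w n"
      using w[OF n] mult_right_mono[OF prev[OF n] w[OF n]] by (simp add: abs_mult v_def u_def)
  qed
  also have "\<dots> = e" unfolding sum_distrib_left[symmetric] w1 by simp
  finally have "\<bar>(\<Sum>n<N. v n * w n) - (\<Sum>n<N. u n * w n)\<bar> \<le> e" .
  moreover have "\<bar>(\<Sum>n<N. u n * w n) - (\<integral>y. W k y \<partial>trans_kernel d M (H - k) x a)\<bar> \<le> \<phi>"
    using noise a unfolding u_def w_def by blast
  ultimately show "\<bar>reward M (H - Suc k) x a +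
      (\<Sum>n<N. mesh_value d H M b N \<omega> k (\<omega> n (H - k)) * mesh_weight M b N \<omega> (H - Suc k) n x a) - Q k (x, a)\<bar> \<le> e + \<phi>"
    unfolding q_fun_def v_def[symmetric] w_def[symmetric] by simp
qed

lemma mesh_error_le:
  assumes H: "0 < H" and G: "0 < G"
  shows "mesh_error d H M b x0 N \<le> ennreal (H * (2 * ((real H + 1) * G) * noise_const / sqrt (real N - 1)))"
proof -
  let ?c = "2 * ((real H + 1) * G) * noise_const / sqrt (real N - 1)"
  have "\<exists>\<Phi>. \<Phi> \<in> borel_measurable (P N) \<and> (\<forall>\<omega>. 0 \<le> \<Phi> \<omega>) \<and>
    (AE \<omega> in P N. \<forall>x\<in>states d M. \<forall>a\<in>actions d M.
       \<bar>(\<Sum>n<N. W k (\<omega> n (H - k)) * mesh_weight M b N \<omega> (H - Suc k) n x a) - (\<integral>y. W k y \<partial>trans_kernel d M (H - k) x a)\<bar> \<le> \<Phi> \<omega>) \<and>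
    (\<integral>\<^sup>+\<omega>. ennreal (\<Phi> \<omega>) \<partial>P N) \<le> ennreal ?c" if k: "k < H" for k
  proof -
    have h: "H - Suc k < H" "Suc (H - Suc k) = H - k" using k by auto
    have Wm: "W k \<in> borel_measurable S" using k by (intro value_fun_measurable) simp
    have "\<bar>W k y\<bar> \<le> (real H + 1) * G" if "y \<in> states d M" for y
    proof -
      have "\<bar>W k y\<bar> \<le> (real k + 1) * G" using k that by (intro value_fun_bound) auto
      also have "\<dots> \<le> (real H + 1) * G" using k G by (intro mult_right_mono) auto
      finally show ?thesis .
    qed
    moreover have "0 < (real H + 1) * G" using G by (intro mult_pos_pos) auto
    ultimately show ?thesis using mesh_average_majorant[OF h(1) Wm, of "(real H + 1) * G"] unfolding h(2) by blast
  qed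
  then have "\<forall>k. \<exists>\<Phi>. k < H \<longrightarrow> \<Phi> \<in> borel_measurable (P N) \<and> (\<forall>\<omega>. 0 \<le> \<Phi> \<omega>) \<and>
    (AE \<omega> in P N. \<forall>x\<in>states d M. \<forall>a\<in>actions d M.
       \<bar>(\<Sum>n<N. W k (\<omega> n (H - k)) * mesh_weight M b N \<omega> (H - Suc k) n x a) - (\<integral>y. W k y \<partial>trans_kernel d M (H - k) x a)\<bar> \<le> \<Phi> \<omega>) \<and>
    (\<integral>\<^sup>+\<omega>. ennreal (\<Phi> \<omega>) \<partial>P N) \<le> ennreal ?c" by blast
  from choice[OF this] obtain \<Phi> where \<Phi>: "\<And>k. k < H \<Longrightarrow> \<Phi> k \<in> borel_measurable (P N)" "\<And>k \<omega>. k < H \<Longrightarrow> 0 \<le> \<Phi> k \<omega>"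
    "\<And>k. k < H \<Longrightarrow> AE \<omega> in P N. \<forall>x\<in>states d M. \<forall>a\<in>actions d M.
       \<bar>(\<Sum>n<N. W k (\<omega> n (H - k)) * mesh_weight M b N \<omega> (H - Suc k) n x a) - (\<integral>y. W k y \<partial>trans_kernel d M (H - k) x a)\<bar> \<le> \<Phi> k \<omega>"
    "\<And>k. k < H \<Longrightarrow> (\<integral>\<^sup>+\<omega>. ennreal (\<Phi> k \<omega>) \<partial>P N) \<le> ennreal ?c" by auto
  have "AE \<omega> in P N. \<forall>k\<in>{..<H}. \<forall>x\<in>states d M. \<forall>a\<in>actions d M.
       \<bar>(\<Sum>n<N. W k (\<omega> n (H - k)) * mesh_weight M b N \<omega> (H - Suc k) n x a) - (\<integral>y. W k y \<partial>trans_kernel d M (H - k) x a)\<bar> \<le> \<Phi> k \<omega>"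
    using \<Phi>(3) by (intro AE_finite_allI[OF finite_lessThan]) simp
  \<comment> \<open>The bound \<open>k < H - 1\<close> means that the time \<open>H - Suc k\<close>
    is at least 1, where mesh states have a density. At time 0 all chains sit at
    \<open>x0\<close>.\<close>
  moreover have "AE \<omega> in P N. \<forall>k\<in>{..<H - 1}. \<forall>n<N.
      (SUP a\<in>actions d M. Q k (\<omega> n (H - Suc k), a)) = W (Suc k) (\<omega> n (H - Suc k))"
  proof (rule AE_finite_allI[OF finite_lessThan], rule sample_AE[OF N])
    fix k assume "k \<in> {..<H - 1}"
    then have k: "H - Suc (Suc k) < H" "Suc (H - Suc (Suc k)) = H - Suc k" "k < H" by auto
    show "AE s in chain H. (SUP a\<in>actions d M. Q k (s (H - Suc k), a)) = W (Suc k) (s (H - Suc k))"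
      using chain_next_AE[OF k(1) value_fun_AE[OF k(3)]] unfolding k(2) .
  qed
  ultimately have "AE \<omega> in P N. \<bar>mesh_output d H M b x0 N \<omega> - optimal_value d H M x0\<bar> \<le> (\<Sum>k<H. \<Phi> k \<omega>)"
    using AE_space
  proof eventually_elim
    case (elim \<omega>)
    have "\<forall>n<N. \<bar>mesh_value d H M b N \<omega> k (\<omega> n (H - k)) - W k (\<omega> n (H - k))\<bar> \<le> (\<Sum>j<k. \<Phi> j \<omega>)"
      if "k < H" for k
      using that
    proof (induction k)
      case (Suc k)
      show ?case
      proof (intro allI impI)
        fix n assume n: "n < N"
        have x: "\<omega> n (H - Suc k) \<in> states d M" using sample_states[OF N elim(3) n] by simp
        have "\<bar>mesh_value d H M b N \<omega> (Suc k) (\<omega> n (H - Suc k)) - (SUP a\<in>actions d M. Q k (\<omega> n (H - Suc k), a))\<bar>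
            \<le> (\<Sum>j<k. \<Phi> j \<omega>) + \<Phi> k \<omega>"
          using Suc elim(1) x by (intro mesh_value_step[OF elim(3)]) auto
        moreover have "(SUP a\<in>actions d M. Q k (\<omega> n (H - Suc k), a)) = W (Suc k) (\<omega> n (H - Suc k))"
          using elim(2) n Suc.prems by auto
        ultimately show "\<bar>mesh_value d H M b N \<omega> (Suc k) (\<omega> n (H - Suc k)) - W (Suc k) (\<omega> n (H - Suc k))\<bar> \<le> (\<Sum>j<Suc k. \<Phi> j \<omega>)"
          by simp
      qed
    qed simp
    from this[of "H - 1"] have prev: "\<bar>mesh_value d H M b N \<omega> (H - 1) (\<omega> n (H - (H - 1))) - W (H - 1) (\<omega> n (H - (H - 1)))\<bar>
        \<le> (\<Sum>j<H - 1. \<Phi> j \<omega>)" if "n < N" for n using H that by simp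
    have "\<bar>mesh_value d H M b N \<omega> (Suc (H - 1)) x0 - (SUP a\<in>actions d M. Q (H - 1) (x0, a))\<bar>
        \<le> (\<Sum>j<H - 1. \<Phi> j \<omega>) + \<Phi> (H - 1) \<omega>"
    proof (rule mesh_value_step[OF elim(3) _ x0 _ prev])
      show k: "H - 1 < H" using H by simp
      show "\<forall>a\<in>actions d M. \<bar>(\<Sum>n<N. W (H - 1) (\<omega> n (H - (H - 1))) * mesh_weight M b N \<omega> (H - Suc (H - 1)) n x0 a)
          - (\<integral>y. W (H - 1) y \<partial>trans_kernel d M (H - (H - 1)) x0 a)\<bar> \<le> \<Phi> (H - 1) \<omega>"
        by (rule bspec[OF bspec[OF elim(1)] x0]) (use k in simp)
    qed
    moreover have "(\<Sum>j<H - 1. \<Phi> j \<omega>) + \<Phi> (H - 1) \<omega> = (\<Sum>k<H. \<Phi> k \<omega>)"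
      using H sum.lessThan_Suc[of "\<lambda>j. \<Phi> j \<omega>" "H - 1"] by simp
    ultimately show ?case
      unfolding mesh_output_def optimal_value_eq[OF H x0] using H by simp
  qed
  \<comment> \<open>From here on only the measurable majorants are integrated; the possibly
    non-Borel output enters through an inequality, and completing the law leaves its integral
    unchanged.\<close>
  then have "(\<integral>\<^sup>+\<omega>. ennreal \<bar>mesh_output d H M b x0 N \<omega> - optimal_value d H M x0\<bar> \<partial>P N) \<le> (\<integral>\<^sup>+\<omega>. ennreal (\<Sum>k<H. \<Phi> k \<omega>) \<partial>P N)"
    by (intro nn_integral_mono_AE) (auto elim!: eventually_mono intro: ennreal_leI)
  also have "\<dots> = (\<integral>\<^sup>+\<omega>. (\<Sum>k<H. ennreal (\<Phi> k \<omega>)) \<partial>P N)"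
    using \<Phi>(2) by (intro nn_integral_cong sum_ennreal[symmetric]) auto
  also have "\<dots> = (\<Sum>k<H. \<integral>\<^sup>+\<omega>. ennreal (\<Phi> k \<omega>) \<partial>P N)"
    using \<Phi>(1) by (intro nn_integral_sum) (auto intro: measurable_compose[OF _ measurable_ennreal])
  also have "\<dots> \<le> (\<Sum>k<H. ennreal ?c)" using \<Phi>(4) by (intro sum_mono) auto
  also have "\<dots> = ennreal (H * ?c)"
    by (simp add: ennreal_of_nat_eq_real_of_nat ennreal_mult'[symmetric])
  finally show ?thesis unfolding mesh_error_def nn_integral_completion .
qed

end

end

section \<open>Complexity\<close>

context mesh_setting
begin

text \<open>The ball contains a cube, whose volume is bounded because the densities are at least \<open>\<delta>\<close>.\<close>

lemma state_radius_le:
  assumes "0 < H"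
  shows "2 * state_radius M / sqrt d \<le> 1 + 1 / \<delta>"
proof -
  obtain a where a: "a \<in> actions d M" using actions_nonempty by blast
  let ?K = "trans_kernel d M 1 x0 a"
  have K: "prob_space ?K" "space ?K = states d M" using kernel_prob[OF _ _ x0 a, of 1] assms by auto
  have "ennreal \<delta> * emeasure S (space S) = (\<integral>\<^sup>+y. ennreal \<delta> \<partial>S)" by simp
  also have "\<dots> \<le> (\<integral>\<^sup>+y. 1 * ennreal (trans_dens M 1 a x0 y) \<partial>S)"
    using dens_bounds(1)[of 1 a x0] assms a x0 by (intro nn_integral_mono) (auto intro!: ennreal_leI)
  also have "\<dots> = (\<integral>\<^sup>+y. 1 \<partial>?K)"
    using assms a x0 by (intro nn_integral_trans_kernel[symmetric]) auto
  also have "\<dots> = 1" using prob_space.emeasure_space_1[OF K(1)] by simp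
  finally have vol: "ennreal \<delta> * emeasure S (space S) \<le> 1" .
  define u where "u = 2 * state_radius M / sqrt d"
  have u: "0 \<le> u" using radii by (simp add: u_def)
  have "ennreal (\<delta> * u ^ d) = ennreal \<delta> * ennreal (u ^ d)"
    using constants_pos u by (intro ennreal_mult) auto
  also have "\<dots> \<le> ennreal \<delta> * emeasure S (space S)"
    using cube_le_emeasure_lebesgue_ball[OF less_imp_le[OF radii(1)] d]
    by (intro mult_left_mono) (simp_all add: u_def state_space_def)
  also note vol
  finally have "\<delta> * u ^ d \<le> 1" by simp
  then have ud: "u ^ d \<le> 1 / \<delta>" using constants_pos by (simp add: field_simps)
  \<comment> \<open>In place of a \<open>d\<close>-th root: either \<open>u \<le> 1\<close>, or
    \<open>u \<le> u ^ d\<close> because \<open>d \<ge> 1\<close>.\<close>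
  show ?thesis
    unfolding u_def[symmetric]
  proof (cases "u \<le> 1")
    case False
    then have "u ^ 1 \<le> u ^ d" using d by (intro power_increasing) auto
    with ud show "u \<le> 1 + 1 / \<delta>" by simp
  qed (use constants_pos in \<open>simp add: add_increasing2\<close>)
qed

text \<open>The crude \<open>ln (x + 2) \<le> x + 1\<close> is enough for the state radius, which is
  itself polynomially bounded. For the action radius the logarithm undoes the exponential.\<close>

lemma metric_entropy_le:
  fixes e p :: real
  assumes "0 < H" and e: "1 / \<delta> \<le> e" and A: "action_radius M \<le> exp p"
  shows "metric_entropy \<le> real d * (2 * real d * (1 + e) + 4 * real d + 3 + p\<^sup>2)"
proof -
  have sd: "0 < sqrt d" "sqrt d * sqrt d = d" "sqrt d \<le> d"
    using d by (auto intro!: real_le_lsqrt simp: power2_eq_square)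
  have ln_le: "ln (x + 2) \<le> x + 1" if "0 \<le> x" for x :: real
    using ln_add_one_self_le_self[of "x + 1"] that by (simp add: add.commute)
  have "2 * state_radius M / sqrt d \<le> 1 + e" using state_radius_le[OF assms(1)] e by linarith
  then have "2 * state_radius M \<le> (1 + e) * sqrt d" using sd by (simp add: field_simps)
  from mult_right_mono[OF this less_imp_le[OF sd(1)]] sd(2)
  have R: "2 * state_radius M * sqrt d \<le> (1 + e) * d" by (simp add: mult.assoc)
  have "ln (4 * state_radius M * sqrt d + 2) \<le> 4 * state_radius M * sqrt d + 1"
    using radii by (intro ln_le) auto
  also have "\<dots> \<le> 2 * real d * (1 + e) + 1" using R by (simp add: algebra_simps)
  finally have 1: "ln (4 * state_radius M * sqrt d + 2) \<le> 2 * real d * (1 + e) + 1" .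
  \<comment> \<open>\<open>1 + p^2\<close> is nonnegative whatever the sign of \<open>p\<close>, so
    its exponential is at least 1 and the additive 2 can be absorbed as well.\<close>
  have "(p - 1 / 2)\<^sup>2 = p\<^sup>2 - p + 1 / 4" by (simp add: power2_eq_square algebra_simps)
  then have p: "p \<le> 1 + p\<^sup>2" using zero_le_power2[of "p - 1 / 2"] by linarith
  have "4 * action_radius M * sqrt d + 2 \<le> 4 * exp (1 + p\<^sup>2) * d + 2 * exp (1 + p\<^sup>2)"
  proof (intro add_mono mult_mono)
    show "action_radius M \<le> exp (1 + p\<^sup>2)" using A p by (meson exp_le_cancel_iff order_trans)
    have "1 \<le> exp (1 + p\<^sup>2)" by simp
    then show "2 \<le> 2 * exp (1 + p\<^sup>2)" by linarith
  qed (use sd radii in auto)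
  also have "\<dots> = (4 * real d + 2) * exp (1 + p\<^sup>2)" by (simp add: algebra_simps)
  finally have "ln (4 * action_radius M * sqrt d + 2) \<le> ln ((4 * real d + 2) * exp (1 + p\<^sup>2))"
    using radii by (subst ln_le_cancel_iff) (auto intro!: add_nonneg_pos mult_pos_pos)
  also have "\<dots> = ln (4 * real d + 2) + (1 + p\<^sup>2)"
    by (subst ln_mult) (auto intro!: add_nonneg_pos)
  also have "\<dots> \<le> 4 * real d + 1 + (1 + p\<^sup>2)" using ln_le[of "4 * real d"] by linarith
  finally have 2: "ln (4 * action_radius M * sqrt d + 2) \<le> 4 * real d + 1 + (1 + p\<^sup>2)" .
  show ?thesis
    unfolding metric_entropy_def using 1 2 by (intro mult_left_mono) auto
qed

lemma noise_const_le:
  fixes l u e m :: real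
  assumes "L \<le> l" "\<Lambda> \<le> u" "1 / \<delta> \<le> e" "metric_entropy \<le> m"
  shows "noise_const \<le> 3 * (u * e)\<^sup>2 + (2 * (u * e) * (m + 2) + 4 * (l * e) * (4 + 4 * m + 12 * d) + 2 * (l * e))"
proof -
  have "\<Lambda> * (1 / \<delta>) \<le> u * e" "L * (1 / \<delta>) \<le> l * e"
    using assms constants_pos by (intro mult_mono; simp)+
  then have le: "\<Lambda> / \<delta> \<le> u * e" "L / \<delta> \<le> l * e" by simp_all
  have pos: "0 \<le> \<Lambda> / \<delta>" "0 \<le> L / \<delta>" using constants_pos by auto
  have 1: "3 * \<Lambda>\<^sup>2 / \<delta>\<^sup>2 \<le> 3 * (u * e)\<^sup>2"
    using power_mono[OF le(1) pos(1), of 2] by (simp add: power_divide)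
  have 2: "2 * (\<Lambda> / \<delta>) * (metric_entropy + 2) \<le> 2 * (u * e) * (m + 2)"
    using le pos assms(4) metric_entropy_nonneg by (intro mult_mono) linarith+
  have 3: "4 * (L / \<delta>) * (4 + 4 * metric_entropy + 12 * d) \<le> 4 * (l * e) * (4 + 4 * m + 12 * d)"
    using le pos assms(4) metric_entropy_nonneg by (intro mult_mono) linarith+
  have 4: "2 * (L / \<delta>) \<le> 2 * (l * e)" using le by linarith
  show ?thesis unfolding noise_const_def by (intro add_mono 1 2 3 4)
qed

end

text \<open>The bounds of \<open>noise_const_le\<close> and \<open>metric_entropy_le\<close>
  combined, written as a polynomial in the dimension that depends on the four given polynomials
  only. The added 1 makes its values at least 1 in every problem.\<close>

definition noise_poly :: "real poly \<Rightarrow> real poly \<Rightarrow> real poly \<Rightarrow> real poly \<Rightarrow> real poly" where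
  "noise_poly pL p\<Lambda> p\<delta> pA =
    (let X = [:0, 1:]; m = X * (smult 2 X * (1 + p\<delta>) + smult 4 X + [:3:] + pA\<^sup>2) in
     1 + smult 3 ((p\<Lambda> * p\<delta>)\<^sup>2) + (smult 2 (p\<Lambda> * p\<delta>) * (m + [:2:]) +
       smult 4 (pL * p\<delta>) * ([:4:] + smult 4 m + smult 12 X) + smult 2 (pL * p\<delta>)))"

text \<open>\<open>G\<close> may be 0 while the error bound takes a positive bound on the rewards,
  hence \<open>G'\<close>. The factor 4 comes from \<open>H + 1 \<le> 2 * H\<close>.\<close>

lemma mesh_error_problem_le:
  assumes prob: "mesh_problem pL p\<Lambda> p\<delta> pA H G M x0 b \<delta> \<Lambda> L" and d: "1 \<le> d" and G: "G \<le> G'" "0 < G'" and N: "2 \<le> N"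
  defines "c \<equiv> poly (noise_poly pL p\<Lambda> p\<delta> pA) (real d)"
  shows "mesh_error d H (M d) (b d) (x0 d) N \<le> ennreal (4 * real H ^ 2 * G' * c / sqrt (real N - 1))" "1 \<le> c"
proof -
  have H: "0 < H" using prob by (auto simp: mesh_problem_def)
  interpret mesh_setting d H "M d" G' "\<delta> d" "\<Lambda> d" "L d" "x0 d" "b d"
  proof unfold_locales
    have "bounded_rewards d H (M d) G" using prob d by (simp add: mesh_problem_def)
    then show "bounded_rewards d H (M d) G'"
      using G(1) unfolding bounded_rewards_def by (meson order_trans)
  qed (use prob d in \<open>auto simp: mesh_problem_def\<close>)
  have le: "L d \<le> poly pL (real d)" "\<Lambda> d \<le> poly p\<Lambda> (real d)" "1 / \<delta> d \<le> poly p\<delta> (real d)"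
    "action_radius (M d) \<le> exp (poly pA (real d))"
    using prob d by (auto simp: mesh_problem_def)
  define B where "B = 3 * (poly p\<Lambda> d * poly p\<delta> d)\<^sup>2 + (2 * (poly p\<Lambda> d * poly p\<delta> d) *
      (real d * (2 * real d * (1 + poly p\<delta> d) + 4 * real d + 3 + (poly pA d)\<^sup>2) + 2) +
      4 * (poly pL d * poly p\<delta> d) * (4 + 4 * (real d * (2 * real d * (1 + poly p\<delta> d) + 4 * real d + 3 + (poly pA d)\<^sup>2)) + 12 * real d) +
      2 * (poly pL d * poly p\<delta> d))"
  have noise: "noise_const \<le> B"
    using noise_const_le[OF le(1-3) metric_entropy_le[OF H le(3,4)]] unfolding B_def by simp
  have c: "c = 1 + B"
    unfolding c_def noise_poly_def B_def by (simp add: Let_def algebra_simps)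
  show "1 \<le> c" unfolding c using noise noise_const_nonneg by linarith
  have "mesh_error d H (M d) (b d) (x0 d) N \<le> ennreal (H * (2 * ((real H + 1) * G') * noise_const / sqrt (real N - 1)))"
    by (rule mesh_error_le[OF N H G(2)])
  also have "\<dots> \<le> ennreal (4 * real H ^ 2 * G' * c / sqrt (real N - 1))"
  proof (rule ennreal_leI)
    have "real H * (2 * ((real H + 1) * G') * noise_const) \<le> real H * (2 * ((2 * real H) * G') * c)"
      using H G noise noise_const_nonneg c by (intro mult_left_mono mult_mono) auto
    also have "\<dots> = 4 * real H ^ 2 * G' * c" by (simp add: power2_eq_square)
    finally have "real H * (2 * ((real H + 1) * G') * noise_const) / sqrt (real N - 1) \<le> 4 * real H ^ 2 * G' * c / sqrt (real N - 1)"
      using N by (intro divide_right_mono) auto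
    then show "real H * (2 * ((real H + 1) * G') * noise_const / sqrt (real N - 1)) \<le> 4 * real H ^ 2 * G' * c / sqrt (real N - 1)"
      by simp
  qed
  finally show "mesh_error d H (M d) (b d) (x0 d) N \<le> ennreal (4 * real H ^ 2 * G' * c / sqrt (real N - 1))" .
qed

text \<open>\<open>X\<close> is the square of the error constant divided by \<epsilon>, that is, the
  number of chains which the rate \<open>1 / sqrt (N - 1)\<close> demands.\<close>

lemma mesh_complexity_le:
  assumes prob: "mesh_problem pL p\<Lambda> p\<delta> pA H G M x0 b \<delta> \<Lambda> L" and d: "1 \<le> d" and G: "G \<le> G'" "0 < G'" and \<epsilon>: "0 < \<epsilon>"
  defines "X \<equiv> 16 * real H ^ 4 * G' ^ 2 * poly (noise_poly pL p\<Lambda> p\<delta> pA) (real d) ^ 2 / \<epsilon> ^ 2"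
  shows "mesh_complexity H (M d) (b d) (x0 d) \<epsilon> d \<le> ereal (real H * (X + 3) ^ 2)"
proof -
  define c where "c = poly (noise_poly pL p\<Lambda> p\<delta> pA) (real d)"
  \<comment> \<open>The additive 2 ensures \<open>N \<ge> 2\<close> and \<open>N - 1 \<ge> X\<close>
    at once, and rounding keeps \<open>N \<le> X + 3\<close>.\<close>
  define N where "N = nat \<lceil>X\<rceil> + 2"
  have c: "1 \<le> c" unfolding c_def using mesh_error_problem_le(2)[OF prob d G, of 2] by simp
  have H: "0 < H" using prob by (auto simp: mesh_problem_def)
  define Y where "Y = 4 * real H ^ 2 * G' * c / \<epsilon>"
  have Y: "0 < Y" unfolding Y_def using H G c \<epsilon> by auto
  have XY: "X = Y ^ 2" unfolding X_def Y_def c_def by (simp add: power_divide power_mult_distrib)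
  have X0: "0 \<le> X" unfolding XY by simp
  then have N: "2 \<le> N" "X + 1 \<le> real N - 1" "real N \<le> X + 3" unfolding N_def by linarith+
  have "Y \<le> sqrt (real N - 1)" using N(2) Y unfolding XY by (intro real_le_rsqrt) simp
  then have "4 * real H ^ 2 * G' * c / sqrt (real N - 1) \<le> \<epsilon>"
    using Y \<epsilon> N by (simp add: Y_def field_simps)
  then have "mesh_error d H (M d) (b d) (x0 d) N \<le> ennreal \<epsilon>"
    using mesh_error_problem_le(1)[OF prob d G N(1)] unfolding c_def by (meson ennreal_leI order_trans)
  then have "mesh_complexity H (M d) (b d) (x0 d) \<epsilon> d \<le> ereal (real H * real N ^ 2)"
    unfolding mesh_complexity_def using N(1) by (intro Inf_lower) blast
  also have "\<dots> \<le> ereal (real H * (X + 3) ^ 2)"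
    using N(3) by (simp add: mult_left_mono power_mono)
  finally show ?thesis .
qed

text \<open>Keeps the logarithm in the tractability quotient nonnegative, so that an upper bound
  decides the limit.\<close>

lemma mesh_complexity_ge: "1 \<le> H \<Longrightarrow> 1 \<le> mesh_complexity H M b x0 \<epsilon> d"
  unfolding mesh_complexity_def
proof (rule Inf_greatest)
  fix z assume H: "1 \<le> H" and "z \<in> {ereal (real H * real N ^ 2) | N. 2 \<le> N \<and> mesh_error d H M b x0 N \<le> ennreal \<epsilon>}"
  then obtain N where z: "z = ereal (real H * real N ^ 2)" and N: "2 \<le> N" by blast
  have "1 * 1 \<le> real H * real N ^ 2" using H N by (intro mult_mono one_le_power) auto
  then show "1 \<le> z" by (simp add: z)
qed

section \<open>Polynomial growth and the tractability limit\<close>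

lemma poly_growth: "\<exists>c m. 0 \<le> c \<and> (\<forall>x\<ge>1. \<bar>poly p x\<bar> \<le> c * x ^ m)" for p :: "real poly"
proof (induction p)
  case 0
  show ?case by (intro exI[of _ 0]) simp
next
  case (pCons a p)
  then obtain c m where c: "0 \<le> c" "\<And>x. 1 \<le> x \<Longrightarrow> \<bar>poly p x\<bar> \<le> c * x ^ m" by blast
  have "\<bar>poly (pCons a p) x\<bar> \<le> (\<bar>a\<bar> + c) * x ^ Suc m" if x: "1 \<le> x" for x
  proof -
    have "\<bar>poly (pCons a p) x\<bar> \<le> \<bar>a\<bar> + \<bar>x * poly p x\<bar>" by (simp add: abs_triangle_ineq)
    also have "\<dots> = \<bar>a\<bar> * 1 + x * \<bar>poly p x\<bar>" using x by (simp add: abs_mult)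
    also have "\<dots> \<le> \<bar>a\<bar> * x ^ Suc m + x * (c * x ^ m)"
      using x c(2)[OF x] one_le_power[OF x, of "Suc m"] by (intro add_mono mult_left_mono) auto
    finally show ?thesis by (simp add: algebra_simps)
  qed
  then show ?case using c(1) by (intro exI[of _ "\<bar>a\<bar> + c"] exI[of _ "Suc m"]) auto
qed

text \<open>A polynomial bound in \<open>s = d + 1 / \<epsilon>\<close> makes the logarithm of order
  \<open>ln s\<close>, and \<open>ln s / s\<close> tends to 0. Working with \<open>s\<close> alone
  covers every way in which dimension and accuracy can go to the limit jointly.\<close>

lemma tractableI:
  assumes C1: "\<And>\<epsilon> d. 1 \<le> C \<epsilon> d" and a: "1 \<le> a"
    and C2: "\<And>\<epsilon> d. 1 \<le> d \<Longrightarrow> 0 < \<epsilon> \<Longrightarrow> C \<epsilon> d \<le> ereal (a * (real d + 1 / \<epsilon>) ^ k)"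
  shows "tractable C"
  unfolding tractable_def
proof (intro conjI allI impI)
  show "C \<epsilon> d < \<infinity>" if "1 \<le> d" "0 < \<epsilon>" for d \<epsilon>
    using C2[OF that] by (auto intro: le_less_trans)
  let ?s = "\<lambda>(d, \<epsilon>). real d + 1 / \<epsilon>"
  let ?u = "\<lambda>s. (ln a + real k * ln s) / s"
  have "(?u \<longlongrightarrow> 0) at_top"
  proof -
    have 1: "((\<lambda>s::real. ln a / s) \<longlongrightarrow> 0) at_top"
      by (intro tendsto_divide_0[OF tendsto_const] filterlim_at_top_imp_at_infinity filterlim_ident)
    have 2: "((\<lambda>s::real. real k * (ln s / s)) \<longlongrightarrow> real k * 0) at_top"
      by (intro tendsto_mult tendsto_const ln_x_over_x_tendsto_0)
    show ?thesis using tendsto_add[OF 1 2] by (simp add: add_divide_distrib)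
  qed
  moreover have "filterlim ?s at_top tractability_filter"
    unfolding tractability_filter_def by (rule filterlim_mono[OF filterlim_filtercomap order.refl inf_le1])
  ultimately have u: "((\<lambda>p. ?u (?s p)) \<longlongrightarrow> 0) tractability_filter"
    by (rule filterlim_compose)
  have ev: "eventually P tractability_filter" if "\<And>d \<epsilon>. 1 \<le> d \<Longrightarrow> 0 < \<epsilon> \<Longrightarrow> P (d, \<epsilon>)" for P
    unfolding tractability_filter_def eventually_inf_principal using that by (auto intro: always_eventually)
  have bounds: "0 \<le> ln (real_of_ereal (C \<epsilon> d))" "ln (real_of_ereal (C \<epsilon> d)) \<le> ln a + real k * ln (?s (d, \<epsilon>))"
    "0 < ?s (d, \<epsilon>)" if "1 \<le> d" "0 < \<epsilon>" for d \<epsilon>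
  proof -
    define s where "s = real d + 1 / \<epsilon>"
    have s: "0 < s" unfolding s_def using that by (intro add_pos_pos) auto
    note C2' = C2[OF that]
    obtain r where r: "C \<epsilon> d = ereal r" using C1[of \<epsilon> d] C2' by (cases "C \<epsilon> d") auto
    have "1 \<le> r" "r \<le> a * s ^ k" using C1[of \<epsilon> d] C2' unfolding r s_def by simp_all
    then have "0 \<le> ln r" "ln r \<le> ln (a * s ^ k)" by simp_all
    moreover have "ln (a * s ^ k) = ln a + real k * ln s" using a s by (simp add: ln_mult ln_realpow)
    ultimately show "0 \<le> ln (real_of_ereal (C \<epsilon> d))" "ln (real_of_ereal (C \<epsilon> d)) \<le> ln a + real k * ln (?s (d, \<epsilon>))"
      "0 < ?s (d, \<epsilon>)" using s by (simp_all add: r s_def)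
  qed
  show "((\<lambda>(d, \<epsilon>). ln (real_of_ereal (C \<epsilon> d)) / (real d + 1 / \<epsilon>)) \<longlongrightarrow> 0) tractability_filter"
  proof (rule tendsto_sandwich[OF _ _ tendsto_const u])
    show "\<forall>\<^sub>F p in tractability_filter. 0 \<le> (case p of (d, \<epsilon>) \<Rightarrow> ln (real_of_ereal (C \<epsilon> d)) / (real d + 1 / \<epsilon>))"
      using bounds by (intro ev) (auto intro!: divide_nonneg_pos)
    show "\<forall>\<^sub>F p in tractability_filter. (case p of (d, \<epsilon>) \<Rightarrow> ln (real_of_ereal (C \<epsilon> d)) / (real d + 1 / \<epsilon>)) \<le> ?u (?s p)"
      using bounds by (intro ev) (simp add: divide_right_mono less_imp_le)
  qed
qed

theorem mainTheorem2:
  shows "\<exists>K::real. K > 0 \<and> (\<forall>pL p\<Lambda> p\<delta> pA :: real poly. \<exists>q :: real poly.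
    \<forall>H G M x0 b \<delta> \<Lambda> L. mesh_problem pL p\<Lambda> p\<delta> pA H G M x0 b \<delta> \<Lambda> L \<longrightarrow>
      (\<forall>d\<ge>1. \<forall>\<epsilon>. 0 < \<epsilon> \<and> \<epsilon> \<le> 2 * (real H + 1) * G \<longrightarrow>
         mesh_complexity H (M d) (b d) (x0 d) \<epsilon> d
           \<le> ereal (K * (real H ^ 9 * G ^ 4 / \<epsilon> ^ 4) * poly q (real d))) \<and>
      tractable (\<lambda>\<epsilon> d. mesh_complexity H (M d) (b d) (x0 d) \<epsilon> d))"
proof (intro exI[of _ "4096::real"] conjI allI)
  fix pL p\<Lambda> p\<delta> pA :: "real poly"
  define q where "q = noise_poly pL p\<Lambda> p\<delta> pA"
  show "\<exists>q :: real poly. \<forall>H G M x0 b \<delta> \<Lambda> L. mesh_problem pL p\<Lambda> p\<delta> pA H G M x0 b \<delta> \<Lambda> L \<longrightarrow>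
      (\<forall>d\<ge>1. \<forall>\<epsilon>. 0 < \<epsilon> \<and> \<epsilon> \<le> 2 * (real H + 1) * G \<longrightarrow>
         mesh_complexity H (M d) (b d) (x0 d) \<epsilon> d
           \<le> ereal (4096 * (real H ^ 9 * G ^ 4 / \<epsilon> ^ 4) * poly q (real d))) \<and>
      tractable (\<lambda>\<epsilon> d. mesh_complexity H (M d) (b d) (x0 d) \<epsilon> d)"
  proof (intro exI[of _ "q ^ 4"] allI impI conjI)
    fix H G M x0 b \<delta> \<Lambda> L
    assume prob: "mesh_problem pL p\<Lambda> p\<delta> pA H G M x0 b \<delta> \<Lambda> L"
    then have H: "1 \<le> H" by (simp add: mesh_problem_def)
    have q1: "1 \<le> poly q (real d)" if "1 \<le> d" for d
      unfolding q_def by (rule mesh_error_problem_le(2)[OF prob that, of "max G 1" 2]) auto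
    show "mesh_complexity H (M d) (b d) (x0 d) \<epsilon> d
        \<le> ereal (4096 * (real H ^ 9 * G ^ 4 / \<epsilon> ^ 4) * poly (q ^ 4) (real d))"
      if d: "1 \<le> d" and \<epsilon>: "0 < \<epsilon> \<and> \<epsilon> \<le> 2 * (real H + 1) * G" for d \<epsilon>
    proof -
      have "0 < 2 * (real H + 1) * G" using \<epsilon> by linarith
      then have G: "0 < G" by (simp add: zero_less_mult_iff)
      define X where "X = 16 * real H ^ 4 * G ^ 2 * poly q (real d) ^ 2 / \<epsilon> ^ 2"
      \<comment> \<open>The upper bound on \<epsilon> makes \<open>X \<ge> 1\<close>, which lets the
        rounding term 3 be absorbed into \<open>4 * X\<close>.\<close>
      have "\<epsilon> \<le> 4 * real H * G"
      proof -
        have "2 * (real H + 1) * G \<le> 4 * real H * G" using H G by (intro mult_right_mono) auto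
        with \<epsilon> show ?thesis by linarith
      qed
      also have "\<dots> \<le> 4 * real H ^ 2 * G * poly q (real d)"
      proof -
        have "4 * real H * G * 1 \<le> 4 * real H ^ 2 * G * poly q (real d)"
          using H G q1[OF d] by (intro mult_mono mult_right_mono) (auto simp: self_le_power)
        then show ?thesis by simp
      qed
      finally have "1 \<le> 4 * real H ^ 2 * G * poly q (real d) / \<epsilon>" using \<epsilon> by (simp add: field_simps)
      then have "1 \<le> (4 * real H ^ 2 * G * poly q (real d) / \<epsilon>) ^ 2" by (rule one_le_power)
      then have X1: "1 \<le> X" unfolding X_def by (simp add: power_divide power_mult_distrib)
      have "mesh_complexity H (M d) (b d) (x0 d) \<epsilon> d \<le> ereal (real H * (X + 3) ^ 2)"
        unfolding X_def q_def using \<epsilon> G by (intro mesh_complexity_le[OF prob d]) auto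
      also have "real H * (X + 3) ^ 2 \<le> real H * (4 * X) ^ 2"
        using X1 by (intro mult_left_mono power_mono) auto
      \<comment> \<open>\<open>16 * H * X^2\<close> with the factor 16 in \<open>X\<close>: hence
        \<open>4096 = 16 * 16^2\<close>, and the fourth power of the noise polynomial.\<close>
      also have "real H * (4 * X) ^ 2 = 4096 * (real H ^ 9 * G ^ 4 / \<epsilon> ^ 4) * poly (q ^ 4) (real d)"
        unfolding X_def by (simp add: power_divide power_mult_distrib poly_power eval_nat_numeral ac_simps)
      finally show ?thesis by simp
    qed
    show "tractable (\<lambda>\<epsilon> d. mesh_complexity H (M d) (b d) (x0 d) \<epsilon> d)"
    proof -
      \<comment> \<open>Tractability concerns all \<epsilon> and includes \<open>G = 0\<close>, so a
        positive substitute for \<open>G\<close> is used and the rounding term 3 stays as an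
        additive constant in \<open>a\<close>.\<close>
      define G' where "G' = max G 1"
      obtain c m where c: "0 \<le> c" "\<And>x. 1 \<le> x \<Longrightarrow> \<bar>poly q x\<bar> \<le> c * x ^ m" using poly_growth by blast
      define a where "a = 16 * real H ^ 4 * G' ^ 2 * c ^ 2 + 3"
      have a: "3 \<le> a" unfolding a_def by simp
      show ?thesis
      proof (rule tractableI[where a = "real H * a ^ 2" and k = "2 * (2 * m + 2)"])
        show "1 \<le> mesh_complexity H (M d) (b d) (x0 d) \<epsilon> d" for \<epsilon> d by (rule mesh_complexity_ge[OF H])
        have "1 * 1 \<le> real H * a ^ 2" using H a by (intro mult_mono one_le_power) auto
        then show "1 \<le> real H * a ^ 2" by simp
        fix \<epsilon> :: real and d :: nat assume d: "1 \<le> d" and \<epsilon>: "0 < \<epsilon>"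
        define s where "s = real d + 1 / \<epsilon>"
        have s: "real d \<le> s" "1 \<le> s" "1 / \<epsilon> \<le> s" unfolding s_def using d \<epsilon> by (auto simp: add_increasing2)
        have qs: "poly q (real d) \<le> c * s ^ m"
        proof -
          have "poly q (real d) \<le> c * real d ^ m" using c(2)[of "real d"] d by (simp add: abs_le_iff)
          also have "\<dots> \<le> c * s ^ m" using c(1) s by (intro mult_left_mono power_mono) auto
          finally show ?thesis .
        qed
        have "16 * real H ^ 4 * G' ^ 2 * poly q (real d) ^ 2 / \<epsilon> ^ 2 = 16 * real H ^ 4 * G' ^ 2 * (poly q (real d) ^ 2 * (1 / \<epsilon>) ^ 2)"
          by (simp add: power_divide)
        also have "\<dots> \<le> 16 * real H ^ 4 * G' ^ 2 * ((c * s ^ m) ^ 2 * s ^ 2)"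
          using qs q1[OF d] s \<epsilon> by (intro mult_left_mono mult_mono power_mono) auto
        also have "\<dots> = 16 * real H ^ 4 * G' ^ 2 * c ^ 2 * s ^ (2 * m + 2)"
        proof -
          have "s ^ (2 * m + 2) = (s ^ m) ^ 2 * s ^ 2"
            unfolding power_add power_mult[of s m 2, symmetric] by (simp add: mult.commute)
          then show ?thesis by (simp add: power_mult_distrib)
        qed
        finally have "16 * real H ^ 4 * G' ^ 2 * poly q (real d) ^ 2 / \<epsilon> ^ 2 + 3
            \<le> 16 * real H ^ 4 * G' ^ 2 * c ^ 2 * s ^ (2 * m + 2) + 3 * s ^ (2 * m + 2)"
          using one_le_power[OF s(2), of "2 * m + 2"] by linarith
        also have "\<dots> = a * s ^ (2 * m + 2)" unfolding a_def by (simp add: algebra_simps)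
        finally have X: "16 * real H ^ 4 * G' ^ 2 * poly q (real d) ^ 2 / \<epsilon> ^ 2 + 3 \<le> a * s ^ (2 * m + 2)" .
        have "mesh_complexity H (M d) (b d) (x0 d) \<epsilon> d
            \<le> ereal (real H * (16 * real H ^ 4 * G' ^ 2 * poly q (real d) ^ 2 / \<epsilon> ^ 2 + 3) ^ 2)"
          unfolding q_def using \<epsilon> by (intro mesh_complexity_le[OF prob d]) (auto simp: G'_def)
        also have "real H * (16 * real H ^ 4 * G' ^ 2 * poly q (real d) ^ 2 / \<epsilon> ^ 2 + 3) ^ 2 \<le> real H * (a * s ^ (2 * m + 2)) ^ 2"
          using X by (intro mult_left_mono power_mono) auto
        also have "\<dots> = real H * a ^ 2 * s ^ (2 * (2 * m + 2))"
          by (simp only: power_mult_distrib power_even_eq mult.assoc)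
        finally show "mesh_complexity H (M d) (b d) (x0 d) \<epsilon> d \<le> ereal (real H * a ^ 2 * (real d + 1 / \<epsilon>) ^ (2 * (2 * m + 2)))"
          unfolding s_def by simp
      qed
    qed
  qed
qed simp

end
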